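(* Let $u\in L^\infty(\mathbb{R}^d)$, let $b\in BV_{loc}(\mathbb{R}^d;\mathbb{R}^d)$ with $\operatorname{div}b\in L^1_{loc}(\mathbb{R}^d)$, and let $\theta\in C_c^\infty(\mathbb{R}^d)$ be a smooth even nonnegative convolution kernel with $\operatorname{supp}\theta\subset B_1$. For $\varepsilon>0$ let $$r_\varepsilon:=b\cdot\nabla(u\ast\theta_\varepsilon)-(b\cdot\nabla u)\ast\theta_\varepsilon .$$ Then there exist an even convolution kernel $\rho$ with $\operatorname{supp}\rho\subset B_1$ and a constant $C_\theta$ depending only on $\theta$ (and $d$) such that, for every $\varepsilon>0$ and every measurable $\varphi:\mathbb{R}^d\to\mathbb{R}$, $$\int_{\mathbb{R}^d}|r_\varepsilon\varphi|\,dx\le C_\theta\,\|u\|_{L^\infty((\operatorname{supp}\varphi)_\varepsilon)}\int_{\mathbb{R}^d}(|\varphi|\ast\rho_\varepsilon)\,d|Db|,$$ where $(\operatorname{supp}\varphi)_\varepsilon=\{x\in\mathbb{R}^d:\operatorname{dist}(x,\operatorname{supp}\varphi)\le\varepsilon\}$. Consequently, for a.e. $x\in\mathbb{R}^d$, $$|r_\varepsilon|(x)\le C_\theta\,\|u\|_{L^\infty(B(x,\varepsilon))}\,(|Db|\ast\rho_\varepsilon)(x).$$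
   Context: A convolution kernel on $\mathbb{R}^d$ is a nonnegative integrable function with integral $1$; even means $\theta(-x)=\theta(x)$. For a kernel $\theta$ and $\varepsilon>0$, $\theta_\varepsilon(x)=\varepsilon^{-d}\theta(x/\varepsilon)$ (likewise $\rho_\varepsilon$). $B_1$ is the unit ball of $\mathbb{R}^d$ centred at the origin and $B(x,\varepsilon)$ the ball of centre $x$ and radius $\varepsilon$ (balls may be taken closed). $|Db|$ is the total variation measure of the matrix-valued Radon measure $Db$ (distributional derivative of $b$), and $(|Db|\ast\rho_\varepsilon)(x)=\int\rho_\varepsilon(x-y)\,d|Db|(y)$. The distribution $b\cdot\nabla u$ is defined by $b\cdot\nabla u=\operatorname{div}(bu)-u\operatorname{div}b$, so that $$\big((b\cdot\nabla u)\ast\theta_\varepsilon\big)(x)=-\int u(y)\big[\theta_\varepsilon(x-y)\operatorname{div}b(y)+b(y)\cdot\nabla_y(\theta_\varepsilon(x-y))\big]dy .$$ Integrals of nonnegative functions take values in $[0,\infty]$, with the convention $0\cdot\infty=0$. *)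

theory Defs
  imports "HOL-Analysis.Analysis" "HOL-Probability.Essential_Supremum"
begin

definition grad :: "(real^'n \<Rightarrow> real) \<Rightarrow> real^'n \<Rightarrow> real^'n" where
  "grad f x = (\<chi> i. frechet_derivative f (at x) (axis i 1))"

fun iterated_partial :: "'n list \<Rightarrow> (real^'n \<Rightarrow> real) \<Rightarrow> real^'n \<Rightarrow> real" where
  "iterated_partial [] f = f"
| "iterated_partial (i # is) f = (\<lambda>x. grad (iterated_partial is f) x $ i)"

text \<open>Class \<open>C\<^sup>\<infinity>\<close>: every iterated partial derivative, of any order, is (Frechet) differentiable
  everywhere, hence also continuous.\<close>

definition smooth :: "(real^'n \<Rightarrow> real) \<Rightarrow> bool" where
  "smooth f \<longleftrightarrow> (\<forall>is. iterated_partial is f differentiable_on UNIV)"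

definition supp :: "(real^'n \<Rightarrow> real) \<Rightarrow> (real^'n) set" where
  "supp f = closure {x. f x \<noteq> 0}"

definition test_function :: "(real^'n \<Rightarrow> real) \<Rightarrow> bool" where
  "test_function f \<longleftrightarrow> smooth f \<and> compact (supp f)"

text \<open>Integrability over \<open>lborel\<close> makes a kernel Borel measurable, so that it can be integrated
  pointwise against measures that are singular with respect to Lebesgue measure.\<close>

definition convolution_kernel :: "(real^'n \<Rightarrow> real) \<Rightarrow> bool" where
  "convolution_kernel f \<longleftrightarrow> (\<forall>x. 0 \<le> f x) \<and> integrable lborel f \<and> integral\<^sup>L lborel f = 1"

definition even_fun :: "(real^'n \<Rightarrow> real) \<Rightarrow> bool" where
  "even_fun f \<longleftrightarrow> (\<forall>x. f (- x) = f x)"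

definition rescale :: "real \<Rightarrow> (real^'n \<Rightarrow> real) \<Rightarrow> real^'n \<Rightarrow> real" where
  "rescale \<epsilon> f x = f (x /\<^sub>R \<epsilon>) / \<epsilon> ^ CARD('n)"

text \<open>The guard matters because \<open>infdist x {} = 0\<close>, whereas \<open>dist(x, \<emptyset>) = \<infinity>\<close>
  is meant here.\<close>

definition closed_nbhd :: "real \<Rightarrow> (real^'n) set \<Rightarrow> (real^'n) set" where
  "closed_nbhd \<epsilon> S = {x. S \<noteq> {} \<and> infdist x S \<le> \<epsilon>}"

definition Linf_norm_on :: "(real^'n) set \<Rightarrow> (real^'n \<Rightarrow> real) \<Rightarrow> ennreal" where
  "Linf_norm_on A u = esssup (restrict_space lebesgue A) (\<lambda>x. ennreal \<bar>u x\<bar>)"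

definition Linfty :: "(real^'n \<Rightarrow> real) \<Rightarrow> bool" where
  "Linfty u \<longleftrightarrow> u \<in> borel_measurable lebesgue \<and> Linf_norm_on UNIV u < \<infinity>"

definition locally_integrable :: "(real^'n \<Rightarrow> 'b::euclidean_space) \<Rightarrow> bool" where
  "locally_integrable f \<longleftrightarrow> (\<forall>K. compact K \<longrightarrow> f absolutely_integrable_on K)"

text \<open>The function \<open>g\<close> represents the distributional divergence of \<open>b\<close>.\<close>

definition weak_divergence :: "(real^'n \<Rightarrow> real^'n) \<Rightarrow> (real^'n \<Rightarrow> real) \<Rightarrow> bool" where
  "weak_divergence b g \<longleftrightarrow>
    (\<forall>\<psi>. test_function \<psi> \<longrightarrow>
      (\<integral>x. b x \<bullet> grad \<psi> x \<partial>lebesgue) = - (\<integral>x. \<psi> x * g x \<partial>lebesgue))"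

text \<open>On \<open>\<real>\<^sup>d\<close> every locally finite Borel measure is automatically regular.\<close>

definition radon_measure :: "(real^'n) measure \<Rightarrow> bool" where
  "radon_measure M \<longleftrightarrow> sets M = sets borel \<and> (\<forall>K. compact K \<longrightarrow> emeasure M K < \<infinity>)"

text \<open>A matrix-valued Radon measure is a set function \<open>\<mu>\<close> on the bounded Borel sets whose entries
  are signed Radon measures, that is, differences of two positive Radon measures
  \<open>P i j\<close> and \<open>N i j\<close>. The values of \<open>\<mu>\<close> on other sets are irrelevant.\<close>

definition matrix_radon_measure ::
  "((real^'n) set \<Rightarrow> real^'n^'n) \<Rightarrow> ('n \<Rightarrow> 'n \<Rightarrow> (real^'n) measure) \<Rightarrow>
   ('n \<Rightarrow> 'n \<Rightarrow> (real^'n) measure) \<Rightarrow> bool" where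
  "matrix_radon_measure \<mu> P N \<longleftrightarrow>
    (\<forall>i j. radon_measure (P i j) \<and> radon_measure (N i j)) \<and>
    (\<forall>A \<in> sets borel. bounded A \<longrightarrow>
      (\<forall>i j. \<mu> A $ i $ j = measure (P i j) A - measure (N i j) A))"

text \<open>\<open>derivative_measure b \<mu>\<close> states that \<open>\<mu>\<close> is the distributional derivative \<open>Db\<close>; its entry
  \<open>(i, j)\<close> is the \<open>j\<close>-th partial derivative of \<open>b\<^sub>i\<close>. The integral of \<open>\<psi>\<close> against
  a signed measure \<open>P i j - N i j\<close> does not depend on the choice of \<open>P\<close> and \<open>N\<close>.\<close>

definition derivative_measure ::
  "(real^'n \<Rightarrow> real^'n) \<Rightarrow> ((real^'n) set \<Rightarrow> real^'n^'n) \<Rightarrow> bool" where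
  "derivative_measure b \<mu> \<longleftrightarrow>
    (\<exists>P N. matrix_radon_measure \<mu> P N \<and>
      (\<forall>\<psi>. test_function \<psi> \<longrightarrow>
        (\<forall>i j. (\<integral>x. b x $ i * grad \<psi> x $ j \<partial>lebesgue) =
               - ((\<integral>x. \<psi> x \<partial>P i j) - (\<integral>x. \<psi> x \<partial>N i j)))))"

text \<open>\<open>b\<close> is of class \<open>BV\<^sub>l\<^sub>o\<^sub>c\<close> and \<open>Db\<close> is its derivative. As a set function on bounded Borel
  sets, \<open>Db\<close> is determined by \<open>b\<close>.\<close>

definition BV_loc :: "(real^'n \<Rightarrow> real^'n) \<Rightarrow> ((real^'n) set \<Rightarrow> real^'n^'n) \<Rightarrow> bool" where
  "BV_loc b Db \<longleftrightarrow> locally_integrable b \<and> derivative_measure b Db"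

text \<open>The total variation of a matrix-valued Radon measure: the supremum over countable partitions
  into bounded Borel sets. The norm of type \<open>real^'n^'n\<close> is the Euclidean (Frobenius) norm. For
  a set function as in \<open>matrix_radon_measure\<close> this is countably additive, so that
  \<open>measure_of\<close> yields a measure with exactly these values on Borel sets.\<close>

definition total_variation :: "((real^'n) set \<Rightarrow> real^'n^'n) \<Rightarrow> (real^'n) measure" where
  "total_variation \<mu> = measure_of UNIV (sets borel)
    (\<lambda>A. SUP E \<in> {E :: nat \<Rightarrow> (real^'n) set.
                    (\<forall>h. E h \<in> sets borel \<and> bounded (E h)) \<and> disjoint_family E \<and> (\<Union>h. E h) = A}.
           \<Sum>h. ennreal (norm (\<mu> (E h))))"

definition conv :: "(real^'n \<Rightarrow> real) \<Rightarrow> (real^'n \<Rightarrow> real) \<Rightarrow> real^'n \<Rightarrow> real" where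
  "conv u \<theta> x = (\<integral>y. u y * \<theta> (x - y) \<partial>lebesgue)"

text \<open>\<open>|\<phi>| \<star> \<rho>\<close> and, for a positive measure \<open>M\<close>, \<open>M \<star> \<rho>\<close>, with values in
  \<open>[0, \<infinity>]\<close>.\<close>

definition abs_conv :: "(real^'n \<Rightarrow> real) \<Rightarrow> (real^'n \<Rightarrow> real) \<Rightarrow> real^'n \<Rightarrow> ennreal" where
  "abs_conv \<phi> \<rho> x = (\<integral>\<^sup>+y. ennreal \<bar>\<phi> y\<bar> * ennreal (\<rho> (x - y)) \<partial>lebesgue)"

definition measure_conv :: "(real^'n) measure \<Rightarrow> (real^'n \<Rightarrow> real) \<Rightarrow> real^'n \<Rightarrow> ennreal" where
  "measure_conv M \<rho> x = (\<integral>\<^sup>+y. ennreal (\<rho> (x - y)) \<partial>M)"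

text \<open>The distribution \<open>b \<cdot> \<nabla>u = div (b u) - u div b\<close>, as a functional on test functions.
  The argument \<open>divb\<close> is the divergence of \<open>b\<close>.\<close>

definition transport_distr ::
  "(real^'n \<Rightarrow> real^'n) \<Rightarrow> (real^'n \<Rightarrow> real) \<Rightarrow> (real^'n \<Rightarrow> real) \<Rightarrow> (real^'n \<Rightarrow> real) \<Rightarrow> real" where
  "transport_distr b divb u \<psi> = - (\<integral>y. u y * (\<psi> y * divb y + b y \<bullet> grad \<psi> y) \<partial>lebesgue)"

definition distr_conv :: "((real^'n \<Rightarrow> real) \<Rightarrow> real) \<Rightarrow> (real^'n \<Rightarrow> real) \<Rightarrow> real^'n \<Rightarrow> real" where
  "distr_conv T \<theta> x = T (\<lambda>y. \<theta> (x - y))"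

definition commutator ::
  "(real^'n \<Rightarrow> real) \<Rightarrow> (real^'n \<Rightarrow> real^'n) \<Rightarrow> (real^'n \<Rightarrow> real) \<Rightarrow> (real^'n \<Rightarrow> real) \<Rightarrow> real \<Rightarrow>
   real^'n \<Rightarrow> real" where
  "commutator u b divb \<theta> \<epsilon> x =
    b x \<bullet> grad (conv u (rescale \<epsilon> \<theta>)) x
    - distr_conv (transport_distr b divb u) (rescale \<epsilon> \<theta>) x"

end

theory Submission
  imports Defs
begin

text \<open>Write \<open>M = |Db|\<close>. Differentiating \<open>u \<star> \<theta>\<^sub>\<epsilon>\<close> under the integral gives
  \[ r_\varepsilon(x) = \int u(y)\,[(b(x) - b(y)) \cdot \nabla\theta_\varepsilon(x - y)
     + \theta_\varepsilon(x - y) \operatorname{div} b(y)]\,dy, \]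
  whose integrand vanishes outside \<open>B(x, \<epsilon>)\<close>. The divergence is the trace of \<open>Db\<close>, so
  \<open>|div b| dx \<le> d M\<close>. For fixed \<open>h\<close>, integrating the derivative of a mollification of \<open>b\<^sub>i\<close>
  along the segment from \<open>x\<close> to \<open>x - h\<close> and removing the mollification yields the inequality of
  measures \<open>|b\<^sub>i(x) - b\<^sub>i(x - h)| dx \<le> |h|\<^sub>1 \<integral>\<^sub>0\<^sup>1 (\<tau>\<^sub>t\<^sub>h)\<^sub># M dt\<close>. Integrating this over \<open>|h| \<le> \<epsilon>\<close>
  and substituting \<open>x = t h\<close> turns the right-hand side into a convolution of \<open>M\<close> with the kernel
  \<open>\<integral>\<^sub>0\<^sup>1 t\<^sup>-\<^sup>d k(x / t) dt\<close>, \<open>k(x) = |x| 1\<^bsub>|x| \<le> 1\<^esub>\<close>, which is integrable although, for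
  \<open>d > 1\<close>, unbounded at the origin. This proves the pointwise estimate for almost every \<open>x\<close>, and the integral estimate
  follows from it by Fubini's theorem.\<close>

subsection \<open>Smooth functions and their translates\<close>

lemma has_derivative_grad:
  fixes f :: "real^'n \<Rightarrow> real"
  assumes "f differentiable at x"
  shows "(f has_derivative (\<lambda>h. grad f x \<bullet> h)) (at x)"
proof -
  have d: "(f has_derivative frechet_derivative f (at x)) (at x)"
    using assms frechet_derivative_works by blast
  then have lin: "linear (frechet_derivative f (at x))"
    by (rule has_derivative_linear)
  have "frechet_derivative f (at x) = (\<lambda>h. grad f x \<bullet> h)"
  proof
    fix h
    have "frechet_derivative f (at x) h = frechet_derivative f (at x) (\<Sum>i\<in>UNIV. h $ i *\<^sub>R axis i 1)"
      using basis_expansion[of h] by (simp add: scalar_mult_eq_scaleR)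
    also have "\<dots> = (\<Sum>i\<in>UNIV. h $ i * frechet_derivative f (at x) (axis i 1))"
      using lin by (simp add: linear_sum linear_cmul)
    also have "\<dots> = grad f x \<bullet> h"
      by (simp add: grad_def inner_vec_def mult.commute)
    finally show "frechet_derivative f (at x) h = grad f x \<bullet> h" .
  qed
  then show ?thesis using d by simp
qed

lemma grad_eqI:
  fixes f :: "real^'n \<Rightarrow> real"
  assumes "(f has_derivative (\<lambda>h. v \<bullet> h)) (at x)"
  shows "grad f x = v"
proof -
  have "frechet_derivative f (at x) = (\<lambda>h. v \<bullet> h)"
    using frechet_derivative_at[OF assms] by simp
  then show ?thesis by (simp add: grad_def vec_eq_iff inner_axis)
qed

lemma has_derivative_affine:
  fixes f :: "real^'n \<Rightarrow> real"
  assumes "f differentiable at (a *\<^sub>R y + v)"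
  shows "((\<lambda>y. c * f (a *\<^sub>R y + v)) has_derivative (\<lambda>h. ((c * a) *\<^sub>R grad f (a *\<^sub>R y + v)) \<bullet> h)) (at y)"
proof -
  have "((\<lambda>y. a *\<^sub>R y + v) has_derivative (\<lambda>h. a *\<^sub>R h)) (at y)"
    by (auto intro!: derivative_eq_intros)
  from has_derivative_compose[OF this has_derivative_grad[OF assms]]
  have "((\<lambda>y. f (a *\<^sub>R y + v)) has_derivative (\<lambda>h. grad f (a *\<^sub>R y + v) \<bullet> (a *\<^sub>R h))) (at y)" .
  from has_derivative_mult_right[OF this, of c] show ?thesis
    by (simp add: algebra_simps)
qed

lemma grad_affine:
  fixes f :: "real^'n \<Rightarrow> real"
  assumes "f differentiable at (a *\<^sub>R y + v)"
  shows "grad (\<lambda>y. c * f (a *\<^sub>R y + v)) y = (c * a) *\<^sub>R grad f (a *\<^sub>R y + v)"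
  by (rule grad_eqI[OF has_derivative_affine[OF assms]])

lemma smooth_imp_differentiable: "smooth f \<Longrightarrow> f differentiable at x"
  unfolding smooth_def differentiable_on_def by (metis UNIV_I iterated_partial.simps(1))

lemma iterated_partial_differentiable: "smooth f \<Longrightarrow> iterated_partial is f differentiable at x"
  unfolding smooth_def differentiable_on_def by blast

lemma iterated_partial_affine:
  fixes f :: "real^'n \<Rightarrow> real"
  assumes "smooth f"
  shows "iterated_partial is (\<lambda>y. c * f (a *\<^sub>R y + v))
    = (\<lambda>y. (c * a ^ length is) * iterated_partial is f (a *\<^sub>R y + v))"
proof (induction "is")
  case (Cons i "is")
  show ?case
    by (rule ext) (simp add: Cons.IH grad_affine iterated_partial_differentiable[OF assms])
qed simp

lemma smooth_affine:
  fixes f :: "real^'n \<Rightarrow> real"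
  assumes "smooth f"
  shows "smooth (\<lambda>y. c * f (a *\<^sub>R y + v))"
  unfolding smooth_def differentiable_on_def iterated_partial_affine[OF assms]
  using has_derivative_affine[OF iterated_partial_differentiable[OF assms]] differentiable_def by blast

lemma compact_suppI:
  fixes f :: "real^'n \<Rightarrow> real"
  assumes "\<And>y. f y \<noteq> 0 \<Longrightarrow> y \<in> cball x r"
  shows "compact (supp f)" "supp f \<subseteq> cball x r"
proof -
  show *: "supp f \<subseteq> cball x r" unfolding supp_def
    by (rule closure_minimal) (use assms in auto)
  then have "bounded (supp f)" using bounded_cball bounded_subset by blast
  then show "compact (supp f)" by (simp add: compact_eq_bounded_closed supp_def)
qed

lemma supp_I: "f x \<noteq> 0 \<Longrightarrow> x \<in> supp f"
  unfolding supp_def using closure_subset by fastforce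

lemma rescale_eq_affine:
  fixes f :: "real^'n \<Rightarrow> real"
  shows "rescale \<epsilon> f = (\<lambda>y. inverse (\<epsilon> ^ CARD('n)) * f (inverse \<epsilon> *\<^sub>R y + 0))"
    "(\<lambda>y. rescale \<epsilon> f (x - y)) =
       (\<lambda>y. inverse (\<epsilon> ^ CARD('n)) * f ((- inverse \<epsilon>) *\<^sub>R y + inverse \<epsilon> *\<^sub>R x))"
  by (simp_all add: rescale_def fun_eq_iff algebra_simps divide_inverse)

lemma rescale_eq_0:
  fixes f :: "real^'n \<Rightarrow> real"
  assumes "supp f \<subseteq> cball 0 1" "\<epsilon> > 0" "norm x > \<epsilon>"
  shows "rescale \<epsilon> f x = 0"
proof -
  have "norm (x /\<^sub>R \<epsilon>) > 1" using assms by (simp add: field_simps)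
  then show ?thesis using supp_I[of f "x /\<^sub>R \<epsilon>"] assms(1) by (force simp: rescale_def)
qed

lemma smooth_rescale: "smooth f \<Longrightarrow> smooth (rescale \<epsilon> f)"
  unfolding rescale_eq_affine by (rule smooth_affine)

lemma test_function_rescale:
  fixes f :: "real^'n \<Rightarrow> real"
  assumes "smooth f" "supp f \<subseteq> cball 0 1" "\<epsilon> > 0"
  shows "test_function (rescale \<epsilon> f)" "test_function (\<lambda>y. rescale \<epsilon> f (x - y))"
proof -
  have "compact (supp (rescale \<epsilon> f))"
    by (rule compact_suppI[of _ 0 \<epsilon>]) (use assms rescale_eq_0 in \<open>force simp: not_less[symmetric]\<close>)
  then show "test_function (rescale \<epsilon> f)"
    using smooth_rescale[OF assms(1)] by (simp add: test_function_def)
  have "compact (supp (\<lambda>y. rescale \<epsilon> f (x - y)))"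
    by (rule compact_suppI[of _ x \<epsilon>]) (use assms rescale_eq_0 in \<open>force simp: not_less[symmetric] dist_norm\<close>)
  moreover have "smooth (\<lambda>y. rescale \<epsilon> f (x - y))"
    unfolding rescale_eq_affine(2) by (rule smooth_affine[OF assms(1)])
  ultimately show "test_function (\<lambda>y. rescale \<epsilon> f (x - y))"
    by (simp add: test_function_def)
qed

lemma grad_reflect:
  fixes f :: "real^'n \<Rightarrow> real"
  assumes "smooth f"
  shows "grad (\<lambda>y. f (x - y)) y = - grad f (x - y)"
  using grad_affine[of f "-1" y x 1] smooth_imp_differentiable[OF assms] by (simp add: algebra_simps)

lemma continuous_grad:
  assumes "smooth f"
  shows "continuous_on UNIV (grad f)"
proof -
  have "continuous_on UNIV (\<lambda>x. grad f x $ i)" for i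
    using iterated_partial_differentiable[OF assms, of "[i]"]
    by (auto intro!: continuous_at_imp_continuous_on differentiable_imp_continuous_within)
  then show ?thesis
    by (subst continuous_on_componentwise) (auto simp: Basis_vec_def inner_axis)
qed

lemma smooth_continuous: "smooth f \<Longrightarrow> continuous_on UNIV f"
  by (auto intro!: continuous_at_imp_continuous_on differentiable_imp_continuous_within
    smooth_imp_differentiable)

lemma grad_eq_0:
  fixes f :: "real^'n \<Rightarrow> real"
  assumes "x \<notin> supp f"
  shows "grad f x = 0"
proof -
  have "open (- supp f)" by (simp add: supp_def open_Compl)
  moreover have "f y = 0" if "y \<in> - supp f" for y using that supp_I[of f y] by auto
  ultimately have "(f has_derivative (\<lambda>h. 0)) (at x)"
    using has_derivative_transform_within_open[of "\<lambda>_. 0" "\<lambda>_. 0" x UNIV "- supp f" f] assms by auto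
  then show ?thesis using grad_eqI[of f 0 x] by simp
qed

lemma continuous_zero_outside_bounded:
  fixes f :: "real^'n \<Rightarrow> 'b::real_normed_vector"
  assumes "continuous_on UNIV f" "\<And>x. x \<notin> cball 0 r \<Longrightarrow> f x = 0"
  obtains B where "B > 0" "\<And>x. norm (f x) \<le> B"
proof -
  have "bounded (f ` cball 0 r)"
    using assms(1) by (meson compact_cball compact_continuous_image compact_imp_bounded continuous_on_subset subset_UNIV)
  then obtain B where B: "B > 0" "\<And>x. x \<in> cball 0 r \<Longrightarrow> norm (f x) \<le> B"
    by (auto simp: bounded_pos)
  then show thesis using that[of B] assms(2) by (metis norm_zero less_imp_le)
qed

text \<open>The remainder of the first-order expansion is uniform because a continuous gradient of compact
  support is uniformly continuous.\<close>

lemma uniformly_differentiable: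
  fixes f :: "real^'n \<Rightarrow> real"
  assumes sm: "smooth f" and s: "supp f \<subseteq> cball 0 r" and e: "e > 0"
  obtains d where "0 < d" "\<And>z h. norm h < d \<Longrightarrow> \<bar>f (z + h) - f z - grad f z \<bullet> h\<bar> \<le> e * norm h"
proof -
  have "uniformly_continuous_on (cball 0 (r+1)) (grad f)"
    by (rule compact_uniformly_continuous)
      (use continuous_grad[OF sm] continuous_on_subset in blast, auto)
  then obtain d where d: "d > 0" "\<And>x y. x \<in> cball 0 (r+1) \<Longrightarrow> y \<in> cball 0 (r+1) \<Longrightarrow> dist y x < d
    \<Longrightarrow> dist (grad f y) (grad f x) < e"
    using e unfolding uniformly_continuous_on_def by metis
  have out: "grad f x = 0" if "norm x > r" for x
    using that s by (intro grad_eq_0) auto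
  have uc: "norm (grad f y - grad f x) \<le> e" if "dist y x < min d 1" for x y
  proof (cases "x \<in> cball 0 (r+1) \<and> y \<in> cball 0 (r+1)")
    case True then show ?thesis using d(2)[of x y] that by (simp add: dist_norm)
  next
    case False
    have "\<bar>norm y - norm x\<bar> \<le> dist y x" by (metis dist_norm norm_triangle_ineq3)
    then have "norm x > r" "norm y > r" using that False by auto
    then show ?thesis using out e by auto
  qed
  show thesis
  proof (rule that[of "min d 1"])
    fix z h :: "real^'n" assume h: "norm h < min d 1"
    have "norm (f (z+h) - f z - grad f z \<bullet> (z + h - z)) \<le> norm (z + h - z) * e"
    proof (rule differentiable_bound_linearization[where S="ball z (min d 1)" and f'="\<lambda>x h. grad f x \<bullet> h"])
      show "z + t *\<^sub>R (z + h - z) \<in> ball z (min d 1)" if "t \<in> {0..1}" for t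
      proof -
        have "norm (t *\<^sub>R h) \<le> norm h" using that mult_left_le_one_le[of "norm h" t] by simp
        then show ?thesis using h by (simp add: dist_norm)
      qed
      show "(f has_derivative (\<bullet>) (grad f x)) (at x within ball z (min d 1))" for x
        using has_derivative_grad[OF smooth_imp_differentiable[OF sm], of x] has_derivative_at_withinI by blast
      fix x assume "x \<in> ball z (min d 1)"
      then have "norm (grad f x - grad f z) \<le> e" using uc[of x z] by (simp add: dist_commute)
      moreover have "onorm (\<lambda>h. (grad f x - grad f z) \<bullet> h) \<le> norm (grad f x - grad f z)"
        by (rule onorm_le) (simp add: Cauchy_Schwarz_ineq2 )
      ultimately show "onorm ((\<bullet>) (grad f x) - (\<bullet>) (grad f z)) \<le> e"
        by (simp add: fun_diff_def inner_diff_left)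
    qed (use d in auto)
    then show "\<bar>f (z + h) - f z - grad f z \<bullet> h\<bar> \<le> e * norm h" by (simp add: mult.commute)
  qed (use d in auto)
qed

subsection \<open>Locally integrable functions\<close>

lemma locally_integrable_component:
  fixes b :: "real^'n \<Rightarrow> real^'m"
  assumes "locally_integrable b"
  shows "locally_integrable (\<lambda>x. b x $ i)"
  using assms absolutely_integrable_component[where f=b and b="axis i 1"]
  by (auto simp: locally_integrable_def inner_axis)

lemma locally_integrable_measurable:
  fixes f :: "real^'n \<Rightarrow> 'b::euclidean_space"
  assumes "locally_integrable f"
  shows "f \<in> borel_measurable lebesgue"
proof (rule borel_measurable_LIMSEQ_metric)
  show "(\<lambda>x. indicator (cball 0 (real n)) x *\<^sub>R f x) \<in> borel_measurable lebesgue" for n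
    using assms borel_measurable_integrable compact_cball
    unfolding locally_integrable_def set_integrable_def by blast
  show "(\<lambda>n. indicator (cball 0 (real n)) x *\<^sub>R f x) \<longlonglongrightarrow> f x" for x
  proof (rule tendsto_eventually)
    obtain N where "norm x \<le> real N" using real_arch_simple by blast
    then show "eventually (\<lambda>n. indicator (cball 0 (real n)) x *\<^sub>R f x = f x) sequentially"
      by (auto simp: eventually_sequentially intro!: exI[of _ N])
  qed
qed

lemma locally_integrable_cball:
  fixes f :: "real^'n \<Rightarrow> real"
  assumes "locally_integrable f"
  shows "integrable lebesgue (\<lambda>y. indicator (cball x r) y * \<bar>f y\<bar>)"
proof -
  have "integrable lebesgue (\<lambda>y. indicator (cball x r) y *\<^sub>R f y)"
    using assms by (simp add: locally_integrable_def set_integrable_def)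
  from integrable_abs[OF this] show ?thesis by (simp add: abs_mult)
qed

lemma locally_integrable_mult:
  fixes f g :: "real^'n \<Rightarrow> real"
  assumes f: "locally_integrable f" and g: "g \<in> borel_measurable borel"
    and B: "\<And>y. \<bar>g y\<bar> \<le> B" and z: "\<And>y. y \<notin> cball x r \<Longrightarrow> g y = 0"
  shows "integrable lebesgue (\<lambda>y. f y * g y)"
proof (rule Bochner_Integration.integrable_bound)
  show "integrable lebesgue (\<lambda>y. B * (indicator (cball x r) y * \<bar>f y\<bar>))"
    using locally_integrable_cball[OF f] by simp
  have "g \<in> borel_measurable lebesgue" using g by (simp add: measurable_completion)
  then show "(\<lambda>y. f y * g y) \<in> borel_measurable lebesgue"
    using locally_integrable_measurable[OF f] by simp
  have "\<bar>f y * g y\<bar> \<le> \<bar>B * (indicator (cball x r) y * \<bar>f y\<bar>)\<bar>" for y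
  proof (cases "y \<in> cball x r")
    case True
    have "\<bar>f y\<bar> * \<bar>g y\<bar> \<le> \<bar>f y\<bar> * \<bar>B\<bar>"
      by (rule mult_left_mono) (use B[of y] in auto)
    then show ?thesis using True by (simp add: abs_mult mult.commute)
  qed (use z in auto)
  then show "AE y in lebesgue. norm (f y * g y) \<le> norm (B * (indicator (cball x r) y * \<bar>f y\<bar>))"
    by simp
qed

lemma Linf_norm_on_AE:
  fixes u :: "real^'n \<Rightarrow> real"
  assumes "A \<in> sets borel"
  shows "AE x in lebesgue. x \<in> A \<longrightarrow> ennreal \<bar>u x\<bar> \<le> Linf_norm_on A u"
proof -
  have "AE x in restrict_space lebesgue A. ennreal \<bar>u x\<bar> \<le> Linf_norm_on A u"
    unfolding Linf_norm_on_def by (rule esssup_AE)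
  moreover have "A \<inter> space lebesgue \<in> sets lebesgue" using assms by simp
  ultimately show ?thesis by (simp add: AE_restrict_space_iff)
qed

lemma Linf_norm_on_mono:
  fixes u :: "real^'n \<Rightarrow> real"
  assumes u: "u \<in> borel_measurable lebesgue" and "A \<subseteq> B" "A \<in> sets borel" "B \<in> sets borel"
  shows "Linf_norm_on A u \<le> Linf_norm_on B u"
proof -
  have "AE x in lebesgue. x \<in> A \<longrightarrow> ennreal \<bar>u x\<bar> \<le> Linf_norm_on B u"
    using Linf_norm_on_AE[OF assms(4), of u] by (rule eventually_mono) (use assms(2) in auto)
  then have "AE x in restrict_space lebesgue A. ennreal \<bar>u x\<bar> \<le> Linf_norm_on B u"
    using assms(3) by (subst AE_restrict_space_iff) auto
  moreover have "(\<lambda>x. ennreal \<bar>u x\<bar>) \<in> borel_measurable (restrict_space lebesgue A)"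
    using u by (intro measurable_restrict_space1) simp
  ultimately show ?thesis
    unfolding Linf_norm_on_def[of A] by (intro esssup_I)
qed

lemma Linfty_locally_integrable:
  fixes u :: "real^'n \<Rightarrow> real"
  assumes "Linfty u"
  shows "locally_integrable u"
proof -
  have m: "u \<in> borel_measurable lebesgue" and "Linf_norm_on UNIV u < \<infinity>"
    using assms by (auto simp: Linfty_def)
  then obtain L where L: "Linf_norm_on UNIV u = ennreal L" "L \<ge> 0"
    by (cases "Linf_norm_on UNIV u") auto
  have AE: "AE x in lebesgue. \<bar>u x\<bar> \<le> L"
    using Linf_norm_on_AE[of UNIV u] L by auto
  show ?thesis unfolding locally_integrable_def
  proof (intro allI impI)
    fix K :: "(real^'n) set" assume "compact K"
    then have K: "K \<in> lmeasurable" by (rule lmeasurable_compact)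
    show "u absolutely_integrable_on K"
      unfolding set_integrable_def
    proof (rule Bochner_Integration.integrable_bound)
      show "integrable lebesgue (\<lambda>x. indicator K x * L)"
        using K by (intro integrable_mult_left integrable_real_indicator) (auto simp: fmeasurable_def)
      show "(\<lambda>x. indicator K x *\<^sub>R u x) \<in> borel_measurable lebesgue"
        using K m by (auto simp: fmeasurable_def)
      show "AE x in lebesgue. norm (indicator K x *\<^sub>R u x) \<le> norm (indicator K x * L)"
        using AE by (rule eventually_mono) (auto simp: indicator_def)
    qed
  qed
qed

lemma conv_has_derivative:
  fixes v \<xi> :: "real^'n \<Rightarrow> real"
  assumes v: "locally_integrable v" and sm: "smooth \<xi>" and s: "supp \<xi> \<subseteq> cball 0 r"
  shows "(conv v \<xi> has_derivative
    (\<lambda>h. (\<chi> i. \<integral>y. v y * grad \<xi> (x - y) $ i \<partial>lebesgue) \<bullet> h)) (at x)"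
proof -
  have z0: "\<xi> w = 0" if "w \<notin> cball 0 r" for w using that s supp_I by blast
  have zg: "grad \<xi> w = 0" if "w \<notin> cball 0 r" for w using that s by (intro grad_eq_0) blast
  obtain B0 where B0: "\<And>w. norm (\<xi> w) \<le> B0"
    using continuous_zero_outside_bounded[OF smooth_continuous[OF sm] z0] by metis
  obtain B1 where B1: "\<And>w. norm (grad \<xi> w) \<le> B1"
    using continuous_zero_outside_bounded[OF continuous_grad[OF sm] zg] by metis
  have m0: "(\<lambda>y. \<xi> (a - y)) \<in> borel_measurable borel" for a
    by (intro borel_measurable_continuous_onI continuous_on_compose2[OF smooth_continuous[OF sm]] continuous_intros) auto
  have m1: "(\<lambda>y. grad \<xi> (a - y) $ i) \<in> borel_measurable borel" for a i
    by (intro borel_measurable_continuous_onI continuous_on_component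
        continuous_on_compose2[OF continuous_grad[OF sm]] continuous_intros) auto
  have i0: "integrable lebesgue (\<lambda>y. v y * \<xi> (a - y))" for a
    by (rule locally_integrable_mult[OF v m0, of a B0 a r]) (use B0 z0 in \<open>auto simp: dist_norm\<close>)
  have i1: "integrable lebesgue (\<lambda>y. v y * (grad \<xi> (a - y) $ i))" for a i
    by (rule locally_integrable_mult[OF v, of _ B1 a r])
      (use m1 order_trans[OF component_le_norm_cart B1] zg in \<open>auto simp: dist_norm\<close>)
  define G where "G = (\<chi> i. \<integral>y. v y * grad \<xi> (x - y) $ i \<partial>lebesgue)"
  have Gh: "G \<bullet> h = (\<integral>y. v y * (grad \<xi> (x - y) \<bullet> h) \<partial>lebesgue)"
    and i2: "integrable lebesgue (\<lambda>y. v y * (grad \<xi> (x - y) \<bullet> h))" for h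
  proof -
    have eq: "v y * (grad \<xi> (x - y) \<bullet> h) = (\<Sum>i\<in>UNIV. v y * grad \<xi> (x - y) $ i * h $ i)" for y
      by (simp add: inner_vec_def sum_distrib_left mult.assoc)
    show "integrable lebesgue (\<lambda>y. v y * (grad \<xi> (x - y) \<bullet> h))"
      unfolding eq using i1 by simp
    show "G \<bullet> h = (\<integral>y. v y * (grad \<xi> (x - y) \<bullet> h) \<partial>lebesgue)"
      unfolding eq using i1 by (simp add: inner_vec_def G_def)
  qed
  define S where "S = (\<integral>y. indicator (cball x (r + 1)) y * \<bar>v y\<bar> \<partial>lebesgue)"
  have S: "S \<ge> 0" unfolding S_def by (intro integral_nonneg_AE) auto
  have "(conv v \<xi> has_derivative (\<lambda>h. G \<bullet> h)) (at x)"
    unfolding has_derivative_at_alt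
  proof (intro conjI allI impI)
    show "bounded_linear ((\<bullet>) G)" by (rule bounded_linear_inner_right)
    fix e :: real assume e: "e > 0"
    define e' where "e' = e / (S + 1)"
    have e': "e' > 0" "e' * S \<le> e" using e S by (auto simp: e'_def field_simps)
    obtain d where d: "0 < d" "\<And>z h. norm h < d \<Longrightarrow> \<bar>\<xi> (z + h) - \<xi> z - grad \<xi> z \<bullet> h\<bar> \<le> e' * norm h"
      using uniformly_differentiable[OF sm s e'(1)] by metis
    show "\<exists>d>0. \<forall>w. norm (w - x) < d \<longrightarrow>
        norm (conv v \<xi> w - conv v \<xi> x - G \<bullet> (w - x)) \<le> e * norm (w - x)"
    proof (intro exI[of _ "min d 1"] conjI allI impI)
      fix w assume w: "norm (w - x) < min d 1"
      define h where "h = w - x"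
      let ?R = "\<lambda>y. \<xi> (w - y) - \<xi> (x - y) - grad \<xi> (x - y) \<bullet> h"
      have R: "\<bar>v y * ?R y\<bar> \<le> e' * norm h * (indicator (cball x (r + 1)) y * \<bar>v y\<bar>)" for y
      proof (cases "y \<in> cball x (r + 1)")
        case True
        have "\<bar>?R y\<bar> \<le> e' * norm h"
          using d(2)[of h "x - y"] w by (simp add: h_def algebra_simps)
        from mult_left_mono[OF this, of "\<bar>v y\<bar>"] show ?thesis
          using True by (simp add: abs_mult ac_simps)
      next
        case False
        have "norm (x - y) \<le> norm (w - y) + norm (w - x)"
          using norm_triangle_ineq4[of "w - y" "w - x"] by simp
        then have "w - y \<notin> cball 0 r" "x - y \<notin> cball 0 r"
          using False w norm_minus_commute[of y] by (auto simp: dist_norm)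
        then show ?thesis using z0 zg False by simp
      qed
      have "conv v \<xi> w - conv v \<xi> x - G \<bullet> h = (\<integral>y. v y * ?R y \<partial>lebesgue)"
        unfolding conv_def Gh using i0 i2 by (simp add: right_diff_distrib)
      then have "\<bar>conv v \<xi> w - conv v \<xi> x - G \<bullet> h\<bar> \<le> (\<integral>y. \<bar>v y * ?R y\<bar> \<partial>lebesgue)"
        using integral_abs_bound[of lebesgue "\<lambda>y. v y * ?R y"] by (simp only:)
      also have "\<dots> \<le> (\<integral>y. e' * norm h * (indicator (cball x (r + 1)) y * \<bar>v y\<bar>) \<partial>lebesgue)"
        by (rule integral_mono)
          (use R i0 i2 locally_integrable_cball[OF v] in \<open>auto simp: right_diff_distrib\<close>)
      also have "\<dots> = (e' * S) * norm h" by (simp add: S_def)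
      also have "\<dots> \<le> e * norm h" using e'(2) by (rule mult_right_mono) simp
      finally show "norm (conv v \<xi> w - conv v \<xi> x - G \<bullet> (w - x)) \<le> e * norm (w - x)"
        by (simp add: h_def)
    qed (use d in auto)
  qed
  then show ?thesis by (simp add: G_def)
qed

subsection \<open>The total variation measure\<close>

definition bounded_partitions :: "(real^'n) set \<Rightarrow> (nat \<Rightarrow> (real^'n) set) set" where
  "bounded_partitions A =
    {E. (\<forall>h. E h \<in> sets borel \<and> bounded (E h)) \<and> disjoint_family E \<and> (\<Union>h. E h) = A}"

definition variation :: "((real^'n) set \<Rightarrow> real^'n^'n) \<Rightarrow> (real^'n) set \<Rightarrow> ennreal" where
  "variation \<mu> A = (SUP E\<in>bounded_partitions A. \<Sum>h. ennreal (norm (\<mu> (E h))))"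

lemma total_variation_eq: "total_variation \<mu> = measure_of UNIV (sets borel) (variation \<mu>)"
  unfolding total_variation_def variation_def bounded_partitions_def ..

lemma bounded_partitions_nonempty:
  assumes "A \<in> sets borel"
  shows "bounded_partitions A \<noteq> {}"
proof -
  let ?E = "\<lambda>h::nat. A \<inter> {x. h = nat \<lfloor>norm x\<rfloor>}"
  have "?E h \<in> sets borel" for h
    using assms by measurable
  moreover have "bounded (?E h)" for h
  proof (rule bounded_subset[OF bounded_cball])
    show "?E h \<subseteq> cball 0 (real h + 1)"
      using real_nat_ceiling_ge by (auto simp: of_nat_nat)
  qed
  ultimately have "?E \<in> bounded_partitions A"
    unfolding bounded_partitions_def by (auto simp: disjoint_family_on_def)
  then show ?thesis by blast
qed

lemma variation_upper:
  "E \<in> bounded_partitions A \<Longrightarrow> (\<Sum>h. ennreal (norm (\<mu> (E h)))) \<le> variation \<mu> A"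
  unfolding variation_def by (rule SUP_upper)

lemma radon_measure_bounded:
  assumes "radon_measure M" "bounded A"
  shows "emeasure M A < \<infinity>"
proof -
  obtain r where "A \<subseteq> cball 0 r" using assms(2) by (metis bounded_iff mem_cball_0 subsetI)
  then have "emeasure M A \<le> emeasure M (cball 0 r)"
    using assms(1) by (intro emeasure_mono) (auto simp: radon_measure_def)
  also have "\<dots> < \<infinity>" using assms(1) by (auto simp: radon_measure_def)
  finally show ?thesis .
qed

lemma radon_measure_sets: "radon_measure M \<Longrightarrow> sets M = sets borel"
  by (simp add: radon_measure_def)

lemma matrix_radon_measure_sums:
  fixes \<mu> :: "(real^'n) set \<Rightarrow> real^'n^'n"
  assumes mu: "matrix_radon_measure \<mu> P N"
    and A: "\<And>k::nat. A k \<in> sets borel" "disjoint_family A" "bounded (\<Union>k. A k)"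
  shows "(\<lambda>k. \<mu> (A k)) sums \<mu> (\<Union>k. A k)"
proof -
  have bd: "bounded (A k)" for k using A(3) by (rule bounded_subset) auto
  have "(\<lambda>k. \<mu> (A k) $ i $ j) sums (\<mu> (\<Union>k. A k) $ i $ j)" for i j
  proof -
    have r: "radon_measure (P i j)" "radon_measure (N i j)"
      using mu by (auto simp: matrix_radon_measure_def)
    have "(\<lambda>k. measure M (A k)) sums measure M (\<Union>k. A k)" if "radon_measure M" for M
      using that A radon_measure_bounded[OF that A(3)]
      by (intro measure_UNION) (auto simp: radon_measure_sets)
    from sums_diff[OF this[OF r(1)] this[OF r(2)]] show ?thesis
      using mu A bd by (simp add: matrix_radon_measure_def)
  qed
  then show ?thesis unfolding sums_def by (intro vec_tendstoI) simp
qed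

lemma matrix_radon_measure_subadditive:
  fixes \<mu> :: "(real^'n) set \<Rightarrow> real^'n^'n"
  assumes mu: "matrix_radon_measure \<mu> P N"
    and A: "\<And>k::nat. A k \<in> sets borel" "disjoint_family A" "bounded (\<Union>k. A k)"
  shows "ennreal (norm (\<mu> (\<Union>k. A k))) \<le> (\<Sum>k. ennreal (norm (\<mu> (A k))))"
proof (cases "(\<Sum>k. ennreal (norm (\<mu> (A k)))) = top")
  case False
  then have s: "summable (\<lambda>k. norm (\<mu> (A k)))"
    by (intro summable_suminf_not_top) auto
  have "norm (\<mu> (\<Union>k. A k)) \<le> (\<Sum>k. norm (\<mu> (A k)))"
    using summable_norm[OF s] sums_unique[OF matrix_radon_measure_sums[OF assms]] by simp
  then show ?thesis using s by (subst suminf_ennreal2) (auto intro: ennreal_leI)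
qed simp

lemma variation_superadditive:
  assumes "A \<in> sets borel" "B \<in> sets borel" "A \<inter> B = {}"
  shows "variation \<mu> A + variation \<mu> B \<le> variation \<mu> (A \<union> B)"
proof -
  let ?g = "\<lambda>E. ennreal (norm (\<mu> E))"
  have 1: "(\<Sum>h. ?g (E h)) + (\<Sum>h. ?g (F h)) \<le> variation \<mu> (A \<union> B)"
    if E: "E \<in> bounded_partitions A" and F: "F \<in> bounded_partitions B" for E F
  proof -
    define C where "C n = (if even n then E (n div 2) else F (n div 2))" for n
    have UE: "(\<Union>h. E h) = A" and UF: "(\<Union>h. F h) = B"
      and dE: "disjoint_family E" and dF: "disjoint_family F"
      using E F by (auto simp: bounded_partitions_def)
    have "(\<Union>h. C h) = A \<union> B"
    proof
      show "(\<Union>h. C h) \<subseteq> A \<union> B" using UE UF by (auto simp: C_def split: if_splits)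
      have "E h \<subseteq> (\<Union>h. C h)" "F h \<subseteq> (\<Union>h. C h)" for h
        using UN_upper[of "2 * h" UNIV C] UN_upper[of "2 * h + 1" UNIV C] by (auto simp: C_def)
      then show "A \<union> B \<subseteq> (\<Union>h. C h)" unfolding UE[symmetric] UF[symmetric] by blast
    qed
    moreover have "disjoint_family C"
      unfolding disjoint_family_on_def
    proof (intro ballI impI)
      fix m n :: nat assume "m \<noteq> n"
      have "E h \<inter> F k = {}" for h k using assms(3) UE UF by blast
      moreover have "E (m div 2) \<inter> E (n div 2) = {}" if "even m" "even n"
        using dE that \<open>m \<noteq> n\<close> by (intro disjoint_family_onD[OF dE]) auto
      moreover have "F (m div 2) \<inter> F (n div 2) = {}" if "odd m" "odd n"
        using dF that \<open>m \<noteq> n\<close> by (intro disjoint_family_onD[OF dF]) (auto elim!: oddE)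
      ultimately show "C m \<inter> C n = {}" unfolding C_def by (auto simp: Int_commute)
    qed
    ultimately have C: "C \<in> bounded_partitions (A \<union> B)"
      using E F by (auto simp: bounded_partitions_def C_def)
    have "(\<Sum>k<m. ?g (E k) + ?g (F k)) = (\<Sum>n<2 * m. ?g (C n))" for m
      by (induction m) (auto simp: C_def ac_simps)
    also have "(\<Sum>n<2 * m. ?g (C n)) \<le> (\<Sum>n. ?g (C n))" for m
      by (rule sum_le_suminf) auto
    finally have "(\<Sum>k. ?g (E k) + ?g (F k)) \<le> (\<Sum>n. ?g (C n))"
      by (intro suminf_le_const) auto
    also have "\<dots> \<le> variation \<mu> (A \<union> B)" by (rule variation_upper[OF C])
    finally show ?thesis by (simp add: suminf_add)
  qed
  have "variation \<mu> A + variation \<mu> B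
      = (SUP E\<in>bounded_partitions A. (\<Sum>h. ?g (E h)) + variation \<mu> B)"
    unfolding variation_def[of \<mu> A]
    by (rule ennreal_SUP_add_left[symmetric]) (rule bounded_partitions_nonempty[OF assms(1)])
  also have "\<dots> \<le> variation \<mu> (A \<union> B)"
  proof (rule SUP_least)
    fix E assume E: "E \<in> bounded_partitions A"
    have "(\<Sum>h. ?g (E h)) + variation \<mu> B
        = (SUP F\<in>bounded_partitions B. (\<Sum>h. ?g (E h)) + (\<Sum>h. ?g (F h)))"
      unfolding variation_def[of \<mu> B]
      by (rule ennreal_SUP_add_right) (rule bounded_partitions_nonempty[OF assms(2)])
    also have "\<dots> \<le> variation \<mu> (A \<union> B)" by (rule SUP_least) (rule 1[OF E])
    finally show "(\<Sum>h. ?g (E h)) + variation \<mu> B \<le> variation \<mu> (A \<union> B)" .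
  qed
  finally show ?thesis .
qed

lemma variation_mono:
  assumes "A \<in> sets borel" "B \<in> sets borel" "A \<subseteq> B"
  shows "variation \<mu> A \<le> variation \<mu> B"
proof -
  have "variation \<mu> A \<le> variation \<mu> A + variation \<mu> (B - A)" by simp
  also have "\<dots> \<le> variation \<mu> (A \<union> (B - A))" using assms by (intro variation_superadditive) auto
  also have "A \<union> (B - A) = B" using assms(3) by auto
  finally show ?thesis .
qed

lemma ennreal_suminf_swap:
  fixes f :: "nat \<Rightarrow> nat \<Rightarrow> ennreal"
  shows "(\<Sum>h. \<Sum>k. f h k) = (\<Sum>k. \<Sum>h. f h k)"
proof -
  have "(\<Sum>h. \<Sum>k. f h k) = (\<integral>\<^sup>+h. (\<Sum>k. f h k) \<partial>count_space UNIV)"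
    by (rule nn_integral_count_space_nat[symmetric])
  also have "\<dots> = (\<Sum>k. \<integral>\<^sup>+h. f h k \<partial>count_space UNIV)"
    by (rule nn_integral_suminf) simp
  also have "\<dots> = (\<Sum>k. \<Sum>h. f h k)" by (simp add: nn_integral_count_space_nat)
  finally show ?thesis .
qed

lemma variation_countably_additive:
  fixes \<mu> :: "(real^'n) set \<Rightarrow> real^'n^'n"
  assumes mu: "matrix_radon_measure \<mu> P N"
  shows "countably_additive (sets borel) (variation \<mu>)"
  unfolding countably_additive_def
proof (intro allI impI)
  fix A :: "nat \<Rightarrow> (real^'n) set"
  assume "range A \<subseteq> sets borel" and dA: "disjoint_family A" and U: "(\<Union>k. A k) \<in> sets borel"
  then have A[measurable]: "\<And>k. A k \<in> sets borel" by auto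
  let ?g = "\<lambda>E. ennreal (norm (\<mu> E))"
  show "(\<Sum>k. variation \<mu> (A k)) = variation \<mu> (\<Union>k. A k)"
  proof (rule antisym)
    have "(\<Sum>k<n. variation \<mu> (A k)) \<le> variation \<mu> (\<Union>k<n. A k)" for n
    proof (induction n)
      case (Suc n)
      have dj: "(\<Union>k<n. A k) \<inter> A n = {}"
        using disjoint_family_onD[OF dA, of _ n] by fastforce
      have "(\<Sum>k<Suc n. variation \<mu> (A k)) \<le> variation \<mu> (\<Union>k<n. A k) + variation \<mu> (A n)"
        using Suc by (simp add: add_mono)
      also have "\<dots> \<le> variation \<mu> ((\<Union>k<n. A k) \<union> A n)"
        by (rule variation_superadditive) (use dj in auto)
      also have "(\<Union>k<n. A k) \<union> A n = (\<Union>k<Suc n. A k)" by (auto simp: less_Suc_eq)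
      finally show ?case .
    qed simp
    also have "variation \<mu> (\<Union>k<n. A k) \<le> variation \<mu> (\<Union>k. A k)" for n
      by (rule variation_mono) auto
    finally show "(\<Sum>k. variation \<mu> (A k)) \<le> variation \<mu> (\<Union>k. A k)"
      by (intro suminf_le_const) auto
  next
    show "variation \<mu> (\<Union>k. A k) \<le> (\<Sum>k. variation \<mu> (A k))"
      unfolding variation_def[of \<mu> "\<Union>k. A k"]
    proof (rule SUP_least)
      fix E assume E: "E \<in> bounded_partitions (\<Union>k. A k)"
      then have Em[measurable]: "\<And>h. E h \<in> sets borel" and Eb: "\<And>h. bounded (E h)"
        and Ed: "disjoint_family E" and EU: "(\<Union>h. E h) = (\<Union>k. A k)"
        by (auto simp: bounded_partitions_def)
      have "?g (E h) \<le> (\<Sum>k. ?g (E h \<inter> A k))" for h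
      proof -
        have U: "(\<Union>k. E h \<inter> A k) = E h" using EU by blast
        have "disjoint_family (\<lambda>k. E h \<inter> A k)"
          using dA by (auto simp: disjoint_family_on_def)
        from matrix_radon_measure_subadditive[OF mu _ this, unfolded U, OF _ Eb] show ?thesis
          by measurable
      qed
      then have "(\<Sum>h. ?g (E h)) \<le> (\<Sum>h. \<Sum>k. ?g (E h \<inter> A k))"
        by (intro suminf_le) auto
      also have "\<dots> = (\<Sum>k. \<Sum>h. ?g (E h \<inter> A k))" by (rule ennreal_suminf_swap)
      also have "\<dots> \<le> (\<Sum>k. variation \<mu> (A k))"
      proof (intro suminf_le allI)
        fix k
        have "(\<lambda>h. E h \<inter> A k) \<in> bounded_partitions (A k)"
          unfolding bounded_partitions_def
        proof (intro CollectI conjI allI)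
          show "disjoint_family (\<lambda>h. E h \<inter> A k)" using Ed by (auto simp: disjoint_family_on_def)
          show "(\<Union>h. E h \<inter> A k) = A k" using EU by blast
          show "bounded (E h \<inter> A k)" for h using Eb[of h] by (simp add: bounded_Int)
        qed simp
        then show "(\<Sum>h. ?g (E h \<inter> A k)) \<le> variation \<mu> (A k)" by (rule variation_upper)
      qed auto
      finally show "(\<Sum>h. ?g (E h)) \<le> (\<Sum>k. variation \<mu> (A k))" .
    qed
  qed
qed

lemma norm_matrix_radon_measure_le:
  fixes \<mu> :: "(real^'n) set \<Rightarrow> real^'n^'n"
  assumes mu: "matrix_radon_measure \<mu> P N" and A: "A \<in> sets borel" "bounded A"
  shows "ennreal (norm (\<mu> A)) \<le> (\<Sum>i\<in>UNIV. \<Sum>j\<in>UNIV. emeasure (P i j) A + emeasure (N i j) A)"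
proof -
  have "norm (\<mu> A) \<le> (\<Sum>i\<in>UNIV. norm (\<mu> A $ i))"
    by (simp add: norm_vec_def L2_set_le_sum)
  also have "\<dots> \<le> (\<Sum>i\<in>UNIV. \<Sum>j\<in>UNIV. \<bar>\<mu> A $ i $ j\<bar>)"
    by (intro sum_mono norm_le_l1_cart)
  also have "\<dots> \<le> (\<Sum>i\<in>UNIV. \<Sum>j\<in>UNIV. measure (P i j) A + measure (N i j) A)"
    using mu A by (intro sum_mono) (auto simp: matrix_radon_measure_def abs_if add_increasing)
  finally have "ennreal (norm (\<mu> A)) \<le> ennreal \<dots>" by (rule ennreal_leI)
  also have "\<dots> = (\<Sum>i\<in>UNIV. \<Sum>j\<in>UNIV. ennreal (measure (P i j) A) + ennreal (measure (N i j) A))"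
    by (simp add: sum_nonneg flip: sum_ennreal ennreal_plus)
  also have "\<dots> = (\<Sum>i\<in>UNIV. \<Sum>j\<in>UNIV. emeasure (P i j) A + emeasure (N i j) A)"
  proof (intro sum.cong refl)
    fix i j
    have "radon_measure (P i j)" "radon_measure (N i j)"
      using mu by (auto simp: matrix_radon_measure_def)
    then show "ennreal (measure (P i j) A) + ennreal (measure (N i j) A) = emeasure (P i j) A + emeasure (N i j) A"
      using radon_measure_bounded[OF _ A(2)] by (simp add: emeasure_eq_ennreal_measure less_top[symmetric])
  qed
  finally show ?thesis .
qed

lemma variation_le:
  fixes \<mu> :: "(real^'n) set \<Rightarrow> real^'n^'n"
  assumes mu: "matrix_radon_measure \<mu> P N"
  shows "variation \<mu> A \<le> (\<Sum>i\<in>UNIV. \<Sum>j\<in>UNIV. emeasure (P i j) A + emeasure (N i j) A)"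
  unfolding variation_def
proof (rule SUP_least)
  fix E assume "E \<in> bounded_partitions A"
  then have E: "\<And>h. E h \<in> sets borel" "\<And>h. bounded (E h)" "disjoint_family E" "(\<Union>h. E h) = A"
    by (auto simp: bounded_partitions_def)
  have s: "sets (P i j) = sets borel" "sets (N i j) = sets borel" for i j
    using mu by (auto simp: matrix_radon_measure_def radon_measure_def)
  have "(\<Sum>h. ennreal (norm (\<mu> (E h))))
      \<le> (\<Sum>h. \<Sum>i\<in>UNIV. \<Sum>j\<in>UNIV. emeasure (P i j) (E h) + emeasure (N i j) (E h))"
    by (intro suminf_le norm_matrix_radon_measure_le[OF mu] E) auto
  also have "\<dots> = (\<Sum>i\<in>UNIV. \<Sum>j\<in>UNIV. (\<Sum>h. emeasure (P i j) (E h)) + (\<Sum>h. emeasure (N i j) (E h)))"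
    by (simp add: suminf_sum suminf_add)
  also have "\<dots> = (\<Sum>i\<in>UNIV. \<Sum>j\<in>UNIV. emeasure (P i j) A + emeasure (N i j) A)"
  proof (intro sum.cong refl arg_cong2[where f="(+)"])
    show "(\<Sum>h. emeasure (P i j) (E h)) = emeasure (P i j) A" for i j
      using E s by (subst suminf_emeasure) auto
    show "(\<Sum>h. emeasure (N i j) (E h)) = emeasure (N i j) A" for i j
      using E s by (subst suminf_emeasure) auto
  qed
  finally show "(\<Sum>h. ennreal (norm (\<mu> (E h)))) \<le> \<dots>" .
qed

lemma emeasure_total_variation:
  fixes \<mu> :: "(real^'n) set \<Rightarrow> real^'n^'n"
  assumes mu: "matrix_radon_measure \<mu> P N" and A: "A \<in> sets borel"
  shows "emeasure (total_variation \<mu>) A = variation \<mu> A"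
proof (rule emeasure_measure_of[OF total_variation_eq])
  have s: "sets (total_variation \<mu>) = sets borel"
    unfolding total_variation_eq by (simp add: sets.sigma_sets_eq[of borel, simplified])
  have "variation \<mu> {} \<le> 0" using variation_le[OF mu, of "{}"] by simp
  then show "positive (sets (total_variation \<mu>)) (variation \<mu>)" by (simp add: positive_def)
  show "countably_additive (sets (total_variation \<mu>)) (variation \<mu>)"
    using variation_countably_additive[OF mu] by (simp add: s)
  show "A \<in> sets (total_variation \<mu>)" using A by (simp add: s)
qed simp

lemma radon_total_variation:
  fixes \<mu> :: "(real^'n) set \<Rightarrow> real^'n^'n"
  assumes mu: "matrix_radon_measure \<mu> P N"
  shows "radon_measure (total_variation \<mu>)"
  unfolding radon_measure_def
proof (intro conjI allI impI)
  show "sets (total_variation \<mu>) = sets borel"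
    unfolding total_variation_eq by (simp add: sets.sigma_sets_eq[of borel, simplified])
  fix K :: "(real^'n) set" assume K: "compact K"
  have r: "radon_measure (P i j)" "radon_measure (N i j)" for i j
    using mu by (auto simp: matrix_radon_measure_def)
  have "emeasure (total_variation \<mu>) K \<le> (\<Sum>i\<in>UNIV. \<Sum>j\<in>UNIV. emeasure (P i j) K + emeasure (N i j) K)"
    using emeasure_total_variation[OF mu] variation_le[OF mu] K by (simp add: borel_compact)
  also have "\<dots> < \<infinity>"
    using r K by (auto simp: radon_measure_def)
  finally show "emeasure (total_variation \<mu>) K < \<infinity>" .
qed

lemma norm_le_total_variation:
  fixes \<mu> :: "(real^'n) set \<Rightarrow> real^'n^'n"
  assumes mu: "matrix_radon_measure \<mu> P N" and A: "A \<in> sets borel" "bounded A"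
  shows "ennreal (norm (\<mu> A)) \<le> emeasure (total_variation \<mu>) A"
proof -
  let ?E = "\<lambda>h::nat. if h = 0 then A else {}"
  have E: "?E \<in> bounded_partitions A"
    using A by (auto simp: bounded_partitions_def disjoint_family_on_def)
  have "ennreal (norm (\<mu> A)) \<le> (\<Sum>h. ennreal (norm (\<mu> (?E h))))"
  proof -
    have "ennreal (norm (\<mu> A)) = (\<Sum>h\<in>{0}. ennreal (norm (\<mu> (?E h))))" by simp
    also have "\<dots> \<le> (\<Sum>h. ennreal (norm (\<mu> (?E h))))" by (rule sum_le_suminf) auto
    finally show ?thesis .
  qed
  also have "\<dots> \<le> variation \<mu> A" using E by (rule variation_upper)
  finally show ?thesis using emeasure_total_variation[OF mu A(1)] by simp
qed

lemma matrix_radon_measure_entry_le: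
  fixes \<mu> :: "(real^'n) set \<Rightarrow> real^'n^'n"
  assumes mu: "matrix_radon_measure \<mu> P N" and A: "A \<in> sets borel" "bounded A"
  shows "emeasure (P i j) A \<le> emeasure (N i j) A + emeasure (total_variation \<mu>) A"
    "emeasure (N i j) A \<le> emeasure (P i j) A + emeasure (total_variation \<mu>) A"
proof -
  have r: "radon_measure (P i j)" "radon_measure (N i j)"
    using mu by (auto simp: matrix_radon_measure_def)
  have "\<bar>\<mu> A $ i $ j\<bar> \<le> norm (\<mu> A)"
    using component_le_norm_cart[of "\<mu> A $ i" j] Finite_Cartesian_Product.norm_nth_le[of "\<mu> A" i] by linarith
  then have "\<bar>measure (P i j) A - measure (N i j) A\<bar> \<le> norm (\<mu> A)"
    using mu A by (auto simp: matrix_radon_measure_def)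
  moreover have "emeasure M A = ennreal (measure M A)" if "radon_measure M" for M
    using radon_measure_bounded[OF that A(2)] by (simp add: emeasure_eq_ennreal_measure less_top[symmetric])
  ultimately have "emeasure (P i j) A \<le> emeasure (N i j) A + ennreal (norm (\<mu> A))"
    "emeasure (N i j) A \<le> emeasure (P i j) A + ennreal (norm (\<mu> A))"
    using r by (auto simp flip: ennreal_plus intro!: ennreal_leI)
  then show "emeasure (P i j) A \<le> emeasure (N i j) A + emeasure (total_variation \<mu>) A"
    "emeasure (N i j) A \<le> emeasure (P i j) A + emeasure (total_variation \<mu>) A"
    using norm_le_total_variation[OF mu A] by (meson add_left_mono order_trans)+
qed

subsection \<open>Comparison of measures through mollification\<close>

lemma radon_sigma_finite:
  assumes "radon_measure M"
  shows "sigma_finite_measure M"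
proof (intro sigma_finite_measure.intro exI[of _ "range (\<lambda>n::nat. cball 0 (real n))"] conjI ballI)
  show "\<Union> (range (\<lambda>n::nat. cball 0 (real n))) = space M"
    using sets_eq_imp_space_eq[OF radon_measure_sets[OF assms]] real_arch_simple by (auto simp: Bex_def)
  show "range (\<lambda>n::nat. cball 0 (real n)) \<subseteq> sets M"
    by (intro image_subsetI) (simp add: radon_measure_sets[OF assms])
qed (use radon_measure_bounded[OF assms bounded_cball] in \<open>auto simp: less_top\<close>)

lemma lborel_pair_radon: "radon_measure M \<Longrightarrow> pair_sigma_finite lborel M"
  by (simp add: pair_sigma_finite_def radon_sigma_finite sigma_finite_lborel)

lemma nn_integral_lborel_affine:
  fixes f :: "'a::euclidean_space \<Rightarrow> ennreal"
  assumes f: "f \<in> borel_measurable borel" and c: "c \<noteq> 0"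
  shows "(\<integral>\<^sup>+x. f x \<partial>lborel) = ennreal (\<bar>c\<bar> ^ DIM('a)) * (\<integral>\<^sup>+x. f (t + c *\<^sub>R x) \<partial>lborel)"
proof -
  have "(\<integral>\<^sup>+x. f x \<partial>lborel)
      = (\<integral>\<^sup>+x. f x \<partial>density (distr lborel borel (\<lambda>x. t + c *\<^sub>R x)) (\<lambda>_. \<bar>c\<bar> ^ DIM('a)))"
    by (simp only: lborel_affine[OF c, of t, symmetric])
  also have "\<dots> = ennreal (\<bar>c\<bar> ^ DIM('a)) * (\<integral>\<^sup>+x. f (t + c *\<^sub>R x) \<partial>lborel)"
    using f by (simp add: nn_integral_density nn_integral_distr nn_integral_cmult)
  finally show ?thesis .
qed

lemma emeasure_le_add_bounded:
  fixes \<alpha> \<beta> \<nu> :: "(real^'n) measure"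
  assumes s: "sets \<alpha> = sets borel" "sets \<beta> = sets borel" "sets \<nu> = sets borel"
    and le: "\<And>A. A \<in> sets borel \<Longrightarrow> bounded A \<Longrightarrow> emeasure \<alpha> A \<le> emeasure \<beta> A + emeasure \<nu> A"
    and A: "A \<in> sets borel"
  shows "emeasure \<alpha> A \<le> emeasure \<beta> A + emeasure \<nu> A"
proof -
  let ?A = "\<lambda>n::nat. A \<inter> cball 0 (real n)"
  have "incseq ?A" by (auto simp: incseq_def)
  moreover have "(\<Union>n. ?A n) = A" using real_arch_simple by auto
  moreover have "range ?A \<subseteq> sets \<alpha>"
    unfolding s(1) by (intro image_subsetI sets.Int A) simp
  ultimately have "emeasure \<alpha> A = (SUP n. emeasure \<alpha> (?A n))"
    using SUP_emeasure_incseq[of ?A \<alpha>] by (simp only:)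
  also have "\<dots> \<le> emeasure \<beta> A + emeasure \<nu> A"
  proof (rule SUP_least)
    fix n :: nat
    have "emeasure \<alpha> (?A n) \<le> emeasure \<beta> (?A n) + emeasure \<nu> (?A n)"
      by (rule le) (use A in \<open>auto simp: bounded_Int\<close>)
    also have "\<dots> \<le> emeasure \<beta> A + emeasure \<nu> A"
      using s A by (intro add_mono emeasure_mono) auto
    finally show "emeasure \<alpha> (?A n) \<le> emeasure \<beta> A + emeasure \<nu> A" .
  qed
  finally show ?thesis .
qed

lemma nn_integral_le_add_measure:
  fixes \<alpha> \<beta> \<nu> :: "'a measure"
  assumes s: "sets \<beta> = sets \<alpha>" "sets \<nu> = sets \<alpha>"
    and le: "\<And>A. A \<in> sets \<alpha> \<Longrightarrow> emeasure \<alpha> A \<le> emeasure \<beta> A + emeasure \<nu> A"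
    and f: "f \<in> borel_measurable \<alpha>"
  shows "(\<integral>\<^sup>+x. f x \<partial>\<alpha>) \<le> (\<integral>\<^sup>+x. f x \<partial>\<beta>) + (\<integral>\<^sup>+x. f x \<partial>\<nu>)"
  using f
proof (induction rule: borel_measurable_induct)
  have m: "g \<in> borel_measurable \<beta>" "g \<in> borel_measurable \<nu>" if "g \<in> borel_measurable \<alpha>" for g :: "'a \<Rightarrow> ennreal"
    using that s measurable_cong_sets[OF s(1) refl] measurable_cong_sets[OF s(2) refl] by auto
  note sp = sets_eq_imp_space_eq[OF s(1)] sets_eq_imp_space_eq[OF s(2)]
  {
    case (cong f g)
    have "(\<integral>\<^sup>+x. f x \<partial>\<alpha>) = (\<integral>\<^sup>+x. g x \<partial>\<alpha>)" "(\<integral>\<^sup>+x. f x \<partial>\<beta>) = (\<integral>\<^sup>+x. g x \<partial>\<beta>)"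
      "(\<integral>\<^sup>+x. f x \<partial>\<nu>) = (\<integral>\<^sup>+x. g x \<partial>\<nu>)"
      using cong.hyps(3) sp by (auto intro!: nn_integral_cong)
    then show ?case using cong by simp
  next
    case (set A) then show ?case using le s by simp
  next
    case (mult u c)
    show ?case using mult.hyps(2) m[OF mult.hyps(2)] mult_left_mono[OF mult.IH, of c]
      by (simp add: nn_integral_cmult distrib_left)
  next
    case (add u v)
    show ?case using add.hyps(1,3) m[OF add.hyps(1)] m[OF add.hyps(3)] add_mono[OF add.IH(2) add.IH(1)]
      by (simp add: nn_integral_add ac_simps)
  next
    case (seq U)
    have "(\<integral>\<^sup>+x. (SUP i. U i) x \<partial>\<alpha>) = (SUP i. \<integral>\<^sup>+x. U i x \<partial>\<alpha>)"
      unfolding SUP_apply by (rule nn_integral_monotone_convergence_SUP[OF seq.hyps(3) seq.hyps(1)])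
    also have "\<dots> \<le> (\<integral>\<^sup>+x. (SUP i. U i) x \<partial>\<beta>) + (\<integral>\<^sup>+x. (SUP i. U i) x \<partial>\<nu>)"
    proof (rule SUP_least)
      fix i
      have "(\<integral>\<^sup>+x. U i x \<partial>\<alpha>) \<le> (\<integral>\<^sup>+x. U i x \<partial>\<beta>) + (\<integral>\<^sup>+x. U i x \<partial>\<nu>)" by (rule seq.IH)
      also have "\<dots> \<le> (\<integral>\<^sup>+x. (SUP i. U i) x \<partial>\<beta>) + (\<integral>\<^sup>+x. (SUP i. U i) x \<partial>\<nu>)"
        by (intro add_mono nn_integral_mono) (auto simp: SUP_apply intro: SUP_upper)
      finally show "(\<integral>\<^sup>+x. U i x \<partial>\<alpha>) \<le> (\<integral>\<^sup>+x. (SUP i. U i) x \<partial>\<beta>) + (\<integral>\<^sup>+x. (SUP i. U i) x \<partial>\<nu>)" .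
    qed
    finally show ?case .
  }
qed

definition mollifier :: "(real^'n \<Rightarrow> real) \<Rightarrow> bool" where
  "mollifier \<theta> \<longleftrightarrow> smooth \<theta> \<and> (\<forall>x. 0 \<le> \<theta> x) \<and> supp \<theta> \<subseteq> cball 0 1 \<and>
    (\<integral>\<^sup>+x. ennreal (\<theta> x) \<partial>lborel) = 1"

lemma borel_measurable_smooth: "smooth f \<Longrightarrow> f \<in> borel_measurable borel"
  by (intro borel_measurable_continuous_onI smooth_continuous)

lemma
  fixes \<theta> :: "real^'n \<Rightarrow> real"
  assumes "mollifier \<theta>" and \<delta>: "\<delta> > 0"
  shows mollifier_nonneg: "0 \<le> rescale \<delta> \<theta> x"
    and mollifier_measurable [measurable]: "rescale \<delta> \<theta> \<in> borel_measurable borel"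
    and mollifier_eq_0: "norm x > \<delta> \<Longrightarrow> rescale \<delta> \<theta> x = 0"
    and mollifier_nn_integral: "(\<integral>\<^sup>+z. ennreal (rescale \<delta> \<theta> (z - y)) \<partial>lborel) = 1"
proof -
  have th: "smooth \<theta>" "\<And>x. 0 \<le> \<theta> x" "supp \<theta> \<subseteq> cball 0 1" "(\<integral>\<^sup>+x. ennreal (\<theta> x) \<partial>lborel) = 1"
    using assms by (auto simp: mollifier_def)
  show "0 \<le> rescale \<delta> \<theta> x" using th \<delta> by (simp add: rescale_def)
  show [measurable]: "rescale \<delta> \<theta> \<in> borel_measurable borel"
    by (intro borel_measurable_smooth smooth_rescale th)
  show "norm x > \<delta> \<Longrightarrow> rescale \<delta> \<theta> x = 0" using rescale_eq_0[OF th(3) \<delta>] .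
  have "(\<integral>\<^sup>+z. ennreal (rescale \<delta> \<theta> (z - y)) \<partial>lborel)
      = ennreal (\<delta> ^ CARD('n)) * (\<integral>\<^sup>+z. ennreal (rescale \<delta> \<theta> (\<delta> *\<^sub>R z)) \<partial>lborel)"
    using \<delta> by (subst nn_integral_lborel_affine[of _ \<delta> y]) (simp_all)
  also have "\<dots> = (\<integral>\<^sup>+z. ennreal (\<delta> ^ CARD('n)) * ennreal (rescale \<delta> \<theta> (\<delta> *\<^sub>R z)) \<partial>lborel)"
    by (rule nn_integral_cmult[symmetric]) measurable
  also have "\<dots> = (\<integral>\<^sup>+z. ennreal (\<theta> z) \<partial>lborel)"
    using \<delta> by (intro nn_integral_cong) (simp add: rescale_def ennreal_mult'[symmetric])
  finally show "(\<integral>\<^sup>+z. ennreal (rescale \<delta> \<theta> (z - y)) \<partial>lborel) = 1" using th by simp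
qed

lemma infdist_nbhd_bounded:
  fixes K :: "(real^'n) set"
  assumes "compact K" "K \<noteq> {}"
  shows "bounded {x. infdist x K \<le> \<delta>}"
proof -
  obtain R where R: "\<And>x. x \<in> K \<Longrightarrow> norm x \<le> R"
    using compact_imp_bounded[OF assms(1)] by (auto simp: bounded_iff)
  have "norm x \<le> R + \<delta>" if "infdist x K \<le> \<delta>" for x
  proof -
    obtain k where "k \<in> K" "infdist x K = dist x k"
      using infdist_attains_inf[OF compact_imp_closed[OF assms(1)] assms(2)] by metis
    then show ?thesis using that R[of k] norm_triangle_sub[of x k] by (auto simp: dist_norm)
  qed
  then show ?thesis by (auto simp: bounded_iff)
qed

text \<open>Comparing the mollified densities on a neighbourhood of a compact set and letting the
  mollification parameter tend to zero compares the measures on compact sets.\<close>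

lemma emeasure_le_add_mollified:
  fixes \<alpha> \<beta> \<nu> :: "(real^'n) measure" and \<theta> :: "real^'n \<Rightarrow> real"
  assumes \<theta>: "mollifier \<theta>" and r: "radon_measure \<alpha>" "radon_measure \<beta>" "radon_measure \<nu>"
    and le: "\<And>z \<delta>. \<delta> > 0 \<Longrightarrow> (\<integral>\<^sup>+y. ennreal (rescale \<delta> \<theta> (z - y)) \<partial>\<alpha>)
      \<le> (\<integral>\<^sup>+y. ennreal (rescale \<delta> \<theta> (z - y)) \<partial>\<beta>) + (\<integral>\<^sup>+y. ennreal (rescale \<delta> \<theta> (z - y)) \<partial>\<nu>)"
    and A: "A \<in> sets borel"
  shows "emeasure \<alpha> A \<le> emeasure \<beta> A + emeasure \<nu> A"
proof -
  define N where "N K \<delta> = {x :: real^'n. infdist x K \<le> \<delta>}" for K \<delta>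
  have Nc: "closed (N K \<delta>)" for K \<delta>
    unfolding N_def by (intro closed_Collect_le continuous_intros)
  then have [measurable]: "N K \<delta> \<in> sets borel" for K \<delta> by simp
  note [measurable_cong] = radon_measure_sets[OF r(1)] radon_measure_sets[OF r(2)] radon_measure_sets[OF r(3)]
  have fub: "(\<integral>\<^sup>+z. indicator (N K \<delta>) z * (\<integral>\<^sup>+y. ennreal (rescale \<delta> \<theta> (z - y)) \<partial>M) \<partial>lborel)
    = (\<integral>\<^sup>+y. (\<integral>\<^sup>+z. indicator (N K \<delta>) z * ennreal (rescale \<delta> \<theta> (z - y)) \<partial>lborel) \<partial>M)"
    if \<delta>: "\<delta> > 0" and M: "radon_measure M" for \<delta> K M
  proof -
    interpret pair_sigma_finite lborel M by (rule lborel_pair_radon[OF M])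
    note [measurable_cong] = radon_measure_sets[OF M]
    note [measurable] = mollifier_measurable[OF \<theta> \<delta>]
    have "(\<integral>\<^sup>+z. indicator (N K \<delta>) z * (\<integral>\<^sup>+y. ennreal (rescale \<delta> \<theta> (z - y)) \<partial>M) \<partial>lborel)
      = (\<integral>\<^sup>+z. (\<integral>\<^sup>+y. indicator (N K \<delta>) z * ennreal (rescale \<delta> \<theta> (z - y)) \<partial>M) \<partial>lborel)"
      by (intro nn_integral_cong nn_integral_cmult[symmetric]) measurable
    also have "\<dots> = (\<integral>\<^sup>+y. (\<integral>\<^sup>+z. indicator (N K \<delta>) z * ennreal (rescale \<delta> \<theta> (z - y)) \<partial>lborel) \<partial>M)"
      by (rule Fubini'[symmetric]) measurable
    finally show ?thesis .
  qed
  have upper: "(\<integral>\<^sup>+z. indicator (N K \<delta>) z * (\<integral>\<^sup>+y. ennreal (rescale \<delta> \<theta> (z - y)) \<partial>M) \<partial>lborel)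
    \<le> emeasure M (N K (2 * \<delta>))"
    if \<delta>: "\<delta> > 0" and M: "radon_measure M" and K: "K \<noteq> {}" "closed K" for \<delta> K M
  proof -
    have "(\<integral>\<^sup>+z. indicator (N K \<delta>) z * ennreal (rescale \<delta> \<theta> (z - y)) \<partial>lborel) \<le> indicator (N K (2 * \<delta>)) y" for y
    proof (cases "y \<in> N K (2 * \<delta>)")
      case True
      have "(\<integral>\<^sup>+z. indicator (N K \<delta>) z * ennreal (rescale \<delta> \<theta> (z - y)) \<partial>lborel)
        \<le> (\<integral>\<^sup>+z. ennreal (rescale \<delta> \<theta> (z - y)) \<partial>lborel)"
        by (intro nn_integral_mono) (auto simp: indicator_def)
      then show ?thesis using True mollifier_nn_integral[OF \<theta> \<delta>] by simp
    next
      case False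
      have z: "indicator (N K \<delta>) z * ennreal (rescale \<delta> \<theta> (z - y)) = 0" for z
      proof (cases "z \<in> N K \<delta>")
        case True
        have "infdist y K \<le> infdist z K + dist y z" by (rule infdist_triangle)
        then have "norm (z - y) > \<delta>" using True False by (auto simp: N_def dist_norm norm_minus_commute)
        then show ?thesis using mollifier_eq_0[OF \<theta> \<delta>] by simp
      qed simp
      have "(\<integral>\<^sup>+z. indicator (N K \<delta>) z * ennreal (rescale \<delta> \<theta> (z - y)) \<partial>lborel) = integral\<^sup>N lborel (\<lambda>z::real^'n. 0)"
        by (rule nn_integral_cong) (rule z)
      then show ?thesis by simp
    qed
    then have "(\<integral>\<^sup>+y. (\<integral>\<^sup>+z. indicator (N K \<delta>) z * ennreal (rescale \<delta> \<theta> (z - y)) \<partial>lborel) \<partial>M)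
      \<le> (\<integral>\<^sup>+y. indicator (N K (2 * \<delta>)) y \<partial>M)" by (intro nn_integral_mono)
    then show ?thesis
      unfolding fub[OF \<delta> M] using radon_measure_sets[OF M] by simp
  qed
  have lower: "emeasure \<alpha> K \<le> (\<integral>\<^sup>+z. indicator (N K \<delta>) z * (\<integral>\<^sup>+y. ennreal (rescale \<delta> \<theta> (z - y)) \<partial>\<alpha>) \<partial>lborel)"
    if \<delta>: "\<delta> > 0" and K: "closed K" for \<delta> K
  proof -
    have "indicator K y \<le> (\<integral>\<^sup>+z. indicator (N K \<delta>) z * ennreal (rescale \<delta> \<theta> (z - y)) \<partial>lborel)" for y
    proof (cases "y \<in> K")
      case True
      have "indicator (N K \<delta>) z * ennreal (rescale \<delta> \<theta> (z - y)) = ennreal (rescale \<delta> \<theta> (z - y))" for z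
      proof (cases "norm (z - y) > \<delta>")
        case False
        then have "z \<in> N K \<delta>" using infdist_le2[OF True, of z \<delta>] by (simp add: N_def dist_norm)
        then show ?thesis by simp
      qed (use mollifier_eq_0[OF \<theta> \<delta>] in simp)
      then show ?thesis using True mollifier_nn_integral[OF \<theta> \<delta>] by simp
    qed simp
    then have "(\<integral>\<^sup>+y. indicator K y \<partial>\<alpha>)
      \<le> (\<integral>\<^sup>+y. (\<integral>\<^sup>+z. indicator (N K \<delta>) z * ennreal (rescale \<delta> \<theta> (z - y)) \<partial>lborel) \<partial>\<alpha>)"
      by (intro nn_integral_mono)
    then show ?thesis
      unfolding fub[OF \<delta> r(1)] using radon_measure_sets[OF r(1)] K by simp
  qed
  have compact_le: "emeasure \<alpha> K \<le> emeasure \<beta> K + emeasure \<nu> K" if K: "compact K" for K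
  proof (cases "K = {}")
    case False
    have cl: "closed K" using K by (rule compact_imp_closed)
    have step: "emeasure \<alpha> K \<le> emeasure \<beta> (N K (2 * \<delta>)) + emeasure \<nu> (N K (2 * \<delta>))" if \<delta>: "\<delta> > 0" for \<delta>
    proof -
      note [measurable] = mollifier_measurable[OF \<theta> \<delta>]
      interpret b: sigma_finite_measure \<beta> by (rule radon_sigma_finite[OF r(2)])
      interpret n: sigma_finite_measure \<nu> by (rule radon_sigma_finite[OF r(3)])
      have "emeasure \<alpha> K \<le> (\<integral>\<^sup>+z. indicator (N K \<delta>) z * (\<integral>\<^sup>+y. ennreal (rescale \<delta> \<theta> (z - y)) \<partial>\<alpha>) \<partial>lborel)"
        by (rule lower[OF \<delta> cl])
      also have "\<dots> \<le> (\<integral>\<^sup>+z. indicator (N K \<delta>) z * (\<integral>\<^sup>+y. ennreal (rescale \<delta> \<theta> (z - y)) \<partial>\<beta>)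
          + indicator (N K \<delta>) z * (\<integral>\<^sup>+y. ennreal (rescale \<delta> \<theta> (z - y)) \<partial>\<nu>) \<partial>lborel)"
        unfolding distrib_left[symmetric] by (intro nn_integral_mono mult_left_mono le[OF \<delta>]) auto
      also have "\<dots> = (\<integral>\<^sup>+z. indicator (N K \<delta>) z * (\<integral>\<^sup>+y. ennreal (rescale \<delta> \<theta> (z - y)) \<partial>\<beta>) \<partial>lborel)
          + (\<integral>\<^sup>+z. indicator (N K \<delta>) z * (\<integral>\<^sup>+y. ennreal (rescale \<delta> \<theta> (z - y)) \<partial>\<nu>) \<partial>lborel)"
        by (rule nn_integral_add) measurable
      also have "\<dots> \<le> emeasure \<beta> (N K (2 * \<delta>)) + emeasure \<nu> (N K (2 * \<delta>))"
        by (intro add_mono upper \<delta> r False cl)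
      finally show ?thesis .
    qed
    let ?d = "\<lambda>n. 2 * inverse (real (Suc n))"
    have INT: "(\<Inter>n. N K (?d n)) = K"
    proof
      show "(\<Inter>n. N K (?d n)) \<subseteq> K"
      proof
        fix x assume x: "x \<in> (\<Inter>n. N K (?d n))"
        have "?d \<longlonglongrightarrow> 0"
          by (rule tendsto_mult_right_zero[OF LIMSEQ_inverse_real_of_nat])
        moreover have "infdist x K \<le> ?d n" for n using x by (auto simp: N_def)
        ultimately have "infdist x K \<le> 0" by (intro LIMSEQ_le_const[of ?d]) blast+
        then show "x \<in> K" using in_closed_iff_infdist_zero[OF cl False, of x] infdist_nonneg[of x K] by simp
      qed
    qed (auto simp: N_def)
    have lim: "(\<lambda>n. emeasure M (N K (?d n))) \<longlonglongrightarrow> emeasure M K" if M: "radon_measure M" for M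
    proof (rule Lim_emeasure_decseq[where A="\<lambda>n. N K (?d n)" and M=M, unfolded INT])
      show "range (\<lambda>n. N K (?d n)) \<subseteq> sets M"
        unfolding radon_measure_sets[OF M] by (intro image_subsetI) measurable
      show "decseq (\<lambda>n. N K (?d n))"
      proof (rule decseq_SucI)
        have "?d (Suc n) \<le> ?d n" for n by (intro mult_left_mono le_imp_inverse_le) auto
        then show "N K (?d (Suc n)) \<le> N K (?d n)" for n
          unfolding N_def by (intro Collect_mono impI) (rule order_trans)
      qed
      show "emeasure M (N K (?d n)) \<noteq> \<infinity>" for n
        unfolding N_def by (rule less_imp_neq[OF radon_measure_bounded[OF M infdist_nbhd_bounded[OF K False]]])
    qed
    have "emeasure \<alpha> K \<le> emeasure \<beta> (N K (?d n)) + emeasure \<nu> (N K (?d n))" for n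
      by (rule step) simp
    then show ?thesis
      by (intro LIMSEQ_le_const[OF tendsto_add[OF lim[OF r(2)] lim[OF r(3)]]]) blast
  qed simp
  show ?thesis
  proof (rule emeasure_le_add_bounded[OF _ _ _ _ A])
    fix A :: "(real^'n) set" assume A[measurable]: "A \<in> sets borel" and bA: "bounded A"
    obtain R where R: "A \<subseteq> cball 0 R" using bA by (metis bounded_iff mem_cball_0 subsetI)
    define \<alpha>' where "\<alpha>' = density \<alpha> (indicator (cball 0 R))"
    have ea: "emeasure \<alpha>' B = emeasure \<alpha> (B \<inter> cball 0 R)" if "B \<in> sets borel" for B
    proof -
      have "emeasure \<alpha>' B = (\<integral>\<^sup>+x. indicator (cball 0 R) x * indicator B x \<partial>\<alpha>)"
        unfolding \<alpha>'_def using that radon_measure_sets[OF r(1)] by (intro emeasure_density borel_measurable_indicator) auto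
      also have "\<dots> = (\<integral>\<^sup>+x. indicator (B \<inter> cball 0 R) x \<partial>\<alpha>)"
        by (intro nn_integral_cong) (auto simp: indicator_def)
      finally show ?thesis using that radon_measure_sets[OF r(1)] by simp
    qed
    have s': "sets \<alpha>' = sets borel" using radon_measure_sets[OF r(1)] by (simp add: \<alpha>'_def)
    moreover have "emeasure \<alpha>' (space \<alpha>') \<noteq> \<infinity>"
      using ea[of UNIV] less_imp_neq[OF radon_measure_bounded[OF r(1) bounded_cball[of 0 R]]]
        sets_eq_imp_space_eq[OF s'] by simp
    ultimately have "emeasure \<alpha>' A = (SUP K\<in>{K. K \<subseteq> A \<and> compact K}. emeasure \<alpha>' K)"
      using A by (rule inner_regular)
    also have "\<dots> \<le> emeasure \<beta> A + emeasure \<nu> A"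
    proof (rule SUP_least)
      fix K assume "K \<in> {K. K \<subseteq> A \<and> compact K}"
      then have K: "K \<subseteq> A" "compact K" "K \<subseteq> cball 0 R" using R by auto
      have "emeasure \<alpha>' K = emeasure \<alpha> K"
        using ea[of K] K by (simp add: borel_compact Int_absorb2)
      also have "\<dots> \<le> emeasure \<beta> K + emeasure \<nu> K" by (rule compact_le[OF K(2)])
      also have "\<dots> \<le> emeasure \<beta> A + emeasure \<nu> A"
        using K r by (intro add_mono emeasure_mono) (auto simp: radon_measure_sets)
      finally show "emeasure \<alpha>' K \<le> emeasure \<beta> A + emeasure \<nu> A" .
    qed
    finally show "emeasure \<alpha> A \<le> emeasure \<beta> A + emeasure \<nu> A"
      using ea[OF A] R by (simp add: Int_absorb2)
  qed (use r in \<open>auto simp: radon_measure_sets\<close>)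
qed

lemma locally_integrable_finite:
  fixes f :: "real^'n \<Rightarrow> real"
  assumes "locally_integrable f"
  shows "(\<integral>\<^sup>+x. ennreal \<bar>f x\<bar> * indicator (cball a r) x \<partial>lborel) < \<infinity>"
proof -
  have "(\<integral>\<^sup>+x. ennreal \<bar>f x\<bar> * indicator (cball a r) x \<partial>lebesgue)
      = (\<integral>\<^sup>+x. ennreal (norm (indicator (cball a r) x * \<bar>f x\<bar>)) \<partial>lebesgue)"
    by (intro nn_integral_cong) (auto simp: indicator_def)
  also have "\<dots> < \<infinity>"
    using locally_integrable_cball[OF assms] by (simp add: integrable_iff_bounded)
  finally show ?thesis by (simp add: nn_integral_completion)
qed

lemma locally_integrableI:
  fixes f :: "real^'n \<Rightarrow> real"
  assumes [measurable]: "f \<in> borel_measurable borel"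
    and fin: "\<And>r. (\<integral>\<^sup>+x. ennreal \<bar>f x\<bar> * indicator (cball 0 r) x \<partial>lborel) < \<infinity>"
  shows "locally_integrable f"
  unfolding locally_integrable_def set_integrable_def
proof (intro allI impI)
  fix K :: "(real^'n) set" assume K: "compact K"
  then have [measurable]: "K \<in> sets borel" by (rule borel_compact)
  obtain r where r: "K \<subseteq> cball 0 r" using compact_imp_bounded[OF K] by (metis bounded_iff mem_cball_0 subsetI)
  have "integrable lborel (\<lambda>x. indicator K x *\<^sub>R f x)"
  proof (rule integrableI_bounded)
    have "(\<integral>\<^sup>+x. ennreal (norm (indicator K x *\<^sub>R f x)) \<partial>lborel)
        \<le> (\<integral>\<^sup>+x. ennreal \<bar>f x\<bar> * indicator (cball 0 r) x \<partial>lborel)"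
      using r by (intro nn_integral_mono) (auto simp: indicator_def)
    also have "\<dots> < \<infinity>" by (rule fin)
    finally show "(\<integral>\<^sup>+x. ennreal (norm (indicator K x *\<^sub>R f x)) \<partial>lborel) < \<infinity>" .
  qed measurable
  then show "integrable lebesgue (\<lambda>x. indicator K x *\<^sub>R f x)"
    by (subst integrable_completion) measurable
qed

lemma integrable_lborel_mult:
  fixes f g :: "real^'n \<Rightarrow> real"
  assumes "locally_integrable f" and [measurable]: "f \<in> borel_measurable borel" "g \<in> borel_measurable borel"
    and "\<And>y. \<bar>g y\<bar> \<le> B" "\<And>y. y \<notin> cball x r \<Longrightarrow> g y = 0"
  shows "integrable lborel (\<lambda>y. f y * g y)"
  using locally_integrable_mult[OF assms(1,3-5)] by (subst (asm) integrable_completion) auto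

lemma radon_integrable:
  fixes g :: "real^'n \<Rightarrow> real"
  assumes M: "radon_measure M" and g: "g \<in> borel_measurable borel"
    and B: "\<And>y. \<bar>g y\<bar> \<le> B" and z: "\<And>y. y \<notin> cball x r \<Longrightarrow> g y = 0"
  shows "integrable M g"
proof (rule Bochner_Integration.integrable_bound)
  show "integrable M (\<lambda>y. B * indicator (cball x r) y)"
    using radon_measure_bounded[OF M bounded_cball] radon_measure_sets[OF M]
    by (intro integrable_mult_right integrable_real_indicator) auto
  show "g \<in> borel_measurable M"
    using g radon_measure_sets[OF M] by (simp cong: measurable_cong_sets)
  show "AE y in M. norm (g y) \<le> norm (B * indicator (cball x r) y)"
    using B z order_trans[OF B abs_ge_self] by (intro AE_I2) (auto simp: indicator_def)
qed

lemma radon_density: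
  fixes f :: "real^'n \<Rightarrow> real"
  assumes f: "locally_integrable f" and [measurable]: "f \<in> borel_measurable borel"
  shows "radon_measure (density lborel (\<lambda>x. ennreal (f x)))"
  unfolding radon_measure_def
proof (intro conjI allI impI)
  fix K :: "(real^'n) set" assume K: "compact K"
  obtain r where r: "K \<subseteq> cball 0 r" using compact_imp_bounded[OF K] by (metis bounded_iff mem_cball_0 subsetI)
  have "emeasure (density lborel (\<lambda>x. ennreal (f x))) K = (\<integral>\<^sup>+x. ennreal (f x) * indicator K x \<partial>lborel)"
    using K by (intro emeasure_density) (auto simp: borel_compact)
  also have "\<dots> \<le> (\<integral>\<^sup>+x. ennreal \<bar>f x\<bar> * indicator (cball 0 r) x \<partial>lborel)"
    using r by (intro nn_integral_mono) (auto simp: indicator_def intro!: ennreal_leI)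
  also have "\<dots> < \<infinity>" by (rule locally_integrable_finite[OF f])
  finally show "emeasure (density lborel (\<lambda>x. ennreal (f x))) K < \<infinity>" .
qed simp

lemma mollifier_bounded:
  fixes \<theta> :: "real^'n \<Rightarrow> real"
  assumes "mollifier \<theta>" "\<delta> > 0"
  obtains B where "\<And>x. \<bar>rescale \<delta> \<theta> x\<bar> \<le> B"
proof (rule continuous_zero_outside_bounded[of "rescale \<delta> \<theta>" \<delta>])
  show "continuous_on UNIV (rescale \<delta> \<theta>)"
    using assms by (intro smooth_continuous smooth_rescale) (auto simp: mollifier_def)
  show "rescale \<delta> \<theta> x = 0" if "x \<notin> cball 0 \<delta>" for x
    using that by (intro mollifier_eq_0[OF assms]) auto
qed (use that in auto)

lemma positive_part_le_mollified:
  fixes f :: "real^'n \<Rightarrow> real" and \<theta> :: "real^'n \<Rightarrow> real"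
  assumes \<theta>: "mollifier \<theta>" and f: "locally_integrable f" and fm[measurable]: "f \<in> borel_measurable borel"
    and \<nu>: "radon_measure \<nu>"
    and le: "\<And>z \<delta>. \<delta> > 0 \<Longrightarrow> ennreal \<bar>\<integral>y. f y * rescale \<delta> \<theta> (z - y) \<partial>lborel\<bar>
      \<le> (\<integral>\<^sup>+y. ennreal (rescale \<delta> \<theta> (z - y)) \<partial>\<nu>)"
    and A[measurable]: "A \<in> sets borel"
  shows "(\<integral>\<^sup>+x. ennreal (f x) * indicator A x \<partial>lborel) \<le> emeasure \<nu> (A \<inter> {x. 0 < f x})"
proof -
  let ?\<alpha> = "density lborel (\<lambda>x. ennreal (f x))" and ?\<beta> = "density lborel (\<lambda>x. ennreal (- f x))"
  let ?A = "A \<inter> {x. 0 < f x}"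
  have f': "locally_integrable (\<lambda>x. - f x)"
    using f by (auto simp: locally_integrable_def set_integrable_def)
  have "emeasure ?\<alpha> ?A \<le> emeasure ?\<beta> ?A + emeasure \<nu> ?A"
  proof (rule emeasure_le_add_mollified[OF \<theta> radon_density[OF f fm] radon_density[OF f'] \<nu>])
    fix z :: "real^'n" and \<delta> :: real assume \<delta>: "\<delta> > 0"
    note [measurable] = mollifier_measurable[OF \<theta> \<delta>]
    let ?g = "\<lambda>y. rescale \<delta> \<theta> (z - y)"
    obtain B where B: "\<And>x. \<bar>rescale \<delta> \<theta> x\<bar> \<le> B" using mollifier_bounded[OF \<theta> \<delta>] by auto
    have i: "integrable lborel (\<lambda>y. f y * ?g y)"
    proof (rule integrable_lborel_mult[OF f])
      show "?g y = 0" if "y \<notin> cball z \<delta>" for y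
        using that by (intro mollifier_eq_0[OF \<theta> \<delta>]) (auto simp: dist_norm)
    qed (use B in auto)
    have g0: "0 \<le> ?g y" for y by (rule mollifier_nonneg[OF \<theta> \<delta>])
    have ip: "integrable lborel (\<lambda>y. max 0 (f y) * ?g y)" and im: "integrable lborel (\<lambda>y. max 0 (- f y) * ?g y)"
      by (rule Bochner_Integration.integrable_bound[OF i]; auto simp: abs_mult intro!: AE_I2 mult_right_mono)+
    have "(\<integral>y. f y * ?g y \<partial>lborel) = (\<integral>y. max 0 (f y) * ?g y - max 0 (- f y) * ?g y \<partial>lborel)"
      by (rule Bochner_Integration.integral_cong) (auto simp: max_def)
    then have eq: "(\<integral>y. f y * ?g y \<partial>lborel) = (\<integral>y. max 0 (f y) * ?g y \<partial>lborel) - (\<integral>y. max 0 (- f y) * ?g y \<partial>lborel)"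
      using ip im by simp
    have pos: "0 \<le> (\<integral>y. max 0 (- f y) * ?g y \<partial>lborel)"
      using g0 by (intro integral_nonneg_AE) auto
    have dens: "(\<integral>\<^sup>+y. ennreal (?g y) \<partial>density lborel (\<lambda>x. ennreal (k x))) = ennreal (\<integral>y. max 0 (k y) * ?g y \<partial>lborel)"
      if k: "integrable lborel (\<lambda>y. max 0 (k y) * ?g y)" and [measurable]: "k \<in> borel_measurable borel"
      for k :: "real^'n \<Rightarrow> real"
    proof -
      have "(\<integral>\<^sup>+y. ennreal (?g y) \<partial>density lborel (\<lambda>x. ennreal (k x))) = (\<integral>\<^sup>+y. ennreal (k y) * ennreal (?g y) \<partial>lborel)"
        by (rule nn_integral_density) measurable
      also have "\<dots> = (\<integral>\<^sup>+y. ennreal (max 0 (k y) * ?g y) \<partial>lborel)"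
        using g0 by (intro nn_integral_cong) (auto simp: max_def ennreal_mult' ennreal_neg)
      also have "\<dots> = ennreal (\<integral>y. max 0 (k y) * ?g y \<partial>lborel)"
        using g0 by (intro nn_integral_eq_integral k) auto
      finally show ?thesis .
    qed
    have "(\<integral>\<^sup>+y. ennreal (?g y) \<partial>?\<alpha>) = ennreal (\<integral>y. max 0 (f y) * ?g y \<partial>lborel)"
      by (rule dens[OF ip fm])
    also have "\<dots> \<le> ennreal ((\<integral>y. max 0 (- f y) * ?g y \<partial>lborel) + \<bar>\<integral>y. f y * ?g y \<partial>lborel\<bar>)"
      unfolding eq by (intro ennreal_leI) linarith
    also have "\<dots> = (\<integral>\<^sup>+y. ennreal (?g y) \<partial>?\<beta>) + ennreal \<bar>\<integral>y. f y * ?g y \<partial>lborel\<bar>"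
      using pos im by (subst dens) (auto simp: ennreal_plus)
    also have "\<dots> \<le> (\<integral>\<^sup>+y. ennreal (?g y) \<partial>?\<beta>) + (\<integral>\<^sup>+y. ennreal (?g y) \<partial>\<nu>)"
      by (intro add_left_mono le \<delta>)
    finally show "(\<integral>\<^sup>+y. ennreal (?g y) \<partial>?\<alpha>) \<le> (\<integral>\<^sup>+y. ennreal (?g y) \<partial>?\<beta>) + (\<integral>\<^sup>+y. ennreal (?g y) \<partial>\<nu>)" .
  qed measurable
  moreover have "emeasure ?\<beta> ?A = 0"
  proof -
    have "emeasure ?\<beta> ?A = (\<integral>\<^sup>+x. ennreal (- f x) * indicator ?A x \<partial>lborel)"
      by (rule emeasure_density) measurable
    also have "\<dots> = integral\<^sup>N lborel (\<lambda>x::real^'n. 0)"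
      by (intro nn_integral_cong) (auto simp: indicator_def ennreal_neg)
    finally show ?thesis by simp
  qed
  moreover have "emeasure ?\<alpha> ?A = (\<integral>\<^sup>+x. ennreal (f x) * indicator A x \<partial>lborel)"
  proof -
    have "emeasure ?\<alpha> ?A = (\<integral>\<^sup>+x. ennreal (f x) * indicator ?A x \<partial>lborel)"
      by (rule emeasure_density) measurable
    also have "\<dots> = (\<integral>\<^sup>+x. ennreal (f x) * indicator A x \<partial>lborel)"
      by (intro nn_integral_cong) (auto simp: indicator_def ennreal_neg not_less)
    finally show ?thesis .
  qed
  ultimately show ?thesis by simp
qed

lemma abs_le_mollified:
  fixes f :: "real^'n \<Rightarrow> real" and \<theta> :: "real^'n \<Rightarrow> real"
  assumes \<theta>: "mollifier \<theta>" and f: "locally_integrable f" and fm[measurable]: "f \<in> borel_measurable borel"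
    and \<nu>: "radon_measure \<nu>"
    and le: "\<And>z \<delta>. \<delta> > 0 \<Longrightarrow> ennreal \<bar>\<integral>y. f y * rescale \<delta> \<theta> (z - y) \<partial>lborel\<bar>
      \<le> (\<integral>\<^sup>+y. ennreal (rescale \<delta> \<theta> (z - y)) \<partial>\<nu>)"
    and A[measurable]: "A \<in> sets borel"
  shows "(\<integral>\<^sup>+x. ennreal \<bar>f x\<bar> * indicator A x \<partial>lborel) \<le> emeasure \<nu> A"
proof -
  have f': "locally_integrable (\<lambda>x. - f x)"
    using f by (auto simp: locally_integrable_def set_integrable_def)
  note s = radon_measure_sets[OF \<nu>]
  have "(\<integral>\<^sup>+x. ennreal \<bar>f x\<bar> * indicator A x \<partial>lborel)
      = (\<integral>\<^sup>+x. ennreal (f x) * indicator A x + ennreal (- f x) * indicator A x \<partial>lborel)"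
    by (intro nn_integral_cong) (auto simp: indicator_def abs_if ennreal_neg)
  also have "\<dots> = (\<integral>\<^sup>+x. ennreal (f x) * indicator A x \<partial>lborel) + (\<integral>\<^sup>+x. ennreal (- f x) * indicator A x \<partial>lborel)"
    by (rule nn_integral_add) measurable
  also have "\<dots> \<le> emeasure \<nu> (A \<inter> {x. 0 < f x}) + emeasure \<nu> (A \<inter> {x. 0 < - f x})"
  proof (intro add_mono positive_part_le_mollified[OF \<theta> f fm \<nu> _ A] positive_part_le_mollified[OF \<theta> f' _ \<nu> _ A])
    fix z :: "real^'n" and \<delta> :: real assume "\<delta> > 0"
    from le[OF this] show "ennreal \<bar>\<integral>y. f y * rescale \<delta> \<theta> (z - y) \<partial>lborel\<bar>
        \<le> (\<integral>\<^sup>+y. ennreal (rescale \<delta> \<theta> (z - y)) \<partial>\<nu>)"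
      "ennreal \<bar>\<integral>y. - f y * rescale \<delta> \<theta> (z - y) \<partial>lborel\<bar>
        \<le> (\<integral>\<^sup>+y. ennreal (rescale \<delta> \<theta> (z - y)) \<partial>\<nu>)" by simp_all
  qed measurable
  also have "\<dots> = emeasure \<nu> ((A \<inter> {x. 0 < f x}) \<union> (A \<inter> {x. 0 < - f x}))"
    by (rule plus_emeasure) (auto simp: s)
  also have "\<dots> \<le> emeasure \<nu> A" by (rule emeasure_mono) (auto simp: s)
  finally show ?thesis .
qed

subsection \<open>Difference quotients\<close>

lemma lborel_integral_translate:
  fixes f :: "real^'n \<Rightarrow> real"
  assumes [measurable]: "f \<in> borel_measurable borel"
  shows "(\<integral>y. f (h + y) \<partial>lborel) = (\<integral>y. f y \<partial>lborel)"
proof -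
  have "(\<integral>y. f y \<partial>lborel) = (\<integral>y. f y \<partial>distr lborel borel ((+) h))" by (simp only: lborel_distr_plus)
  also have "\<dots> = (\<integral>y. f (h + y) \<partial>lborel)" by (rule integral_distr) measurable
  finally show ?thesis by simp
qed

lemma lborel_nn_integral_translate:
  fixes f :: "real^'n \<Rightarrow> ennreal"
  assumes [measurable]: "f \<in> borel_measurable borel"
  shows "(\<integral>\<^sup>+y. f (h + y) \<partial>lborel) = (\<integral>\<^sup>+y. f y \<partial>lborel)"
  using nn_integral_lborel_affine[OF assms, of 1 h] by simp

lemma locally_integrable_translate:
  fixes v :: "real^'n \<Rightarrow> real"
  assumes v: "locally_integrable v" and [measurable]: "v \<in> borel_measurable borel"
  shows "locally_integrable (\<lambda>x. v (x - h))"
proof (rule locally_integrableI)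
  fix r
  have [measurable]: "cball (0 :: real^'n) r \<in> sets borel" by simp
  have m: "(\<lambda>x. ennreal \<bar>v (x - h)\<bar> * indicator (cball 0 r) x) \<in> borel_measurable borel"
    by measurable
  have "(\<integral>\<^sup>+x. ennreal \<bar>v (x - h)\<bar> * indicator (cball 0 r) x \<partial>lborel)
      = (\<integral>\<^sup>+x. ennreal \<bar>v x\<bar> * indicator (cball 0 r) (h + x) \<partial>lborel)"
    using lborel_nn_integral_translate[OF m, of h] by simp
  also have "\<dots> \<le> (\<integral>\<^sup>+x. ennreal \<bar>v x\<bar> * indicator (cball (-h) r) x \<partial>lborel)"
    by (intro nn_integral_mono) (auto simp: indicator_def dist_norm norm_minus_commute add.commute)
  also have "\<dots> < \<infinity>" by (rule locally_integrable_finite[OF v])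
  finally show "(\<integral>\<^sup>+x. ennreal \<bar>v (x - h)\<bar> * indicator (cball 0 r) x \<partial>lborel) < \<infinity>" .
qed measurable

text \<open>The measure \<open>c \<integral>\<^sub>0\<^sup>1 (\<tau>\<^sub>t\<^sub>h)\<^sub># M dt\<close>, where \<open>\<tau>\<^sub>t\<^sub>h\<close> is the translation by \<open>t h\<close>.\<close>

definition segment_measure :: "(real^'n) measure \<Rightarrow> real \<Rightarrow> real^'n \<Rightarrow> (real^'n) measure" where
  "segment_measure M c h =
    distr (density (M \<Otimes>\<^sub>M lborel) (\<lambda>(y, t). ennreal c * indicator {0..1} t)) borel (\<lambda>(y, t). y + t *\<^sub>R h)"

lemma nn_integral_segment_measure:
  fixes M :: "(real^'n) measure"
  assumes M: "radon_measure M" and [measurable]: "g \<in> borel_measurable borel"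
  shows "(\<integral>\<^sup>+x. g x \<partial>segment_measure M c h)
    = (\<integral>\<^sup>+y. (\<integral>\<^sup>+t. ennreal c * indicator {0..1} t * g (y + t *\<^sub>R h) \<partial>lborel) \<partial>M)"
proof -
  note [measurable_cong] = radon_measure_sets[OF M]
  have "(\<integral>\<^sup>+x. g x \<partial>segment_measure M c h)
      = (\<integral>\<^sup>+p. g (case p of (y, t) \<Rightarrow> y + t *\<^sub>R h)
          \<partial>density (M \<Otimes>\<^sub>M lborel) (\<lambda>(y, t). ennreal c * indicator {0..1} t))"
    unfolding segment_measure_def by (rule nn_integral_distr) measurable
  also have "\<dots> = (\<integral>\<^sup>+p. (case p of (y, t) \<Rightarrow> ennreal c * indicator {0..1} t) * g (case p of (y, t) \<Rightarrow> y + t *\<^sub>R h)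
      \<partial>(M \<Otimes>\<^sub>M lborel))"
    by (rule nn_integral_density) measurable
  also have "\<dots> = (\<integral>\<^sup>+y. (\<integral>\<^sup>+t. ennreal c * indicator {0..1} t * g (y + t *\<^sub>R h) \<partial>lborel) \<partial>M)"
    by (subst lborel.nn_integral_fst[symmetric], measurable)
  finally show ?thesis .
qed

lemma radon_segment_measure:
  fixes M :: "(real^'n) measure"
  assumes M: "radon_measure M"
  shows "radon_measure (segment_measure M c h)"
  unfolding radon_measure_def
proof (intro conjI allI impI)
  show s: "sets (segment_measure M c h) = sets borel" by (simp add: segment_measure_def)
  fix K :: "(real^'n) set" assume K: "compact K"
  then have [measurable]: "K \<in> sets borel" by (rule borel_compact)
  obtain r where r: "K \<subseteq> cball 0 r" using compact_imp_bounded[OF K] by (metis bounded_iff mem_cball_0 subsetI)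
  have "emeasure (segment_measure M c h) K = (\<integral>\<^sup>+x. indicator K x \<partial>segment_measure M c h)"
    by (simp add: s)
  also have "\<dots> = (\<integral>\<^sup>+y. (\<integral>\<^sup>+t. ennreal c * indicator {0..1} t * indicator K (y + t *\<^sub>R h) \<partial>lborel) \<partial>M)"
    by (rule nn_integral_segment_measure[OF M]) measurable
  also have "\<dots> \<le> (\<integral>\<^sup>+y. (\<integral>\<^sup>+t. ennreal c * indicator {0..1::real} t * indicator (cball 0 (r + norm h)) y \<partial>lborel) \<partial>M)"
  proof (intro nn_integral_mono)
    fix y and t :: real
    have "norm y \<le> r + norm h" if "t \<in> {0..1}" "y + t *\<^sub>R h \<in> K"
    proof -
      have "norm (t *\<^sub>R h) \<le> norm h" using that mult_left_le_one_le[of "norm h" t] by simp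
      moreover have "norm (y + t *\<^sub>R h) \<le> r" using that r by auto
      ultimately show ?thesis using norm_triangle_ineq4[of "y + t *\<^sub>R h" "t *\<^sub>R h"] by simp
    qed
    then show "ennreal c * indicator {0..1} t * indicator K (y + t *\<^sub>R h)
        \<le> ennreal c * indicator {0..1} t * indicator (cball 0 (r + norm h)) y"
      by (auto simp: indicator_def)
  qed
  also have "\<dots> = (\<integral>\<^sup>+y. ennreal c * indicator (cball 0 (r + norm h)) y \<partial>M)"
    by (simp add: nn_integral_multc nn_integral_cmult)
  also have "\<dots> = ennreal c * emeasure M (cball 0 (r + norm h))"
    using radon_measure_sets[OF M] by (intro nn_integral_cmult_indicator) simp
  also have "\<dots> < \<infinity>"
    using radon_measure_bounded[OF M bounded_cball] by (simp add: ennreal_mult_less_top)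
  finally show "emeasure (segment_measure M c h) K < \<infinity>" .
qed

lemma integral_diff_le_add_measure:
  fixes g :: "real^'n \<Rightarrow> real"
  assumes P: "radon_measure P" and N: "radon_measure N" and M: "radon_measure M"
    and le: "\<And>A. A \<in> sets borel \<Longrightarrow> emeasure P A \<le> emeasure N A + emeasure M A"
    and g: "g \<in> borel_measurable borel" "\<And>y. 0 \<le> g y" "\<And>y. \<bar>g y\<bar> \<le> B" "\<And>y. y \<notin> cball x r \<Longrightarrow> g y = 0"
  shows "(\<integral>y. g y \<partial>P) - (\<integral>y. g y \<partial>N) \<le> (\<integral>y. g y \<partial>M)"
proof -
  have i: "integrable Q g" if "radon_measure Q" for Q
    by (rule radon_integrable[OF that g(1,3,4)])
  have e: "(\<integral>\<^sup>+y. ennreal (g y) \<partial>Q) = ennreal (\<integral>y. g y \<partial>Q)" if "radon_measure Q" for Q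
    using i[OF that] g(2) by (intro nn_integral_eq_integral) auto
  have p: "0 \<le> (\<integral>y. g y \<partial>Q)" for Q using g(2) by (intro integral_nonneg_AE) auto
  have "(\<integral>\<^sup>+y. ennreal (g y) \<partial>P) \<le> (\<integral>\<^sup>+y. ennreal (g y) \<partial>N) + (\<integral>\<^sup>+y. ennreal (g y) \<partial>M)"
    using P N M le g(1) by (intro nn_integral_le_add_measure) (auto simp: radon_measure_sets cong: measurable_cong_sets)
  then have "ennreal (\<integral>y. g y \<partial>P) \<le> ennreal ((\<integral>y. g y \<partial>N) + (\<integral>y. g y \<partial>M))"
    using p P N M by (simp add: e ennreal_plus)
  then show ?thesis using p by (subst (asm) ennreal_le_iff) (auto simp: add_nonneg_nonneg)
qed

text \<open>The difference quotients of \<open>v\<close> are controlled by its derivative measure: the mollification of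
  \<open>v\<close> is differentiable, and its gradient is the mollification of that measure.\<close>

lemma translation_difference_le:
  fixes v :: "real^'n \<Rightarrow> real" and \<theta> :: "real^'n \<Rightarrow> real" and P N :: "'n \<Rightarrow> (real^'n) measure"
  assumes \<theta>: "mollifier \<theta>" and v: "locally_integrable v" and vm[measurable]: "v \<in> borel_measurable borel"
    and P: "\<And>j. radon_measure (P j)" and N: "\<And>j. radon_measure (N j)" and M: "radon_measure M"
    and PN: "\<And>j A. A \<in> sets borel \<Longrightarrow> emeasure (P j) A \<le> emeasure (N j) A + emeasure M A"
    and NP: "\<And>j A. A \<in> sets borel \<Longrightarrow> emeasure (N j) A \<le> emeasure (P j) A + emeasure M A"
    and deriv: "\<And>\<psi> j. test_function \<psi> \<Longrightarrow>
      (\<integral>x. v x * grad \<psi> x $ j \<partial>lebesgue) = - ((\<integral>x. \<psi> x \<partial>P j) - (\<integral>x. \<psi> x \<partial>N j))"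
    and A: "A \<in> sets borel"
  shows "(\<integral>\<^sup>+x. ennreal \<bar>v x - v (x - h)\<bar> * indicator A x \<partial>lborel)
    \<le> emeasure (segment_measure M (\<Sum>j\<in>UNIV. \<bar>h $ j\<bar>) h) A"
proof (rule abs_le_mollified[OF \<theta> _ _ radon_segment_measure[OF M] _ A])
  define c where "c = (\<Sum>j\<in>UNIV. \<bar>h $ j\<bar>)"
  have c: "c \<ge> 0" by (simp add: c_def sum_nonneg)
  note [measurable_cong] = radon_measure_sets[OF M]
  interpret M: sigma_finite_measure M by (rule radon_sigma_finite[OF M])
  have vh: "locally_integrable (\<lambda>x. v (x - h))" by (rule locally_integrable_translate[OF v vm])
  show "locally_integrable (\<lambda>x. v x - v (x - h))"
    using v vh by (auto simp: locally_integrable_def intro: set_integral_diff)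
  fix z :: "real^'n" and \<delta> :: real assume \<delta>: "\<delta> > 0"
  note [measurable] = mollifier_measurable[OF \<theta> \<delta>]
  define k where "k = rescale \<delta> \<theta>"
  have sm: "smooth \<theta>" and supp: "supp \<theta> \<subseteq> cball 0 1" using \<theta> by (auto simp: mollifier_def)
  have km[measurable]: "k \<in> borel_measurable borel" by (simp add: k_def)
  have ksm: "smooth k" unfolding k_def by (rule smooth_rescale[OF sm])
  have k0: "0 \<le> k x" for x unfolding k_def by (rule mollifier_nonneg[OF \<theta> \<delta>])
  have kz: "k (w - y) = 0" if "y \<notin> cball w \<delta>" for w y
    unfolding k_def using that by (intro mollifier_eq_0[OF \<theta> \<delta>]) (auto simp: dist_norm)
  have ks: "supp k \<subseteq> cball 0 \<delta>"
    by (rule compact_suppI(2)) (use kz[where y=0] in \<open>force simp: dist_norm\<close>)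
  obtain B where B: "\<And>x. \<bar>k x\<bar> \<le> B" unfolding k_def using mollifier_bounded[OF \<theta> \<delta>] by auto
  define F where "F = conv v k"
  define G where "G w = (\<chi> j. \<integral>y. v y * grad k (w - y) $ j \<partial>lebesgue)" for w
  define m where "m w = (\<integral>y. k (w - y) \<partial>M)" for w
  have F': "(F has_derivative (\<lambda>a. G w \<bullet> a)) (at w)" for w
    unfolding F_def G_def by (rule conv_has_derivative[OF v ksm ks])
  have mi: "integrable M (\<lambda>y. k (w - y))" for w
    by (rule radon_integrable[OF M _ B kz]) measurable
  have me: "(\<integral>\<^sup>+y. ennreal (k (w - y)) \<partial>M) = ennreal (m w)" for w
    unfolding m_def using mi k0 by (intro nn_integral_eq_integral) auto
  have m0: "0 \<le> m w" for w unfolding m_def using k0 by (intro integral_nonneg_AE) auto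
  have G: "\<bar>G w $ j\<bar> \<le> m w" for w j
  proof -
    have "test_function (\<lambda>y. k (w - y))" unfolding k_def by (rule test_function_rescale(2)[OF sm supp \<delta>])
    from deriv[OF this, of j] have "G w $ j = (\<integral>y. k (w - y) \<partial>P j) - (\<integral>y. k (w - y) \<partial>N j)"
      by (simp add: grad_reflect[OF ksm] G_def)
    moreover have km': "(\<lambda>y. k (w - y)) \<in> borel_measurable borel" by measurable
    moreover have "(\<integral>y. k (w - y) \<partial>P j) - (\<integral>y. k (w - y) \<partial>N j) \<le> m w"
      unfolding m_def by (rule integral_diff_le_add_measure[OF P N M _ km' k0 B kz]) (rule PN)
    moreover have "(\<integral>y. k (w - y) \<partial>N j) - (\<integral>y. k (w - y) \<partial>P j) \<le> m w"
      unfolding m_def by (rule integral_diff_le_add_measure[OF N P M _ km' k0 B kz]) (rule NP)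
    ultimately show ?thesis by linarith
  qed
  have Gh: "\<bar>G w \<bullet> h\<bar> \<le> c * m w" for w
  proof -
    have "\<bar>G w \<bullet> h\<bar> \<le> (\<Sum>j\<in>UNIV. \<bar>G w $ j * h $ j\<bar>)" unfolding inner_vec_def by simp
    also have "\<dots> \<le> (\<Sum>j\<in>UNIV. m w * \<bar>h $ j\<bar>)"
      by (intro sum_mono) (auto simp: abs_mult intro!: mult_right_mono G)
    finally show ?thesis by (simp add: c_def sum_distrib_left mult.commute)
  qed
  have "((\<lambda>t. - (G (z - t *\<^sub>R h) \<bullet> h)) has_integral (F (z - 1 *\<^sub>R h) - F (z - 0 *\<^sub>R h))) {0..1}"
  proof (rule fundamental_theorem_of_calculus)
    fix t :: real
    have "((\<lambda>t. z - t *\<^sub>R h) has_derivative (\<lambda>s. - (s *\<^sub>R h))) (at t)"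
      by (auto intro!: derivative_eq_intros)
    from has_derivative_compose[OF this F']
    have "((\<lambda>t. F (z - t *\<^sub>R h)) has_vector_derivative - (G (z - t *\<^sub>R h) \<bullet> h)) (at t)"
      by (simp add: has_vector_derivative_def inner_minus_right)
    then show "((\<lambda>t. F (z - t *\<^sub>R h)) has_vector_derivative - (G (z - t *\<^sub>R h) \<bullet> h)) (at t within {0..1})"
      by (rule has_vector_derivative_at_within)
  qed simp
  then have ftc: "((\<lambda>t. - (G (z - t *\<^sub>R h) \<bullet> h)) has_integral (F (z - h) - F z)) {0..1}" by simp
  let ?I = "\<integral>\<^sup>+y. ennreal (k (z - y)) \<partial>segment_measure M c h"
  have mm[measurable]: "m \<in> borel_measurable borel"
    unfolding m_def by measurable
  have "?I = (\<integral>\<^sup>+y. (\<integral>\<^sup>+t. ennreal c * indicator {0..1} t * ennreal (k (z - (y + t *\<^sub>R h))) \<partial>lborel) \<partial>M)"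
    by (rule nn_integral_segment_measure[OF M]) measurable
  also have "\<dots> = (\<integral>\<^sup>+t. (\<integral>\<^sup>+y. ennreal c * indicator {0..1} t * ennreal (k (z - (y + t *\<^sub>R h))) \<partial>M) \<partial>lborel)"
    by (rule pair_sigma_finite.Fubini'[OF lborel_pair_radon[OF M]]) measurable
  also have "\<dots> = (\<integral>\<^sup>+t. ennreal (indicator {0..1} t * (c * m (z - t *\<^sub>R h))) \<partial>lborel)"
  proof (intro nn_integral_cong)
    fix t :: real
    have "(\<integral>\<^sup>+y. ennreal c * indicator {0..1} t * ennreal (k (z - (y + t *\<^sub>R h))) \<partial>M)
        = ennreal c * indicator {0..1} t * (\<integral>\<^sup>+y. ennreal (k (z - t *\<^sub>R h - y)) \<partial>M)"
      by (subst nn_integral_cmult[symmetric]) (auto simp: algebra_simps)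
    then show "(\<integral>\<^sup>+y. ennreal c * indicator {0..1} t * ennreal (k (z - (y + t *\<^sub>R h))) \<partial>M)
        = ennreal (indicator {0..1} t * (c * m (z - t *\<^sub>R h)))"
      unfolding me using c m0 by (auto simp: indicator_def ennreal_mult)
  qed
  finally have I: "?I = (\<integral>\<^sup>+t. ennreal (indicator {0..1} t * (c * m (z - t *\<^sub>R h))) \<partial>lborel)" .
  have "?I < \<infinity>"
  proof -
    have "integrable (segment_measure M c h) (\<lambda>y. k (z - y))"
      by (rule radon_integrable[OF radon_segment_measure[OF M] _ B kz]) measurable
    then show ?thesis using k0 by (simp add: integrable_iff_bounded)
  qed
  then have J: "integrable lborel (\<lambda>t. indicator {0..1} t * (c * m (z - t *\<^sub>R h)))"
    unfolding I using c m0 by (intro integrableI_nonneg) auto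
  then have S: "set_integrable lborel {0..1} (\<lambda>t. c * m (z - t *\<^sub>R h))"
    by (simp add: set_integrable_def)
  have "\<bar>F (z - h) - F z\<bar> = norm (integral {0..1} (\<lambda>t. - (G (z - t *\<^sub>R h) \<bullet> h)))"
    using integral_unique[OF ftc] by simp
  also have "\<dots> \<le> integral {0..1} (\<lambda>t. c * m (z - t *\<^sub>R h))"
    using ftc set_borel_integral_eq_integral(1)[OF S] Gh
    by (intro integral_norm_bound_integral) (auto simp: has_integral_integrable)
  also have "\<dots> = (\<integral>t. indicator {0..1} t * (c * m (z - t *\<^sub>R h)) \<partial>lborel)"
    using set_borel_integral_eq_integral(2)[OF S, symmetric]
    by (simp only: set_lebesgue_integral_def real_scaleR_def)
  finally have "ennreal \<bar>F (z - h) - F z\<bar> \<le> ennreal \<dots>" by (rule ennreal_leI)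
  also have "\<dots> = ?I"
    unfolding I using J c m0 by (intro nn_integral_eq_integral[symmetric]) auto
  finally have *: "ennreal \<bar>F (z - h) - F z\<bar> \<le> ?I" .
  have Fe: "F w = (\<integral>y. v y * k (w - y) \<partial>lborel)" for w
    unfolding F_def conv_def by (rule integral_completion) measurable
  have Fh: "F (z - h) = (\<integral>y. v (y - h) * k (z - y) \<partial>lborel)"
  proof -
    have "(\<lambda>y. v (y - h) * k (z - y)) \<in> borel_measurable borel" by measurable
    from lborel_integral_translate[OF this, of h] show ?thesis by (simp add: Fe diff_diff_eq)
  qed
  have "(\<integral>y. (v y - v (y - h)) * k (z - y) \<partial>lborel) = F z - F (z - h)"
    unfolding Fe[of z] Fh left_diff_distrib
  proof (rule Bochner_Integration.integral_diff)
    have km': "(\<lambda>y. k (z - y)) \<in> borel_measurable borel" by measurable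
    have vhm: "(\<lambda>y. v (y - h)) \<in> borel_measurable borel" by measurable
    show "integrable lborel (\<lambda>y. v y * k (z - y))"
      by (rule integrable_lborel_mult[OF v vm km' B kz])
    show "integrable lborel (\<lambda>y. v (y - h) * k (z - y))"
      by (rule integrable_lborel_mult[OF vh vhm km' B kz])
  qed
  then show "ennreal \<bar>\<integral>y. (v y - v (y - h)) * rescale \<delta> \<theta> (z - y) \<partial>lborel\<bar>
      \<le> (\<integral>\<^sup>+y. ennreal (rescale \<delta> \<theta> (z - y)) \<partial>segment_measure M (\<Sum>j\<in>UNIV. \<bar>h $ j\<bar>) h)"
    using * by (simp add: k_def c_def abs_minus_commute)
qed measurable

subsection \<open>The averaging kernel\<close>

lemma AE_le_of_set_nn_integral_le:
  fixes f g :: "'a::euclidean_space \<Rightarrow> ennreal"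
  assumes [measurable]: "f \<in> borel_measurable borel" "g \<in> borel_measurable borel"
    and le: "\<And>A. A \<in> sets borel \<Longrightarrow>
      (\<integral>\<^sup>+x. f x * indicator A x \<partial>lborel) \<le> (\<integral>\<^sup>+x. g x * indicator A x \<partial>lborel)"
  shows "AE x in lborel. f x \<le> g x"
proof -
  define A where "A n = {x. norm x \<le> real n \<and> g x \<le> of_nat n \<and> g x < f x}" for n :: nat
  have [measurable]: "A n \<in> sets borel" for n unfolding A_def by measurable
  have "AE x in lborel. x \<notin> A n" for n
  proof -
    let ?g = "\<lambda>x. g x * indicator (A n) x" and ?f = "\<lambda>x. f x * indicator (A n) x"
    have "(\<integral>\<^sup>+x. ?g x \<partial>lborel) \<le> (\<integral>\<^sup>+x. of_nat n * indicator (cball 0 (real n)) (x::'a) \<partial>lborel)"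
      by (intro nn_integral_mono) (auto simp: A_def indicator_def)
    also have "\<dots> = of_nat n * emeasure lborel (cball (0::'a) (real n))"
      by (intro nn_integral_cmult_indicator) simp
    also have "\<dots> < \<infinity>"
      using emeasure_bounded_finite[OF bounded_cball, of "0::'a" "real n"] by (simp add: ennreal_mult_less_top of_nat_less_top)
    finally have fin: "(\<integral>\<^sup>+x. ?g x \<partial>lborel) < \<infinity>" .
    have "(\<integral>\<^sup>+x. ?f x - ?g x \<partial>lborel) = (\<integral>\<^sup>+x. ?f x \<partial>lborel) - (\<integral>\<^sup>+x. ?g x \<partial>lborel)"
      using fin by (intro nn_integral_diff) (auto simp: A_def indicator_def)
    also have "\<dots> = 0"
    proof -
      have "(\<integral>\<^sup>+x. ?f x \<partial>lborel) \<le> (\<integral>\<^sup>+x. ?g x \<partial>lborel)" by (rule le) measurable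
      then show ?thesis using fin by (simp add: diff_eq_0_iff_ennreal le_less_trans)
    qed
    finally have "AE x in lborel. ?f x - ?g x = 0"
      by (subst (asm) nn_integral_0_iff_AE) measurable
    then show ?thesis
    proof (rule eventually_mono)
      fix x assume "?f x - ?g x = 0"
      then show "x \<notin> A n" using diff_gr0_ennreal[of "g x" "f x"] by (auto simp: A_def)
    qed
  qed
  then have "AE x in lborel. \<forall>n. x \<notin> A n" by (simp add: AE_all_countable)
  then show ?thesis
  proof (rule eventually_mono)
    fix x assume x: "\<forall>n. x \<notin> A n"
    show "f x \<le> g x"
    proof (rule ccontr)
      assume "\<not> f x \<le> g x"
      then have gf: "g x < f x" by simp
      then have "g x < top" using top.not_eq_extremum by fastforce
      then obtain m where m: "g x < of_nat m" using ennreal_Ex_less_of_nat by blast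
      obtain k where k: "norm x \<le> real k" using real_arch_simple by blast
      have "of_nat m \<le> (of_nat (max m k) :: ennreal)" by simp
      then have "x \<in> A (max m k)" using gf m k by (auto simp: A_def intro: less_imp_le[OF less_le_trans])
      then show False using x by blast
    qed
  qed
qed

definition cone_fun :: "real^'n \<Rightarrow> real" where
  "cone_fun x = norm x * indicator (cball 0 1) x"

lemma cone_measurable [measurable]: "cone_fun \<in> borel_measurable borel"
proof -
  have [measurable]: "cball (0::real^'n) 1 \<in> sets borel" by simp
  show ?thesis unfolding cone_fun_def by measurable
qed

lemma cone_bounds: "0 \<le> cone_fun x" "cone_fun x \<le> 1" "cone_fun (- x) = cone_fun x" "cone_fun 0 = 0" "norm x > 1 \<Longrightarrow> cone_fun x = 0"
  by (auto simp: cone_fun_def indicator_def)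

text \<open>The average \<open>\<integral>\<^sub>0\<^sup>1 t\<^sup>-\<^sup>d cone_fun (x / t) dt\<close> of rescaled cones is what remains of
  \<open>|h|\<close> and the translations by \<open>t h\<close> after the substitution \<open>x = t h\<close>. It is of order
  \<open>|x|\<^sup>1\<^sup>-\<^sup>d\<close> at the origin.\<close>

definition cone_average :: "real^'n \<Rightarrow> ennreal" where
  "cone_average x = (\<integral>\<^sup>+t. indicator {0<..1} t * ennreal (cone_fun (x /\<^sub>R t) / t ^ CARD('n)) \<partial>lborel)"

lemma cone_average_measurable [measurable]: "cone_average \<in> borel_measurable borel"
  unfolding cone_average_def by measurable

lemma cone_average_even: "cone_average (- x) = cone_average x"
  by (simp add: cone_average_def cone_bounds)

lemma cone_average_eq_0:
  fixes x :: "real^'n"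
  assumes "norm x > 1"
  shows "cone_average x = 0"
proof -
  have "indicator {0<..1} t * ennreal (cone_fun (x /\<^sub>R t) / t ^ CARD('n)) = 0" for t :: real
  proof (cases "t \<in> {0<..1}")
    case True
    then have "norm (x /\<^sub>R t) > 1" using assms by (simp add: field_simps)
    then have "cone_fun (x /\<^sub>R t) = 0" by (rule cone_bounds(5))
    then show ?thesis by simp
  qed simp
  then have "cone_average x = integral\<^sup>N lborel (\<lambda>t::real. 0)"
    unfolding cone_average_def by (intro nn_integral_cong)
  then show ?thesis by simp
qed

lemma cone_average_finite:
  fixes x :: "real^'n"
  shows "cone_average x < \<infinity>"
proof (cases "x = 0")
  case True
  then show ?thesis by (simp add: cone_average_def cone_bounds)
next
  case False
  have "cone_average x \<le> (\<integral>\<^sup>+t. ennreal (1 / norm x ^ CARD('n)) * indicator {0..1::real} t \<partial>lborel)"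
    unfolding cone_average_def
  proof (intro nn_integral_mono)
    fix t :: real
    show "indicator {0<..1} t * ennreal (cone_fun (x /\<^sub>R t) / t ^ CARD('n)) \<le> ennreal (1 / norm x ^ CARD('n)) * indicator {0..1::real} t"
    proof (cases "t \<in> {0<..1} \<and> norm (x /\<^sub>R t) \<le> 1")
      case True
      then have t: "0 < t" "t \<le> 1" "norm x \<le> t" by (auto simp: field_simps)
      have "cone_fun (x /\<^sub>R t) / t ^ CARD('n) \<le> 1 / norm x ^ CARD('n)"
        using t False cone_bounds by (intro frac_le power_mono) auto
      then show ?thesis using t by (auto intro: ennreal_leI)
    next
      case False
      show ?thesis
      proof (cases "t \<in> {0<..1}")
        case True
        then have "norm (x /\<^sub>R t) > 1" using False by (simp only: not_le de_Morgan_conj simp_thms)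
        then have "cone_fun (x /\<^sub>R t) = 0" by (rule cone_bounds(5))
        then show ?thesis by simp
      qed simp
    qed
  qed
  also have "\<dots> = ennreal (1 / norm x ^ CARD('n))"
    by (subst nn_integral_cmult_indicator) auto
  also have "\<dots> < \<infinity>" by simp
  finally show ?thesis .
qed

lemma cone_average_integral_finite:
  "(\<integral>\<^sup>+x. cone_average x \<partial>(lborel :: (real^'n) measure)) < \<infinity>"
proof -
  have "(\<integral>\<^sup>+x. cone_average x \<partial>(lborel :: (real^'n) measure))
      = (\<integral>\<^sup>+t. (\<integral>\<^sup>+x. indicator {0<..1} t * ennreal (cone_fun (x /\<^sub>R t) / t ^ CARD('n)) \<partial>(lborel :: (real^'n) measure)) \<partial>lborel)"
    unfolding cone_average_def by (rule lborel_pair.Fubini') measurable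
  also have "\<dots> \<le> (\<integral>\<^sup>+t. (\<integral>\<^sup>+x. ennreal (cone_fun x) \<partial>(lborel :: (real^'n) measure)) * indicator {0..1::real} t \<partial>lborel)"
  proof (intro nn_integral_mono)
    fix t :: real
    show "(\<integral>\<^sup>+x. indicator {0<..1} t * ennreal (cone_fun (x /\<^sub>R t) / t ^ CARD('n)) \<partial>(lborel :: (real^'n) measure))
      \<le> (\<integral>\<^sup>+x. ennreal (cone_fun x) \<partial>(lborel :: (real^'n) measure)) * indicator {0..1::real} t"
    proof (cases "t \<in> {0<..1}")
      case True
      have "(\<integral>\<^sup>+x. ennreal (cone_fun (x /\<^sub>R t) / t ^ CARD('n)) \<partial>(lborel :: (real^'n) measure))
          = ennreal (t ^ CARD('n)) * (\<integral>\<^sup>+x. ennreal (cone_fun x / t ^ CARD('n)) \<partial>(lborel :: (real^'n) measure))"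
        using True nn_integral_lborel_affine[of "\<lambda>x::real^'n. ennreal (cone_fun (x /\<^sub>R t) / t ^ CARD('n))" t 0] by simp
      also have "\<dots> = (\<integral>\<^sup>+x. ennreal (t ^ CARD('n)) * ennreal (cone_fun x / t ^ CARD('n)) \<partial>(lborel :: (real^'n) measure))"
        by (rule nn_integral_cmult[symmetric]) measurable
      also have "\<dots> = (\<integral>\<^sup>+x. ennreal (cone_fun x) \<partial>(lborel :: (real^'n) measure))"
        using True cone_bounds by (intro nn_integral_cong) (simp add: ennreal_mult'[symmetric])
      finally show ?thesis using True by simp
    qed simp
  qed
  also have "\<dots> = (\<integral>\<^sup>+x. ennreal (cone_fun x) \<partial>(lborel :: (real^'n) measure))"
    by (subst nn_integral_cmult_indicator) auto
  also have "\<dots> \<le> (\<integral>\<^sup>+x. indicator (cball 0 1) x \<partial>(lborel :: (real^'n) measure))"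
    by (intro nn_integral_mono) (auto simp: cone_fun_def indicator_def)
  also have "\<dots> < \<infinity>"
    using emeasure_bounded_finite[OF bounded_cball, of "0::real^'n" 1] by simp
  finally show ?thesis .
qed

lemma segment_substitution:
  fixes y :: "real^'n"
  assumes t: "t \<in> {0<..1}" and \<epsilon>: "\<epsilon> > 0" and [measurable]: "A \<in> sets borel"
  shows "(\<integral>\<^sup>+h. ennreal (norm h) * indicator (cball 0 \<epsilon>) h * indicator A (y + t *\<^sub>R h) \<partial>lborel)
    = (\<integral>\<^sup>+x. ennreal \<epsilon> * (ennreal (cone_fun (((x - y) /\<^sub>R \<epsilon>) /\<^sub>R t) / t ^ CARD('n)) * indicator A x) \<partial>lborel)"
proof -
  let ?g = "\<lambda>x. ennreal \<epsilon> * (ennreal (cone_fun (((x - y) /\<^sub>R \<epsilon>) /\<^sub>R t) / t ^ CARD('n)) * indicator A x)"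
  have t0: "t > 0" using t by simp
  have gm: "?g \<in> borel_measurable borel" by measurable
  have "(\<integral>\<^sup>+x. ?g x \<partial>lborel) = ennreal (t ^ CARD('n)) * (\<integral>\<^sup>+h. ?g (y + t *\<^sub>R h) \<partial>lborel)"
    using nn_integral_lborel_affine[OF gm, of t y] t0 by simp
  also have "\<dots> = (\<integral>\<^sup>+h. ennreal (t ^ CARD('n)) * ?g (y + t *\<^sub>R h) \<partial>lborel)"
    by (rule nn_integral_cmult[symmetric]) measurable
  also have "\<dots> = (\<integral>\<^sup>+h. ennreal (norm h) * indicator (cball 0 \<epsilon>) h * indicator A (y + t *\<^sub>R h) \<partial>lborel)"
  proof (intro nn_integral_cong)
    fix h :: "real^'n"
    have e: "((y + t *\<^sub>R h - y) /\<^sub>R \<epsilon>) /\<^sub>R t = h /\<^sub>R \<epsilon>" using t0 by simp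
    have "\<epsilon> * cone_fun (h /\<^sub>R \<epsilon>) = norm h * indicator (cball 0 \<epsilon>) h"
      using \<epsilon> by (auto simp: cone_fun_def indicator_def field_simps)
    then have "t ^ CARD('n) * (\<epsilon> * (cone_fun (h /\<^sub>R \<epsilon>) / t ^ CARD('n))) = norm h * indicator (cball 0 \<epsilon>) h"
      using t0 by (simp add: field_simps)
    then have eq: "ennreal (t ^ CARD('n)) * (ennreal \<epsilon> * ennreal (cone_fun (h /\<^sub>R \<epsilon>) / t ^ CARD('n))) = ennreal (norm h) * indicator (cball 0 \<epsilon>) h"
      using t0 \<epsilon> cone_bounds(1)[of "h /\<^sub>R \<epsilon>"] by (auto simp: ennreal_mult'[symmetric] indicator_def)
    have "ennreal (t ^ CARD('n)) * ?g (y + t *\<^sub>R h)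
        = (ennreal (t ^ CARD('n)) * (ennreal \<epsilon> * ennreal (cone_fun (h /\<^sub>R \<epsilon>) / t ^ CARD('n)))) * indicator A (y + t *\<^sub>R h)"
      by (simp only: e mult.assoc)
    then show "ennreal (t ^ CARD('n)) * ?g (y + t *\<^sub>R h)
        = ennreal (norm h) * indicator (cball 0 \<epsilon>) h * indicator A (y + t *\<^sub>R h)"
      by (simp only: eq)
  qed
  finally show ?thesis by simp
qed

lemma nn_integral_segment_measure_le:
  fixes M :: "(real^'n) measure"
  assumes M: "radon_measure M" and \<epsilon>: "\<epsilon> > 0" and A[measurable]: "A \<in> sets borel"
  shows "(\<integral>\<^sup>+h. indicator (cball 0 \<epsilon>) h * emeasure (segment_measure M (\<Sum>j\<in>UNIV. \<bar>h $ j\<bar>) h) A \<partial>lborel)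
    \<le> (\<integral>\<^sup>+x. ennreal (real CARD('n) * \<epsilon>) * (\<integral>\<^sup>+y. cone_average ((x - y) /\<^sub>R \<epsilon>) \<partial>M) * indicator A x \<partial>lborel)"
proof -
  let ?d = "real CARD('n)"
  note [measurable_cong] = radon_measure_sets[OF M]
  interpret M: sigma_finite_measure M by (rule radon_sigma_finite[OF M])
  interpret LM: pair_sigma_finite lborel M by (rule lborel_pair_radon[OF M])
  have [measurable]: "cball (0::real^'n) \<epsilon> \<in> sets borel" by simp
  define \<Phi> where "\<Phi> h y t = ennreal (norm h) * indicator (cball 0 \<epsilon>) h * indicator A (y + t *\<^sub>R h)"
    for h y :: "real^'n" and t :: real
  have [measurable (raw)]: "(\<lambda>p. \<Phi> (f p) (g p) (k p)) \<in> borel_measurable N"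
    if [measurable]: "f \<in> borel_measurable N" "g \<in> borel_measurable N" "k \<in> borel_measurable N"
    for f g and k :: "'b \<Rightarrow> real" and N
    unfolding \<Phi>_def by measurable
  have "(\<integral>\<^sup>+h. indicator (cball 0 \<epsilon>) h * emeasure (segment_measure M (\<Sum>j\<in>UNIV. \<bar>h $ j\<bar>) h) A \<partial>lborel)
    \<le> (\<integral>\<^sup>+h. (\<integral>\<^sup>+y. (\<integral>\<^sup>+t. ennreal ?d * (indicator {0<..1} t * \<Phi> h y t) \<partial>lborel) \<partial>M) \<partial>lborel)"
  proof (intro nn_integral_mono)
    fix h :: "real^'n"
    let ?c = "\<Sum>j\<in>UNIV. \<bar>h $ j\<bar>"
    have "?c \<le> (\<Sum>j\<in>(UNIV :: 'n set). norm h)" by (intro sum_mono component_le_norm_cart)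
    then have c: "ennreal ?c \<le> ennreal ?d * ennreal (norm h)" by (simp add: ennreal_mult'[symmetric] ennreal_leI)
    have "emeasure (segment_measure M ?c h) A = (\<integral>\<^sup>+x. indicator A x \<partial>segment_measure M ?c h)"
      by (simp add: segment_measure_def)
    also have "\<dots> = (\<integral>\<^sup>+y. (\<integral>\<^sup>+t. ennreal ?c * indicator {0..1} t * indicator A (y + t *\<^sub>R h) \<partial>lborel) \<partial>M)"
      by (rule nn_integral_segment_measure[OF M]) measurable
    also have "\<dots> = (\<integral>\<^sup>+y. (\<integral>\<^sup>+t. ennreal ?c * indicator {0<..1} t * indicator A (y + t *\<^sub>R h) \<partial>lborel) \<partial>M)"
    proof (rule nn_integral_cong, rule nn_integral_cong_AE)
      fix y
      have "AE t in lborel. t \<noteq> (0::real)" by (rule AE_lborel_singleton)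
      then show "AE t in lborel. ennreal ?c * indicator {0..1} t * indicator A (y + t *\<^sub>R h) = ennreal ?c * indicator {0<..1} t * indicator A (y + t *\<^sub>R h)"
        by (rule eventually_mono) (auto simp: indicator_def)
    qed
    finally have e: "emeasure (segment_measure M ?c h) A = \<dots>" .
    show "indicator (cball 0 \<epsilon>) h * emeasure (segment_measure M ?c h) A
      \<le> (\<integral>\<^sup>+y. (\<integral>\<^sup>+t. ennreal ?d * (indicator {0<..1} t * \<Phi> h y t) \<partial>lborel) \<partial>M)"
    proof (cases "h \<in> cball 0 \<epsilon>")
      case True
      have "ennreal ?c * indicator {0<..1} t * indicator A (y + t *\<^sub>R h) \<le> ennreal ?d * (indicator {0<..1} t * \<Phi> h y t)" for y t
        using c True by (auto simp: \<Phi>_def indicator_def)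
      then have "(\<integral>\<^sup>+y. (\<integral>\<^sup>+t. ennreal ?c * indicator {0<..1} t * indicator A (y + t *\<^sub>R h) \<partial>lborel) \<partial>M)
        \<le> (\<integral>\<^sup>+y. (\<integral>\<^sup>+t. ennreal ?d * (indicator {0<..1} t * \<Phi> h y t) \<partial>lborel) \<partial>M)"
        by (intro nn_integral_mono)
      then show ?thesis using True by (simp add: e)
    qed simp
  qed
  also have "\<dots> = (\<integral>\<^sup>+y. (\<integral>\<^sup>+h. (\<integral>\<^sup>+t. ennreal ?d * (indicator {0<..1} t * \<Phi> h y t) \<partial>lborel) \<partial>lborel) \<partial>M)"
    by (rule LM.Fubini'[symmetric]) measurable
  also have "\<dots> = (\<integral>\<^sup>+y. (\<integral>\<^sup>+t. (\<integral>\<^sup>+h. ennreal ?d * (indicator {0<..1} t * \<Phi> h y t) \<partial>lborel) \<partial>lborel) \<partial>M)"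
    by (rule nn_integral_cong, rule lborel_pair.Fubini') measurable
  also have "\<dots> = (\<integral>\<^sup>+y. (\<integral>\<^sup>+t. (\<integral>\<^sup>+x. ennreal (?d * \<epsilon>) * (indicator {0<..1} t
      * ennreal (cone_fun (((x - y) /\<^sub>R \<epsilon>) /\<^sub>R t) / t ^ CARD('n)) * indicator A x) \<partial>lborel) \<partial>lborel) \<partial>M)"
  proof (rule nn_integral_cong, rule nn_integral_cong)
    fix y and t :: real
    show "(\<integral>\<^sup>+h. ennreal ?d * (indicator {0<..1} t * \<Phi> h y t) \<partial>lborel)
      = (\<integral>\<^sup>+x. ennreal (?d * \<epsilon>) * (indicator {0<..1} t
      * ennreal (cone_fun (((x - y) /\<^sub>R \<epsilon>) /\<^sub>R t) / t ^ CARD('n)) * indicator A x) \<partial>lborel)"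
    proof (cases "t \<in> {0<..1}")
      case True
      have "(\<integral>\<^sup>+h. ennreal ?d * (indicator {0<..1} t * \<Phi> h y t) \<partial>lborel) = ennreal ?d * (\<integral>\<^sup>+h. \<Phi> h y t \<partial>lborel)"
        using True by (simp, intro nn_integral_cmult, measurable)
      also have "(\<integral>\<^sup>+h. \<Phi> h y t \<partial>lborel)
          = (\<integral>\<^sup>+x. ennreal \<epsilon> * (ennreal (cone_fun (((x - y) /\<^sub>R \<epsilon>) /\<^sub>R t) / t ^ CARD('n)) * indicator A x) \<partial>lborel)"
        unfolding \<Phi>_def by (rule segment_substitution[OF True \<epsilon> A])
      also have "ennreal ?d * \<dots>
          = (\<integral>\<^sup>+x. ennreal ?d * (ennreal \<epsilon> * (ennreal (cone_fun (((x - y) /\<^sub>R \<epsilon>) /\<^sub>R t) / t ^ CARD('n)) * indicator A x)) \<partial>lborel)"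
        by (rule nn_integral_cmult[symmetric]) measurable
      finally show ?thesis using True \<epsilon> by (simp add: ennreal_mult' mult.assoc)
    qed simp
  qed
  also have "\<dots> = (\<integral>\<^sup>+y. (\<integral>\<^sup>+x. (\<integral>\<^sup>+t. ennreal (?d * \<epsilon>) * (indicator {0<..1} t
      * ennreal (cone_fun (((x - y) /\<^sub>R \<epsilon>) /\<^sub>R t) / t ^ CARD('n)) * indicator A x) \<partial>lborel) \<partial>lborel) \<partial>M)"
    by (rule nn_integral_cong, rule lborel_pair.Fubini') measurable
  also have "\<dots> = (\<integral>\<^sup>+y. (\<integral>\<^sup>+x. ennreal (?d * \<epsilon>) * (cone_average ((x - y) /\<^sub>R \<epsilon>) * indicator A x) \<partial>lborel) \<partial>M)"
  proof (intro nn_integral_cong)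
    fix x y :: "real^'n"
    have "(\<integral>\<^sup>+t. ennreal (?d * \<epsilon>) * (indicator {0<..1} t
      * ennreal (cone_fun (((x - y) /\<^sub>R \<epsilon>) /\<^sub>R t) / t ^ CARD('n)) * indicator A x) \<partial>lborel)
      = ennreal (?d * \<epsilon>) * (\<integral>\<^sup>+t. indicator {0<..1} t
      * ennreal (cone_fun (((x - y) /\<^sub>R \<epsilon>) /\<^sub>R t) / t ^ CARD('n)) * indicator A x \<partial>lborel)"
      by (rule nn_integral_cmult) measurable
    also have "(\<integral>\<^sup>+t. indicator {0<..1} t
      * ennreal (cone_fun (((x - y) /\<^sub>R \<epsilon>) /\<^sub>R t) / t ^ CARD('n)) * indicator A x \<partial>lborel) = cone_average ((x - y) /\<^sub>R \<epsilon>) * indicator A x"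
      unfolding cone_average_def by (rule nn_integral_multc) measurable
    finally show "(\<integral>\<^sup>+t. ennreal (?d * \<epsilon>) * (indicator {0<..1} t
      * ennreal (cone_fun (((x - y) /\<^sub>R \<epsilon>) /\<^sub>R t) / t ^ CARD('n)) * indicator A x) \<partial>lborel)
      = ennreal (?d * \<epsilon>) * (cone_average ((x - y) /\<^sub>R \<epsilon>) * indicator A x)" .
  qed
  also have "\<dots> = (\<integral>\<^sup>+x. (\<integral>\<^sup>+y. ennreal (?d * \<epsilon>) * (cone_average ((x - y) /\<^sub>R \<epsilon>) * indicator A x) \<partial>M) \<partial>lborel)"
    by (rule LM.Fubini') measurable
  also have "\<dots> = (\<integral>\<^sup>+x. ennreal (?d * \<epsilon>) * (\<integral>\<^sup>+y. cone_average ((x - y) /\<^sub>R \<epsilon>) \<partial>M) * indicator A x \<partial>lborel)"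
    by (intro nn_integral_cong) (simp add: nn_integral_cmult nn_integral_multc mult.assoc)
  finally show ?thesis .
qed

lemma Linfty_mult_integrable:
  fixes u h :: "real^'n \<Rightarrow> real"
  assumes u: "Linfty u" and h: "integrable lebesgue h"
  shows "integrable lebesgue (\<lambda>y. u y * h y)"
proof -
  have m: "u \<in> borel_measurable lebesgue" and "Linf_norm_on UNIV u < \<infinity>"
    using u by (auto simp: Linfty_def)
  then obtain L where L: "Linf_norm_on UNIV u = ennreal L" "L \<ge> 0"
    by (cases "Linf_norm_on UNIV u") auto
  have AE: "AE x in lebesgue. \<bar>u x\<bar> \<le> L"
    using Linf_norm_on_AE[of UNIV u] L by auto
  show ?thesis
  proof (rule Bochner_Integration.integrable_bound)
    show "integrable lebesgue (\<lambda>y. L * h y)" using h by simp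
    show "(\<lambda>y. u y * h y) \<in> borel_measurable lebesgue"
      using m borel_measurable_integrable[OF h] by simp
    show "AE y in lebesgue. norm (u y * h y) \<le> norm (L * h y)"
      using AE by (rule eventually_mono) (use L in \<open>auto simp: abs_mult intro: mult_right_mono\<close>)
  qed
qed

lemma locally_integrable_cong_AE:
  fixes f g :: "real^'n \<Rightarrow> real"
  assumes f: "locally_integrable f" and g: "g \<in> borel_measurable borel" and e: "AE x in lebesgue. f x = g x"
  shows "locally_integrable g"
  unfolding locally_integrable_def set_integrable_def
proof (intro allI impI)
  fix K :: "(real^'n) set" assume K: "compact K"
  then have "integrable lebesgue (\<lambda>x. indicator K x *\<^sub>R f x)"
    using f by (simp add: locally_integrable_def set_integrable_def)
  then show "integrable lebesgue (\<lambda>x. indicator K x *\<^sub>R g x)"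
  proof (rule integrable_cong_AE_imp)
    have "K \<in> sets lebesgue" using K by (simp add: borel_compact)
    moreover have "g \<in> borel_measurable lebesgue" using g by (simp add: measurable_completion)
    ultimately show "(\<lambda>x. indicator K x *\<^sub>R g x) \<in> borel_measurable lebesgue" by simp
    show "AE x in lebesgue. indicator K x *\<^sub>R f x = indicator K x *\<^sub>R g x"
      using e by (rule eventually_mono) simp
  qed
qed

lemma locally_integrable_borel_representative:
  fixes f :: "real^'n \<Rightarrow> real"
  assumes "locally_integrable f"
  obtains g where "g \<in> borel_measurable borel" "locally_integrable g" "AE x in lebesgue. f x = g x"
proof -
  obtain g where g: "g \<in> borel_measurable lborel" "AE x in lborel. f x = g x"
    using completion_ex_borel_measurable_real[OF locally_integrable_measurable[OF assms]] by blast
  then have "AE x in lebesgue. f x = g x" by (intro AE_completion)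
  with g show thesis using that[of g] locally_integrable_cong_AE[OF assms, of g] by simp
qed

lemma test_function_bounds:
  fixes \<psi> :: "real^'n \<Rightarrow> real"
  assumes "test_function \<psi>"
  obtains B r where "\<psi> \<in> borel_measurable borel" "\<And>i. (\<lambda>x. grad \<psi> x $ i) \<in> borel_measurable borel"
    "\<And>x. \<bar>\<psi> x\<bar> \<le> B" "\<And>x i. \<bar>grad \<psi> x $ i\<bar> \<le> B"
    "\<And>x. x \<notin> cball 0 r \<Longrightarrow> \<psi> x = 0" "\<And>x. x \<notin> cball 0 r \<Longrightarrow> grad \<psi> x = 0"
proof -
  have sm: "smooth \<psi>" and "compact (supp \<psi>)" using assms by (auto simp: test_function_def)
  then obtain r where r: "supp \<psi> \<subseteq> cball 0 r"
    using compact_imp_bounded by (metis bounded_iff mem_cball_0 subsetI)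
  have z: "\<psi> x = 0" "grad \<psi> x = 0" if "x \<notin> cball 0 r" for x
  proof -
    have "x \<notin> supp \<psi>" using that r by blast
    then show "\<psi> x = 0" "grad \<psi> x = 0" using supp_I[of \<psi> x] grad_eq_0[of x \<psi>] by auto
  qed
  obtain B0 where B0: "\<And>x. norm (\<psi> x) \<le> B0"
    using continuous_zero_outside_bounded[OF smooth_continuous[OF sm] z(1)] by metis
  obtain B1 where B1: "\<And>x. norm (grad \<psi> x) \<le> B1"
    using continuous_zero_outside_bounded[OF continuous_grad[OF sm] z(2)] by metis
  show thesis
  proof (rule that[of "max B0 B1" r])
    show "(\<lambda>x. grad \<psi> x $ i) \<in> borel_measurable borel" for i
      by (intro borel_measurable_continuous_onI continuous_on_component continuous_grad[OF sm])
    show "\<bar>\<psi> x\<bar> \<le> max B0 B1" for x using B0[of x] by simp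
    show "\<bar>grad \<psi> x $ i\<bar> \<le> max B0 B1" for x i
      using order_trans[OF component_le_norm_cart[of "grad \<psi> x" i] B1[of x]] by simp
  qed (use z borel_measurable_smooth[OF sm] in auto)
qed

lemma difference_average_le:
  fixes v :: "real^'n \<Rightarrow> real" and \<theta> :: "real^'n \<Rightarrow> real" and P N :: "'n \<Rightarrow> (real^'n) measure"
  assumes \<theta>: "mollifier \<theta>" and v: "locally_integrable v" and vm[measurable]: "v \<in> borel_measurable borel"
    and P: "\<And>j. radon_measure (P j)" and N: "\<And>j. radon_measure (N j)" and M: "radon_measure M"
    and PN: "\<And>j A. A \<in> sets borel \<Longrightarrow> emeasure (P j) A \<le> emeasure (N j) A + emeasure M A"
    and NP: "\<And>j A. A \<in> sets borel \<Longrightarrow> emeasure (N j) A \<le> emeasure (P j) A + emeasure M A"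
    and deriv: "\<And>\<psi> j. test_function \<psi> \<Longrightarrow>
      (\<integral>x. v x * grad \<psi> x $ j \<partial>lebesgue) = - ((\<integral>x. \<psi> x \<partial>P j) - (\<integral>x. \<psi> x \<partial>N j))"
    and \<epsilon>: "\<epsilon> > 0"
  shows "AE x in lborel. (\<integral>\<^sup>+y. ennreal \<bar>v x - v y\<bar> * indicator (cball x \<epsilon>) y \<partial>lborel)
    \<le> ennreal (real CARD('n) * \<epsilon>) * (\<integral>\<^sup>+y. cone_average ((x - y) /\<^sub>R \<epsilon>) \<partial>M)"
proof -
  note [measurable_cong] = radon_measure_sets[OF M]
  interpret M: sigma_finite_measure M by (rule radon_sigma_finite[OF M])
  have [measurable]: "cball (0::real^'n) \<epsilon> \<in> sets borel" by simp
  define f where "f x = (\<integral>\<^sup>+h. ennreal \<bar>v x - v (x - h)\<bar> * indicator (cball 0 \<epsilon>) h \<partial>lborel)" for x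
  have f: "(\<integral>\<^sup>+y. ennreal \<bar>v x - v y\<bar> * indicator (cball x \<epsilon>) y \<partial>lborel) = f x" for x
  proof -
    have [measurable]: "cball x \<epsilon> \<in> sets borel" by simp
    have "(\<lambda>y. ennreal \<bar>v x - v y\<bar> * indicator (cball x \<epsilon>) y) \<in> borel_measurable borel" by measurable
    from nn_integral_lborel_affine[OF this, of "-1" x]
    have "(\<integral>\<^sup>+y. ennreal \<bar>v x - v y\<bar> * indicator (cball x \<epsilon>) y \<partial>lborel)
        = (\<integral>\<^sup>+h. ennreal \<bar>v x - v (x - h)\<bar> * indicator (cball x \<epsilon>) (x - h) \<partial>lborel)" by simp
    also have "\<dots> = f x"
      unfolding f_def by (intro nn_integral_cong) (auto simp: indicator_def dist_norm)
    finally show ?thesis .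
  qed
  have [measurable]: "f \<in> borel_measurable borel" unfolding f_def by measurable
  show ?thesis unfolding f
  proof (rule AE_le_of_set_nn_integral_le)
    fix A :: "(real^'n) set" assume A[measurable]: "A \<in> sets borel"
    have "(\<integral>\<^sup>+x. f x * indicator A x \<partial>lborel)
        = (\<integral>\<^sup>+x. (\<integral>\<^sup>+h. ennreal \<bar>v x - v (x - h)\<bar> * indicator (cball 0 \<epsilon>) h * indicator A x \<partial>lborel) \<partial>lborel)"
      unfolding f_def by (intro nn_integral_cong nn_integral_multc[symmetric]) measurable
    also have "\<dots> = (\<integral>\<^sup>+h. (\<integral>\<^sup>+x. ennreal \<bar>v x - v (x - h)\<bar> * indicator (cball 0 \<epsilon>) h * indicator A x \<partial>lborel) \<partial>lborel)"
      by (rule lborel_pair.Fubini') measurable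
    also have "\<dots> = (\<integral>\<^sup>+h. indicator (cball 0 \<epsilon>) h * (\<integral>\<^sup>+x. ennreal \<bar>v x - v (x - h)\<bar> * indicator A x \<partial>lborel) \<partial>lborel)"
    proof (rule nn_integral_cong)
      fix h
      have "(\<integral>\<^sup>+x. indicator (cball 0 \<epsilon>) h * (ennreal \<bar>v x - v (x - h)\<bar> * indicator A x) \<partial>lborel)
        = indicator (cball 0 \<epsilon>) h * (\<integral>\<^sup>+x. ennreal \<bar>v x - v (x - h)\<bar> * indicator A x \<partial>lborel)"
        by (rule nn_integral_cmult) measurable
      then show "(\<integral>\<^sup>+x. ennreal \<bar>v x - v (x - h)\<bar> * indicator (cball 0 \<epsilon>) h * indicator A x \<partial>lborel)
        = indicator (cball 0 \<epsilon>) h * (\<integral>\<^sup>+x. ennreal \<bar>v x - v (x - h)\<bar> * indicator A x \<partial>lborel)"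
        by (simp add: ac_simps)
    qed
    also have "\<dots> \<le> (\<integral>\<^sup>+h. indicator (cball 0 \<epsilon>) h * emeasure (segment_measure M (\<Sum>j\<in>UNIV. \<bar>h $ j\<bar>) h) A \<partial>lborel)"
      by (intro nn_integral_mono mult_left_mono
          translation_difference_le[OF \<theta> v vm P N M PN NP deriv A]) auto
    also have "\<dots> \<le> (\<integral>\<^sup>+x. ennreal (real CARD('n) * \<epsilon>) * (\<integral>\<^sup>+y. cone_average ((x - y) /\<^sub>R \<epsilon>) \<partial>M) * indicator A x \<partial>lborel)"
      by (rule nn_integral_segment_measure_le[OF M \<epsilon> A])
    finally show "(\<integral>\<^sup>+x. f x * indicator A x \<partial>lborel)
      \<le> (\<integral>\<^sup>+x. ennreal (real CARD('n) * \<epsilon>) * (\<integral>\<^sup>+y. cone_average ((x - y) /\<^sub>R \<epsilon>) \<partial>M) * indicator A x \<partial>lborel)" .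
  qed measurable
qed

lemma divergence_le:
  fixes g :: "real^'n \<Rightarrow> real" and \<theta> :: "real^'n \<Rightarrow> real" and P N :: "'n \<Rightarrow> (real^'n) measure"
  assumes \<theta>: "mollifier \<theta>" and g: "locally_integrable g" and gm[measurable]: "g \<in> borel_measurable borel"
    and P: "\<And>j. radon_measure (P j)" and N: "\<And>j. radon_measure (N j)" and M: "radon_measure M"
    and PN: "\<And>j A. A \<in> sets borel \<Longrightarrow> emeasure (P j) A \<le> emeasure (N j) A + emeasure M A"
    and NP: "\<And>j A. A \<in> sets borel \<Longrightarrow> emeasure (N j) A \<le> emeasure (P j) A + emeasure M A"
    and div: "\<And>\<psi>. test_function \<psi> \<Longrightarrow>
      (\<integral>x. \<psi> x * g x \<partial>lebesgue) = (\<Sum>j\<in>UNIV. (\<integral>x. \<psi> x \<partial>P j) - (\<integral>x. \<psi> x \<partial>N j))"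
    and A: "A \<in> sets borel"
  shows "(\<integral>\<^sup>+x. ennreal \<bar>g x\<bar> * indicator A x \<partial>lborel) \<le> ennreal (real CARD('n)) * emeasure M A"
proof -
  let ?\<nu> = "scale_measure (ennreal (real CARD('n))) M"
  have \<nu>: "radon_measure ?\<nu>"
    using M by (simp add: radon_measure_def ennreal_mult_less_top)
  have "(\<integral>\<^sup>+x. ennreal \<bar>g x\<bar> * indicator A x \<partial>lborel) \<le> emeasure ?\<nu> A"
  proof (rule abs_le_mollified[OF \<theta> g gm \<nu> _ A])
    fix z :: "real^'n" and \<delta> :: real assume \<delta>: "\<delta> > 0"
    let ?k = "\<lambda>y. rescale \<delta> \<theta> (z - y)"
    note [measurable] = mollifier_measurable[OF \<theta> \<delta>]
    have sm: "smooth \<theta>" and supp: "supp \<theta> \<subseteq> cball 0 1" using \<theta> by (auto simp: mollifier_def)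
    have k0: "0 \<le> ?k y" for y by (rule mollifier_nonneg[OF \<theta> \<delta>])
    obtain B where "\<And>x. \<bar>rescale \<delta> \<theta> x\<bar> \<le> B" using mollifier_bounded[OF \<theta> \<delta>] by auto
    then have B: "\<bar>?k y\<bar> \<le> B" for y by simp
    have kz: "?k y = 0" if "y \<notin> cball z \<delta>" for y
      using that by (intro mollifier_eq_0[OF \<theta> \<delta>]) (auto simp: dist_norm)
    have km: "?k \<in> borel_measurable borel" by measurable
    have i: "integrable M ?k" by (rule radon_integrable[OF M km B kz])
    have "\<bar>(\<integral>x. ?k x \<partial>P j) - (\<integral>x. ?k x \<partial>N j)\<bar> \<le> (\<integral>x. ?k x \<partial>M)" for j
    proof -
      have "(\<integral>x. ?k x \<partial>P j) - (\<integral>x. ?k x \<partial>N j) \<le> (\<integral>x. ?k x \<partial>M)"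
        by (rule integral_diff_le_add_measure[OF P N M _ km k0 B kz]) (rule PN)
      moreover have "(\<integral>x. ?k x \<partial>N j) - (\<integral>x. ?k x \<partial>P j) \<le> (\<integral>x. ?k x \<partial>M)"
        by (rule integral_diff_le_add_measure[OF N P M _ km k0 B kz]) (rule NP)
      ultimately show ?thesis by linarith
    qed
    then have "(\<Sum>j\<in>UNIV. \<bar>(\<integral>x. ?k x \<partial>P j) - (\<integral>x. ?k x \<partial>N j)\<bar>) \<le> (\<Sum>j\<in>(UNIV :: 'n set). \<integral>x. ?k x \<partial>M)"
      by (rule sum_mono)
    then have "\<bar>\<Sum>j\<in>UNIV. (\<integral>x. ?k x \<partial>P j) - (\<integral>x. ?k x \<partial>N j)\<bar> \<le> real CARD('n) * (\<integral>x. ?k x \<partial>M)"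
      by (intro order_trans[OF sum_abs]) simp
    moreover have "(\<integral>y. g y * ?k y \<partial>lborel) = (\<Sum>j\<in>UNIV. (\<integral>x. ?k x \<partial>P j) - (\<integral>x. ?k x \<partial>N j))"
      using div[OF test_function_rescale(2)[OF sm supp \<delta>], of z]
      by (subst (asm) integral_completion) (simp_all add: mult.commute)
    ultimately have "ennreal \<bar>\<integral>y. g y * ?k y \<partial>lborel\<bar> \<le> ennreal (real CARD('n) * (\<integral>x. ?k x \<partial>M))"
      by (intro ennreal_leI) simp
    also have "\<dots> = ennreal (real CARD('n)) * (\<integral>\<^sup>+y. ennreal (?k y) \<partial>M)"
      using i k0 by (subst nn_integral_eq_integral) (auto simp: ennreal_mult')
    also have "\<dots> = (\<integral>\<^sup>+y. ennreal (?k y) \<partial>?\<nu>)"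
      using km radon_measure_sets[OF M] by (subst nn_integral_scale_measure) (auto cong: measurable_cong_sets)
    finally show "ennreal \<bar>\<integral>y. g y * ?k y \<partial>lborel\<bar> \<le> (\<integral>\<^sup>+y. ennreal (?k y) \<partial>?\<nu>)" .
  qed
  then show ?thesis by simp
qed

lemma averaging_kernel:
  obtains \<rho> :: "real^'n \<Rightarrow> real" and Z :: real where
    "convolution_kernel \<rho>" "even_fun \<rho>" "supp \<rho> \<subseteq> cball 0 1" "Z > 0" "\<rho> \<in> borel_measurable borel"
    "\<And>x. ennreal (Z * \<rho> x) = indicator (cball 0 1) x + cone_average x"
proof -
  have [measurable]: "cball (0::real^'n) 1 \<in> sets borel" by simp
  define \<sigma> :: "real^'n \<Rightarrow> real" where "\<sigma> x = indicator (cball 0 1) x + enn2real (cone_average x)" for x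
  have [measurable]: "\<sigma> \<in> borel_measurable borel" unfolding \<sigma>_def by measurable
  have s0: "0 \<le> \<sigma> x" for x by (simp add: \<sigma>_def)
  have se: "ennreal (\<sigma> x) = indicator (cball 0 1) x + cone_average x" for x
    using cone_average_finite[of x] by (simp add: \<sigma>_def ennreal_plus ennreal_indicator)
  have nn: "(\<integral>\<^sup>+x. ennreal (\<sigma> x) \<partial>lborel) = emeasure lborel (cball (0::real^'n) 1) + (\<integral>\<^sup>+x. cone_average x \<partial>(lborel :: (real^'n) measure))"
    unfolding se by (subst nn_integral_add) auto
  then have int: "integrable lborel \<sigma>"
    using s0 cone_average_integral_finite emeasure_bounded_finite[OF bounded_cball, of "0::real^'n" 1]
    by (intro integrableI_nonneg) (auto simp: ennreal_add_less_top)
  define Z where "Z = (\<integral>x. \<sigma> x \<partial>lborel)"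
  have Z: "Z > 0"
  proof -
    have "0 < emeasure lborel (cball (0::real^'n) 1)" by (simp add: emeasure_cball)
    then have "0 < (\<integral>\<^sup>+x. ennreal (\<sigma> x) \<partial>lborel)" unfolding nn by (simp add: add_pos_nonneg)
    also have "\<dots> = ennreal Z" unfolding Z_def using int s0 by (intro nn_integral_eq_integral) auto
    finally show ?thesis by simp
  qed
  show thesis
  proof (rule that[of "\<lambda>x. \<sigma> x / Z" Z])
    show "convolution_kernel (\<lambda>x. \<sigma> x / Z)"
      using s0 Z int unfolding convolution_kernel_def by (simp add: Z_def)
    show "even_fun (\<lambda>x. \<sigma> x / Z)"
      by (simp add: even_fun_def \<sigma>_def cone_average_even indicator_def)
    show "supp (\<lambda>x. \<sigma> x / Z) \<subseteq> cball 0 1"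
    proof (rule compact_suppI(2))
      fix y :: "real^'n" assume "\<sigma> y / Z \<noteq> 0"
      then show "y \<in> cball 0 1" using cone_average_eq_0[of y] by (cases "norm y > 1") (auto simp: \<sigma>_def)
    qed
    show "ennreal (Z * (\<sigma> x / Z)) = indicator (cball 0 1) x + cone_average x" for x
      using Z se by simp
  qed (use Z in auto)
qed

subsection \<open>The commutator estimate\<close>

lemma weak_divergence_trace:
  fixes b :: "real^'n \<Rightarrow> real^'n"
  assumes b: "locally_integrable b" and div: "weak_divergence b divb" and \<psi>: "test_function \<psi>"
    and deriv: "\<And>j. (\<integral>x. b x $ j * grad \<psi> x $ j \<partial>lebesgue) = - D j"
  shows "(\<integral>x. \<psi> x * divb x \<partial>lebesgue) = (\<Sum>j\<in>UNIV. D j)"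
proof -
  obtain B r where f: "\<And>i. (\<lambda>x. grad \<psi> x $ i) \<in> borel_measurable borel" "\<And>x i. \<bar>grad \<psi> x $ i\<bar> \<le> B"
    "\<And>x. x \<notin> cball 0 r \<Longrightarrow> grad \<psi> x = 0" using test_function_bounds[OF \<psi>] by metis
  have z: "grad \<psi> x $ j = 0" if "x \<notin> cball 0 r" for x j using f(3)[OF that] by simp
  have i: "integrable lebesgue (\<lambda>x. b x $ j * grad \<psi> x $ j)" for j
    by (rule locally_integrable_mult[OF locally_integrable_component[OF b] f(1,2) z])
  have "- (\<integral>x. \<psi> x * divb x \<partial>lebesgue) = (\<integral>x. b x \<bullet> grad \<psi> x \<partial>lebesgue)"
    using div \<psi> by (simp add: weak_divergence_def)
  also have "\<dots> = (\<Sum>j\<in>UNIV. \<integral>x. b x $ j * grad \<psi> x $ j \<partial>lebesgue)"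
    using i by (simp add: inner_vec_def)
  also have "\<dots> = - (\<Sum>j\<in>UNIV. D j)" by (simp add: deriv sum_negf)
  finally show ?thesis by simp
qed

lemma commutator_le:
  fixes \<theta> u divb g :: "real^'n \<Rightarrow> real" and b :: "real^'n \<Rightarrow> real^'n" and v :: "'n \<Rightarrow> real^'n \<Rightarrow> real"
  assumes sm: "smooth \<theta>" and supp: "supp \<theta> \<subseteq> cball 0 1" and \<epsilon>: "\<epsilon> > 0" and u: "Linfty u"
    and b: "locally_integrable b" and vm[measurable]: "\<And>i. v i \<in> borel_measurable borel"
    and v: "\<And>i. locally_integrable (v i)" and bv: "AE y in lebesgue. \<forall>i. b y $ i = v i y"
    and divb: "locally_integrable divb" and gm[measurable]: "g \<in> borel_measurable borel"
    and g: "locally_integrable g" and dg: "AE y in lebesgue. divb y = g y"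
    and K: "\<And>z i. \<bar>grad \<theta> z $ i\<bar> \<le> K" and T: "\<And>z. \<bar>\<theta> z\<bar> \<le> T" and x: "\<And>i. b x $ i = v i x"
  shows "ennreal \<bar>commutator u b divb \<theta> \<epsilon> x\<bar> \<le> Linf_norm_on (cball x \<epsilon>) u *
    (ennreal (K / (\<epsilon> ^ CARD('n) * \<epsilon>)) * (\<Sum>i\<in>UNIV. \<integral>\<^sup>+y. ennreal \<bar>v i x - v i y\<bar> * indicator (cball x \<epsilon>) y \<partial>lborel)
      + ennreal (T / \<epsilon> ^ CARD('n)) * (\<integral>\<^sup>+y. ennreal \<bar>g y\<bar> * indicator (cball x \<epsilon>) y \<partial>lborel))"
proof -
  define k where "k = rescale \<epsilon> \<theta>"
  define K' where "K' = K / (\<epsilon> ^ CARD('n) * \<epsilon>)"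
  define T' where "T' = T / \<epsilon> ^ CARD('n)"
  have K0: "0 \<le> K" and T0: "0 \<le> T" using K[of 0] T[of 0] by (meson abs_ge_zero order_trans)+
  have ksm: "smooth k" unfolding k_def by (rule smooth_rescale[OF sm])
  have kz: "k w = 0" if "w \<notin> cball 0 \<epsilon>" for w
    unfolding k_def using that by (intro rescale_eq_0[OF supp \<epsilon>]) auto
  have ks: "supp k \<subseteq> cball 0 \<epsilon>" by (rule compact_suppI(2)) (use kz in blast)
  have gz: "grad k w = 0" if "w \<notin> cball 0 \<epsilon>" for w using that ks by (intro grad_eq_0) blast
  have kT: "\<bar>k w\<bar> \<le> T'" for w
    using T[of "w /\<^sub>R \<epsilon>"] \<epsilon> by (simp add: k_def rescale_def T'_def divide_right_mono)
  have gK: "\<bar>grad k w $ i\<bar> \<le> K'" for w i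
  proof -
    have "grad k w = (inverse (\<epsilon> ^ CARD('n)) * inverse \<epsilon>) *\<^sub>R grad \<theta> (inverse \<epsilon> *\<^sub>R w + 0)"
      unfolding k_def rescale_eq_affine(1) by (rule grad_affine[OF smooth_imp_differentiable[OF sm]])
    then have "\<bar>grad k w $ i\<bar> = \<bar>grad \<theta> (inverse \<epsilon> *\<^sub>R w + 0) $ i\<bar> / (\<epsilon> ^ CARD('n) * \<epsilon>)"
      using \<epsilon> by (simp add: abs_mult divide_inverse)
    then show ?thesis using K[of "inverse \<epsilon> *\<^sub>R w + 0" i] \<epsilon> by (simp add: K'_def divide_right_mono)
  qed
  have km[measurable]: "(\<lambda>y. k (x - y)) \<in> borel_measurable borel"
    by (intro borel_measurable_continuous_onI continuous_on_compose2[OF smooth_continuous[OF ksm]] continuous_intros) auto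
  have gkm[measurable]: "(\<lambda>y. grad k (x - y) $ i) \<in> borel_measurable borel" for i
    by (intro borel_measurable_continuous_onI continuous_on_component
        continuous_on_compose2[OF continuous_grad[OF ksm]] continuous_intros) auto
  have kz': "k (x - y) = 0" "grad k (x - y) = 0" if "y \<notin> cball x \<epsilon>" for y
    using that kz[of "x - y"] gz[of "x - y"] by (auto simp: dist_norm norm_minus_commute)
  have gz': "grad k (x - y) $ i = 0" if "y \<notin> cball x \<epsilon>" for y i
    using kz'(2)[OF that] by simp
  have um: "u \<in> borel_measurable lebesgue" using u by (simp add: Linfty_def)
  have lm: "f \<in> borel_measurable lebesgue" if "f \<in> borel_measurable borel" for f :: "real^'n \<Rightarrow> real"
    using that by (simp add: measurable_completion)
  define W where "W y = (\<Sum>i\<in>UNIV. (v i x - v i y) * grad k (x - y) $ i) + g y * k (x - y)" for y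
  define W1 where "W1 y = (\<Sum>i\<in>UNIV. v i x * grad k (x - y) $ i)" for y
  define W2 where "W2 y = g y * k (x - y) - (\<Sum>i\<in>UNIV. v i y * grad k (x - y) $ i)" for y
  have Weq: "W y = W1 y + W2 y" for y
    by (simp add: W_def W1_def W2_def left_diff_distrib sum_subtractf)
  have i1: "integrable lebesgue (\<lambda>y. u y * grad k (x - y) $ i)" for i
    by (rule locally_integrable_mult[OF Linfty_locally_integrable[OF u] gkm gK gz'])
  have iW1: "integrable lebesgue (\<lambda>y. u y * W1 y)"
  proof -
    have "u y * W1 y = (\<Sum>i\<in>UNIV. v i x * (u y * grad k (x - y) $ i))" for y
      by (simp add: W1_def sum_distrib_left ac_simps)
    then show ?thesis using i1 by simp
  qed
  have iW2: "integrable lebesgue (\<lambda>y. u y * W2 y)"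
    unfolding W2_def
    by (intro Linfty_mult_integrable[OF u] Bochner_Integration.integrable_diff Bochner_Integration.integrable_sum
        locally_integrable_mult[OF g km kT kz'(1)] locally_integrable_mult[OF v gkm gK gz'])
  have part1: "b x \<bullet> grad (conv u k) x = (\<integral>y. u y * W1 y \<partial>lebesgue)"
  proof -
    have "grad (conv u k) x = (\<chi> i. \<integral>y. u y * grad k (x - y) $ i \<partial>lebesgue)"
      by (rule grad_eqI[OF conv_has_derivative[OF Linfty_locally_integrable[OF u] ksm ks]])
    then have "b x \<bullet> grad (conv u k) x = (\<Sum>i\<in>UNIV. v i x * (\<integral>y. u y * grad k (x - y) $ i \<partial>lebesgue))"
      by (simp add: inner_vec_def x)
    also have "\<dots> = (\<integral>y. (\<Sum>i\<in>UNIV. v i x * (u y * grad k (x - y) $ i)) \<partial>lebesgue)"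
      using i1 by simp
    also have "\<dots> = (\<integral>y. u y * W1 y \<partial>lebesgue)"
      by (simp add: W1_def sum_distrib_left ac_simps)
    finally show ?thesis .
  qed
  have part2: "distr_conv (transport_distr b divb u) k x = - (\<integral>y. u y * W2 y \<partial>lebesgue)"
  proof -
    have "(\<integral>y. u y * (k (x - y) * divb y + b y \<bullet> grad (\<lambda>y. k (x - y)) y) \<partial>lebesgue) = (\<integral>y. u y * W2 y \<partial>lebesgue)"
    proof (rule integral_cong_AE)
      have "(\<lambda>y. b y $ i) \<in> borel_measurable lebesgue" for i
        by (rule locally_integrable_measurable[OF locally_integrable_component[OF b]])
      then show "(\<lambda>y. u y * (k (x - y) * divb y + b y \<bullet> grad (\<lambda>y. k (x - y)) y)) \<in> borel_measurable lebesgue"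
        using um lm[OF km] lm[OF gkm] locally_integrable_measurable[OF divb]
        by (simp add: grad_reflect[OF ksm] inner_vec_def)
      show "(\<lambda>y. u y * W2 y) \<in> borel_measurable lebesgue" using iW2 by (rule borel_measurable_integrable)
      show "AE y in lebesgue. u y * (k (x - y) * divb y + b y \<bullet> grad (\<lambda>y. k (x - y)) y) = u y * W2 y"
        using bv dg by eventually_elim (simp add: W2_def grad_reflect[OF ksm] inner_vec_def mult.commute sum_negf)
    qed
    then show ?thesis by (simp add: distr_conv_def transport_distr_def)
  qed
  have "commutator u b divb \<theta> \<epsilon> x = (\<integral>y. u y * W y \<partial>lebesgue)"
    using iW1 iW2 part1 part2 by (simp add: commutator_def k_def[symmetric] Weq distrib_left)
  moreover have "integrable lebesgue (\<lambda>y. u y * W y)"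
    using iW1 iW2 by (simp add: Weq distrib_left)
  ultimately have "ennreal \<bar>commutator u b divb \<theta> \<epsilon> x\<bar> \<le> (\<integral>\<^sup>+y. ennreal \<bar>u y * W y\<bar> \<partial>lebesgue)"
    using integral_norm_bound_ennreal[of lebesgue "\<lambda>y. u y * W y"] by simp
  also have "\<dots> \<le> (\<integral>\<^sup>+y. Linf_norm_on (cball x \<epsilon>) u * ennreal \<bar>W y\<bar> \<partial>lebesgue)"
  proof (rule nn_integral_mono_AE)
    have "cball x \<epsilon> \<in> sets borel" by simp
    from Linf_norm_on_AE[OF this, of u]
    show "AE y in lebesgue. ennreal \<bar>u y * W y\<bar> \<le> Linf_norm_on (cball x \<epsilon>) u * ennreal \<bar>W y\<bar>"
    proof (rule eventually_mono)
      fix y assume y: "y \<in> cball x \<epsilon> \<longrightarrow> ennreal \<bar>u y\<bar> \<le> Linf_norm_on (cball x \<epsilon>) u"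
      show "ennreal \<bar>u y * W y\<bar> \<le> Linf_norm_on (cball x \<epsilon>) u * ennreal \<bar>W y\<bar>"
      proof (cases "y \<in> cball x \<epsilon>")
        case True
        then show ?thesis using y by (simp add: abs_mult ennreal_mult' mult_right_mono)
      next
        case False
        then show ?thesis using kz' by (simp add: W_def)
      qed
    qed
  qed
  also have "\<dots> = (\<integral>\<^sup>+y. Linf_norm_on (cball x \<epsilon>) u * ennreal \<bar>W y\<bar> \<partial>lborel)"
    by (rule nn_integral_completion)
  also have "\<dots> = Linf_norm_on (cball x \<epsilon>) u * (\<integral>\<^sup>+y. ennreal \<bar>W y\<bar> \<partial>lborel)"
    unfolding W_def by (rule nn_integral_cmult) measurable
  also have "\<dots> \<le> Linf_norm_on (cball x \<epsilon>) u *
    (ennreal K' * (\<Sum>i\<in>UNIV. \<integral>\<^sup>+y. ennreal \<bar>v i x - v i y\<bar> * indicator (cball x \<epsilon>) y \<partial>lborel)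
      + ennreal T' * (\<integral>\<^sup>+y. ennreal \<bar>g y\<bar> * indicator (cball x \<epsilon>) y \<partial>lborel))"
  proof (rule mult_left_mono)
    have [measurable]: "cball x \<epsilon> \<in> sets borel" by simp
    have "(\<integral>\<^sup>+y. ennreal \<bar>W y\<bar> \<partial>lborel)
      \<le> (\<integral>\<^sup>+y. ennreal K' * (\<Sum>i\<in>UNIV. ennreal \<bar>v i x - v i y\<bar> * indicator (cball x \<epsilon>) y)
        + ennreal T' * (ennreal \<bar>g y\<bar> * indicator (cball x \<epsilon>) y) \<partial>lborel)"
    proof (rule nn_integral_mono)
      fix y
      show "ennreal \<bar>W y\<bar> \<le> ennreal K' * (\<Sum>i\<in>UNIV. ennreal \<bar>v i x - v i y\<bar> * indicator (cball x \<epsilon>) y)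
        + ennreal T' * (ennreal \<bar>g y\<bar> * indicator (cball x \<epsilon>) y)"
      proof (cases "y \<in> cball x \<epsilon>")
        case True
        have K'0: "0 \<le> K'" "0 \<le> T'" using K0 T0 \<epsilon> by (simp_all add: K'_def T'_def)
        have "\<bar>W y\<bar> \<le> (\<Sum>i\<in>UNIV. \<bar>(v i x - v i y) * grad k (x - y) $ i\<bar>) + \<bar>g y * k (x - y)\<bar>"
          unfolding W_def by (intro order_trans[OF abs_triangle_ineq] add_right_mono sum_abs)
        also have "\<dots> \<le> (\<Sum>i\<in>UNIV. K' * \<bar>v i x - v i y\<bar>) + T' * \<bar>g y\<bar>"
        proof (intro add_mono sum_mono)
          show "\<bar>(v i x - v i y) * grad k (x - y) $ i\<bar> \<le> K' * \<bar>v i x - v i y\<bar>" for i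
            using mult_right_mono[OF gK[of "x - y" i], of "\<bar>v i x - v i y\<bar>"] by (simp add: abs_mult mult.commute)
          show "\<bar>g y * k (x - y)\<bar> \<le> T' * \<bar>g y\<bar>"
            using mult_right_mono[OF kT[of "x - y"], of "\<bar>g y\<bar>"] by (simp add: abs_mult mult.commute)
        qed
        also have "\<dots> = K' * (\<Sum>i\<in>UNIV. \<bar>v i x - v i y\<bar>) + T' * \<bar>g y\<bar>"
          by (simp add: sum_distrib_left)
        finally have "ennreal \<bar>W y\<bar> \<le> ennreal (K' * (\<Sum>i\<in>UNIV. \<bar>v i x - v i y\<bar>) + T' * \<bar>g y\<bar>)"
          by (rule ennreal_leI)
        also have "\<dots> = ennreal K' * (\<Sum>i\<in>UNIV. ennreal \<bar>v i x - v i y\<bar>) + ennreal T' * ennreal \<bar>g y\<bar>"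
          using K'0 by (simp add: ennreal_plus ennreal_mult sum_nonneg sum_ennreal)
        finally show ?thesis using True by simp
      next
        case False
        then show ?thesis using kz' by (simp add: W_def)
      qed
    qed
    also have "\<dots> = ennreal K' * (\<Sum>i\<in>UNIV. \<integral>\<^sup>+y. ennreal \<bar>v i x - v i y\<bar> * indicator (cball x \<epsilon>) y \<partial>lborel)
        + ennreal T' * (\<integral>\<^sup>+y. ennreal \<bar>g y\<bar> * indicator (cball x \<epsilon>) y \<partial>lborel)"
    proof -
      have sum: "(\<integral>\<^sup>+y. (\<Sum>i\<in>UNIV. ennreal \<bar>v i x - v i y\<bar> * indicator (cball x \<epsilon>) y) \<partial>lborel)
          = (\<Sum>i\<in>UNIV. \<integral>\<^sup>+y. ennreal \<bar>v i x - v i y\<bar> * indicator (cball x \<epsilon>) y \<partial>lborel)"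
        by (rule nn_integral_sum) measurable
      show ?thesis unfolding sum[symmetric]
        by (subst nn_integral_add, measurable) (subst nn_integral_cmult, measurable)+
    qed
    finally show "(\<integral>\<^sup>+y. ennreal \<bar>W y\<bar> \<partial>lborel)
      \<le> ennreal K' * (\<Sum>i\<in>UNIV. \<integral>\<^sup>+y. ennreal \<bar>v i x - v i y\<bar> * indicator (cball x \<epsilon>) y \<partial>lborel)
        + ennreal T' * (\<integral>\<^sup>+y. ennreal \<bar>g y\<bar> * indicator (cball x \<epsilon>) y \<partial>lborel)" .
  qed simp
  finally show ?thesis unfolding K'_def T'_def .
qed

lemma measure_conv_averaging_kernel:
  fixes M :: "(real^'n) measure"
  assumes M: "radon_measure M" and Z: "Z > 0" and \<epsilon>: "\<epsilon> > 0"
    and \<rho>: "\<And>x. ennreal (Z * \<rho> x) = indicator (cball 0 1) x + cone_average x"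
  shows "ennreal (Z * \<epsilon> ^ CARD('n)) * measure_conv M (rescale \<epsilon> \<rho>) x
    = emeasure M (cball x \<epsilon>) + (\<integral>\<^sup>+y. cone_average ((x - y) /\<^sub>R \<epsilon>) \<partial>M)"
proof -
  note [measurable_cong] = radon_measure_sets[OF M]
  have [measurable]: "cball (0::real^'n) 1 \<in> sets borel" "cball x \<epsilon> \<in> sets borel" by simp_all
  let ?c = "ennreal (1 / (Z * \<epsilon> ^ CARD('n)))"
  have e: "ennreal (rescale \<epsilon> \<rho> (x - y)) = ?c * (indicator (cball x \<epsilon>) y + cone_average ((x - y) /\<^sub>R \<epsilon>))" for y
  proof -
    have eq: "rescale \<epsilon> \<rho> (x - y) = 1 / (Z * \<epsilon> ^ CARD('n)) * (Z * \<rho> ((x - y) /\<^sub>R \<epsilon>))"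
      using Z \<epsilon> by (simp add: rescale_def)
    have "ennreal (rescale \<epsilon> \<rho> (x - y)) = ?c * ennreal (Z * \<rho> ((x - y) /\<^sub>R \<epsilon>))"
    proof -
      have p: "0 \<le> 1 / (Z * \<epsilon> ^ CARD('n))" using Z \<epsilon> by simp
      show ?thesis unfolding eq by (rule ennreal_mult'[OF p])
    qed
    moreover have "indicator (cball 0 1) ((x - y) /\<^sub>R \<epsilon>) = (indicator (cball x \<epsilon>) y :: ennreal)"
    proof -
      have n: "norm ((x - y) /\<^sub>R \<epsilon>) = norm (x - y) / \<epsilon>" using \<epsilon> by (simp add: divide_inverse mult.commute)
      have "norm ((x - y) /\<^sub>R \<epsilon>) \<le> 1 \<longleftrightarrow> norm (x - y) \<le> \<epsilon>"
        unfolding n using \<epsilon> by (simp add: divide_le_eq)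
      then show ?thesis by (simp only: indicator_def mem_cball dist_norm diff_0 norm_minus_cancel)
    qed
    ultimately show ?thesis by (simp only: \<rho>)
  qed
  have "measure_conv M (rescale \<epsilon> \<rho>) x = ?c * (\<integral>\<^sup>+y. indicator (cball x \<epsilon>) y + cone_average ((x - y) /\<^sub>R \<epsilon>) \<partial>M)"
    unfolding measure_conv_def e by (rule nn_integral_cmult) measurable
  also have "(\<integral>\<^sup>+y. indicator (cball x \<epsilon>) y + cone_average ((x - y) /\<^sub>R \<epsilon>) \<partial>M)
      = (\<integral>\<^sup>+y. indicator (cball x \<epsilon>) y \<partial>M) + (\<integral>\<^sup>+y. cone_average ((x - y) /\<^sub>R \<epsilon>) \<partial>M)"
    by (rule nn_integral_add) measurable
  also have "(\<integral>\<^sup>+y. indicator (cball x \<epsilon>) y \<partial>M) = emeasure M (cball x \<epsilon>)"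
    by (simp add: radon_measure_sets[OF M])
  finally have "measure_conv M (rescale \<epsilon> \<rho>) x
      = ?c * (emeasure M (cball x \<epsilon>) + (\<integral>\<^sup>+y. cone_average ((x - y) /\<^sub>R \<epsilon>) \<partial>M))" .
  moreover have "ennreal (Z * \<epsilon> ^ CARD('n)) * ?c = 1"
    using Z \<epsilon> by (subst ennreal_mult'[symmetric]) auto
  ultimately show ?thesis by (simp only: mult.assoc[symmetric] mult_1)
qed

lemma nn_integral_measure_conv:
  fixes M :: "(real^'n) measure" and \<phi> \<rho> :: "real^'n \<Rightarrow> real"
  assumes M: "radon_measure M" and \<phi>: "\<phi> \<in> borel_measurable lebesgue"
    and \<rho>[measurable]: "\<rho> \<in> borel_measurable borel" and even: "even_fun \<rho>"
  shows "(\<integral>\<^sup>+x. ennreal \<bar>\<phi> x\<bar> * measure_conv M \<rho> x \<partial>lebesgue) = (\<integral>\<^sup>+x. abs_conv \<phi> \<rho> x \<partial>M)"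
proof -
  note [measurable_cong] = radon_measure_sets[OF M]
  interpret M: sigma_finite_measure M by (rule radon_sigma_finite[OF M])
  interpret LM: pair_sigma_finite lborel M by (rule lborel_pair_radon[OF M])
  obtain f where fm: "f \<in> borel_measurable lborel" and "AE x in lborel. \<phi> x = f x"
    using completion_ex_borel_measurable_real[OF \<phi>] by blast
  then have f: "AE x in lebesgue. \<phi> x = f x" by (intro AE_completion)
  have [measurable]: "f \<in> borel_measurable borel" using fm by simp
  have "(\<integral>\<^sup>+x. ennreal \<bar>\<phi> x\<bar> * measure_conv M \<rho> x \<partial>lebesgue) = (\<integral>\<^sup>+x. ennreal \<bar>f x\<bar> * measure_conv M \<rho> x \<partial>lebesgue)"
    by (rule nn_integral_cong_AE) (use f in eventually_elim, simp)
  also have "\<dots> = (\<integral>\<^sup>+x. ennreal \<bar>f x\<bar> * measure_conv M \<rho> x \<partial>lborel)" by (rule nn_integral_completion)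
  also have "\<dots> = (\<integral>\<^sup>+x. (\<integral>\<^sup>+y. ennreal \<bar>f x\<bar> * ennreal (\<rho> (x - y)) \<partial>M) \<partial>lborel)"
    unfolding measure_conv_def by (rule nn_integral_cong, rule nn_integral_cmult[symmetric]) measurable
  also have "\<dots> = (\<integral>\<^sup>+y. (\<integral>\<^sup>+x. ennreal \<bar>f x\<bar> * ennreal (\<rho> (x - y)) \<partial>lborel) \<partial>M)"
    by (rule LM.Fubini'[symmetric]) measurable
  also have "\<dots> = (\<integral>\<^sup>+y. abs_conv \<phi> \<rho> y \<partial>M)"
  proof (rule nn_integral_cong)
    fix y
    have "\<rho> (x - y) = \<rho> (y - x)" for x
      using even unfolding even_fun_def by (metis minus_diff_eq)
    then have "(\<integral>\<^sup>+x. ennreal \<bar>f x\<bar> * ennreal (\<rho> (x - y)) \<partial>lborel) = (\<integral>\<^sup>+x. ennreal \<bar>f x\<bar> * ennreal (\<rho> (y - x)) \<partial>lebesgue)"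
      by (simp add: nn_integral_completion)
    also have "\<dots> = abs_conv \<phi> \<rho> y"
      unfolding abs_conv_def by (rule nn_integral_cong_AE) (use f in eventually_elim, simp)
    finally show "(\<integral>\<^sup>+x. ennreal \<bar>f x\<bar> * ennreal (\<rho> (x - y)) \<partial>lborel) = abs_conv \<phi> \<rho> y" .
  qed
  finally show ?thesis .
qed

lemma cball_subset_closed_nbhd:
  fixes \<phi> :: "real^'n \<Rightarrow> real"
  assumes "\<phi> x \<noteq> 0"
  shows "cball x \<epsilon> \<subseteq> closed_nbhd \<epsilon> (supp \<phi>)"
proof
  fix y assume "y \<in> cball x \<epsilon>"
  then show "y \<in> closed_nbhd \<epsilon> (supp \<phi>)"
    using infdist_le2[OF supp_I[of \<phi> x], of y \<epsilon>] supp_I[of \<phi> x] assms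
    by (auto simp: closed_nbhd_def dist_commute)
qed

lemma closed_nbhd_borel: "closed_nbhd \<epsilon> S \<in> sets borel"
proof -
  have "closed {x. infdist x S \<le> \<epsilon>}" by (intro closed_Collect_le continuous_intros)
  then show ?thesis by (cases "S = {}") (simp_all add: closed_nbhd_def)
qed

lemma nn_integral_commutator_le:
  fixes \<phi> r u \<rho> :: "real^'n \<Rightarrow> real"
  assumes M: "radon_measure M" and \<phi>: "\<phi> \<in> borel_measurable lebesgue" and u: "u \<in> borel_measurable lebesgue"
    and \<rho>: "\<rho> \<in> borel_measurable borel" "even_fun \<rho>"
    and le: "AE x in lebesgue. ennreal \<bar>r x\<bar> \<le> C * Linf_norm_on (cball x \<epsilon>) u * measure_conv M \<rho> x"
  shows "(\<integral>\<^sup>+x. ennreal \<bar>r x * \<phi> x\<bar> \<partial>lebesgue)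
    \<le> C * Linf_norm_on (closed_nbhd \<epsilon> (supp \<phi>)) u * (\<integral>\<^sup>+x. abs_conv \<phi> \<rho> x \<partial>M)"
proof -
  let ?L = "C * Linf_norm_on (closed_nbhd \<epsilon> (supp \<phi>)) u"
  note [measurable_cong] = radon_measure_sets[OF M]
  interpret M: sigma_finite_measure M by (rule radon_sigma_finite[OF M])
  note [measurable] = \<rho>(1)
  have "(\<integral>\<^sup>+x. ennreal \<bar>r x * \<phi> x\<bar> \<partial>lebesgue) \<le> (\<integral>\<^sup>+x. ?L * (ennreal \<bar>\<phi> x\<bar> * measure_conv M \<rho> x) \<partial>lebesgue)"
  proof (rule nn_integral_mono_AE, use le in eventually_elim)
    fix x assume x: "ennreal \<bar>r x\<bar> \<le> C * Linf_norm_on (cball x \<epsilon>) u * measure_conv M \<rho> x"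
    show "ennreal \<bar>r x * \<phi> x\<bar> \<le> ?L * (ennreal \<bar>\<phi> x\<bar> * measure_conv M \<rho> x)"
    proof (cases "\<phi> x = 0")
      case False
      have "Linf_norm_on (cball x \<epsilon>) u \<le> Linf_norm_on (closed_nbhd \<epsilon> (supp \<phi>)) u"
        by (intro Linf_norm_on_mono u cball_subset_closed_nbhd False closed_nbhd_borel) simp
      then have "C * Linf_norm_on (cball x \<epsilon>) u * measure_conv M \<rho> x \<le> ?L * measure_conv M \<rho> x"
        by (intro mult_left_mono mult_right_mono) auto
      with x have "ennreal \<bar>r x\<bar> \<le> ?L * measure_conv M \<rho> x" by (rule order_trans)
      then have "ennreal \<bar>r x\<bar> * ennreal \<bar>\<phi> x\<bar> \<le> ?L * measure_conv M \<rho> x * ennreal \<bar>\<phi> x\<bar>"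
        by (rule mult_right_mono) simp
      then show ?thesis by (simp add: abs_mult ennreal_mult' ac_simps)
    qed simp
  qed
  also have "\<dots> = ?L * (\<integral>\<^sup>+x. ennreal \<bar>\<phi> x\<bar> * measure_conv M \<rho> x \<partial>lebesgue)"
  proof (rule nn_integral_cmult)
    have "measure_conv M \<rho> \<in> borel_measurable borel" unfolding measure_conv_def by measurable
    then have "measure_conv M \<rho> \<in> borel_measurable lebesgue" by (simp add: measurable_completion)
    then show "(\<lambda>x. ennreal \<bar>\<phi> x\<bar> * measure_conv M \<rho> x) \<in> borel_measurable lebesgue" using \<phi> by simp
  qed
  also have "\<dots> = ?L * (\<integral>\<^sup>+x. abs_conv \<phi> \<rho> x \<partial>M)"
    by (simp add: nn_integral_measure_conv[OF M \<phi> \<rho>])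
  finally show ?thesis .
qed

lemma commutator_AE_le:
  fixes \<theta> u divb \<rho> :: "real^'n \<Rightarrow> real" and b :: "real^'n \<Rightarrow> real^'n"
  assumes \<theta>: "mollifier \<theta>" and K: "\<And>z i. \<bar>grad \<theta> z $ i\<bar> \<le> K" and T: "\<And>z. \<bar>\<theta> z\<bar> \<le> T"
    and Z: "Z > 0" and \<rho>: "\<And>x. ennreal (Z * \<rho> x) = indicator (cball 0 1) x + cone_average x"
    and u: "Linfty u" and b: "locally_integrable b" and mu: "matrix_radon_measure Db P N"
    and deriv: "\<And>\<psi> i j. test_function \<psi> \<Longrightarrow>
      (\<integral>x. b x $ i * grad \<psi> x $ j \<partial>lebesgue) = - ((\<integral>x. \<psi> x \<partial>P i j) - (\<integral>x. \<psi> x \<partial>N i j))"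
    and divb: "locally_integrable divb" and div: "weak_divergence b divb" and \<epsilon>: "\<epsilon> > 0"
  shows "AE x in lebesgue. ennreal \<bar>commutator u b divb \<theta> \<epsilon> x\<bar>
    \<le> ennreal (Z * (K * (real CARD('n))\<^sup>2 + T * real CARD('n))) * Linf_norm_on (cball x \<epsilon>) u
      * measure_conv (total_variation Db) (rescale \<epsilon> \<rho>) x"
proof -
  let ?d = "real CARD('n)" and ?M = "total_variation Db"
  have sm: "smooth \<theta>" and supp: "supp \<theta> \<subseteq> cball 0 1" using \<theta> by (auto simp: mollifier_def)
  have K0: "0 \<le> K" and T0: "0 \<le> T" using K[of 0] T[of 0] by (meson abs_ge_zero order_trans)+
  have M: "radon_measure ?M" by (rule radon_total_variation[OF mu])
  have P: "radon_measure (P i j)" and N: "radon_measure (N i j)" for i j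
    using mu by (auto simp: matrix_radon_measure_def)
  have PN: "emeasure (P i j) A \<le> emeasure (N i j) A + emeasure ?M A"
    and NP: "emeasure (N i j) A \<le> emeasure (P i j) A + emeasure ?M A" if "A \<in> sets borel" for i j A
    using emeasure_le_add_bounded[OF _ _ _ matrix_radon_measure_entry_le(1)[OF mu] that]
      emeasure_le_add_bounded[OF _ _ _ matrix_radon_measure_entry_le(2)[OF mu] that]
    by (simp_all add: radon_measure_sets P N M)
  have "\<exists>w. w \<in> borel_measurable borel \<and> locally_integrable w \<and> (AE x in lebesgue. b x $ i = w x)" for i
    using locally_integrable_borel_representative[OF locally_integrable_component[OF b]] by metis
  then obtain v where vm: "\<And>i. v i \<in> borel_measurable borel" and v: "\<And>i. locally_integrable (v i)"
    and bv': "\<And>i. AE x in lebesgue. b x $ i = v i x" by metis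
  then have bv: "AE x in lebesgue. \<forall>i. b x $ i = v i x" by (simp add: AE_all_countable)
  obtain g where gm: "g \<in> borel_measurable borel" and g: "locally_integrable g" and dg: "AE x in lebesgue. divb x = g x"
    using locally_integrable_borel_representative[OF divb] by metis
  have deriv_v: "(\<integral>x. v i x * grad \<psi> x $ j \<partial>lebesgue) = - ((\<integral>x. \<psi> x \<partial>P i j) - (\<integral>x. \<psi> x \<partial>N i j))"
    if \<psi>: "test_function \<psi>" for \<psi> i j
  proof -
    obtain B r where "\<And>i. (\<lambda>x. grad \<psi> x $ i) \<in> borel_measurable borel" using test_function_bounds[OF \<psi>] by metis
    then have m: "(\<lambda>x. grad \<psi> x $ j) \<in> borel_measurable lebesgue" by (simp add: measurable_completion)
    have "(\<integral>x. v i x * grad \<psi> x $ j \<partial>lebesgue) = (\<integral>x. b x $ i * grad \<psi> x $ j \<partial>lebesgue)"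
      using locally_integrable_measurable[OF v] locally_integrable_measurable[OF locally_integrable_component[OF b]] m bv'[of i]
      by (intro integral_cong_AE borel_measurable_times) (auto elim: eventually_mono)
    then show ?thesis using deriv[OF \<psi>] by simp
  qed
  have div_g: "(\<integral>x. \<psi> x * g x \<partial>lebesgue) = (\<Sum>j\<in>UNIV. (\<integral>x. \<psi> x \<partial>P j j) - (\<integral>x. \<psi> x \<partial>N j j))"
    if \<psi>: "test_function \<psi>" for \<psi>
  proof -
    have m: "\<psi> \<in> borel_measurable lebesgue"
      using \<psi> by (simp add: test_function_def borel_measurable_smooth measurable_completion)
    have "(\<integral>x. \<psi> x * g x \<partial>lebesgue) = (\<integral>x. \<psi> x * divb x \<partial>lebesgue)"
      using locally_integrable_measurable[OF g] locally_integrable_measurable[OF divb] m dg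
      by (intro integral_cong_AE borel_measurable_times) (auto elim: eventually_mono)
    then show ?thesis using weak_divergence_trace[OF b div \<psi> deriv[OF \<psi>]] by simp
  qed
  have "AE x in lborel. \<forall>i. (\<integral>\<^sup>+y. ennreal \<bar>v i x - v i y\<bar> * indicator (cball x \<epsilon>) y \<partial>lborel)
      \<le> ennreal (?d * \<epsilon>) * (\<integral>\<^sup>+y. cone_average ((x - y) /\<^sub>R \<epsilon>) \<partial>?M)"
    unfolding AE_all_countable
    using difference_average_le[OF \<theta> v vm P N M PN NP deriv_v \<epsilon>] by blast
  then have "AE x in lebesgue. \<forall>i. (\<integral>\<^sup>+y. ennreal \<bar>v i x - v i y\<bar> * indicator (cball x \<epsilon>) y \<partial>lborel)
      \<le> ennreal (?d * \<epsilon>) * (\<integral>\<^sup>+y. cone_average ((x - y) /\<^sub>R \<epsilon>) \<partial>?M)" by (rule AE_completion)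
  with bv show ?thesis
  proof eventually_elim
    fix x assume x: "\<forall>i. b x $ i = v i x"
      and avg: "\<forall>i. (\<integral>\<^sup>+y. ennreal \<bar>v i x - v i y\<bar> * indicator (cball x \<epsilon>) y \<partial>lborel)
        \<le> ennreal (?d * \<epsilon>) * (\<integral>\<^sup>+y. cone_average ((x - y) /\<^sub>R \<epsilon>) \<partial>?M)"
    let ?S = "\<integral>\<^sup>+y. cone_average ((x - y) /\<^sub>R \<epsilon>) \<partial>?M" and ?B = "emeasure ?M (cball x \<epsilon>)"
    let ?L = "Linf_norm_on (cball x \<epsilon>) u" and ?e = "\<epsilon> ^ CARD('n)"
    define C where "C = (K * ?d\<^sup>2 + T * ?d) / ?e"
    have C0: "0 \<le> C" using K0 T0 \<epsilon> by (simp add: C_def)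
    have "(\<Sum>i\<in>UNIV. \<integral>\<^sup>+y. ennreal \<bar>v i x - v i y\<bar> * indicator (cball x \<epsilon>) y \<partial>lborel) \<le> (\<Sum>i\<in>(UNIV::'n set). ennreal (?d * \<epsilon>) * ?S)"
      using avg by (intro sum_mono) blast
    also have "\<dots> = ennreal (?d\<^sup>2 * \<epsilon>) * ?S"
      using \<epsilon> by (simp add: ennreal_of_nat_eq_real_of_nat mult.assoc[symmetric] ennreal_mult'[symmetric] power2_eq_square)
    finally have "ennreal (K / (?e * \<epsilon>)) * (\<Sum>i\<in>UNIV. \<integral>\<^sup>+y. ennreal \<bar>v i x - v i y\<bar> * indicator (cball x \<epsilon>) y \<partial>lborel)
        \<le> ennreal (K / (?e * \<epsilon>)) * (ennreal (?d\<^sup>2 * \<epsilon>) * ?S)" by (rule mult_left_mono) simp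
    also have "\<dots> = ennreal (K * ?d\<^sup>2 / ?e) * ?S"
      using \<epsilon> K0 by (simp add: mult.assoc[symmetric] ennreal_mult''[symmetric])
    also have "\<dots> \<le> ennreal C * ?S"
      using K0 T0 \<epsilon> by (intro mult_right_mono ennreal_leI) (auto simp: C_def divide_right_mono)
    finally have 1: "ennreal (K / (?e * \<epsilon>)) * (\<Sum>i\<in>UNIV. \<integral>\<^sup>+y. ennreal \<bar>v i x - v i y\<bar> * indicator (cball x \<epsilon>) y \<partial>lborel) \<le> ennreal C * ?S" .
    have "(\<integral>\<^sup>+y. ennreal \<bar>g y\<bar> * indicator (cball x \<epsilon>) y \<partial>lborel) \<le> ennreal ?d * ?B"
      by (rule divergence_le[OF \<theta> g gm P N M PN NP div_g]) auto
    then have "ennreal (T / ?e) * (\<integral>\<^sup>+y. ennreal \<bar>g y\<bar> * indicator (cball x \<epsilon>) y \<partial>lborel) \<le> ennreal (T / ?e) * (ennreal ?d * ?B)"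
      by (rule mult_left_mono) simp
    also have "\<dots> = ennreal (T * ?d / ?e) * ?B"
      using \<epsilon> T0 by (simp add: mult.assoc[symmetric] ennreal_mult''[symmetric])
    also have "\<dots> \<le> ennreal C * ?B"
      using K0 T0 \<epsilon> by (intro mult_right_mono ennreal_leI) (auto simp: C_def divide_right_mono)
    finally have 2: "ennreal (T / ?e) * (\<integral>\<^sup>+y. ennreal \<bar>g y\<bar> * indicator (cball x \<epsilon>) y \<partial>lborel) \<le> ennreal C * ?B" .
    have "ennreal \<bar>commutator u b divb \<theta> \<epsilon> x\<bar> \<le> ?L *
      (ennreal (K / (?e * \<epsilon>)) * (\<Sum>i\<in>UNIV. \<integral>\<^sup>+y. ennreal \<bar>v i x - v i y\<bar> * indicator (cball x \<epsilon>) y \<partial>lborel)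
      + ennreal (T / ?e) * (\<integral>\<^sup>+y. ennreal \<bar>g y\<bar> * indicator (cball x \<epsilon>) y \<partial>lborel))"
      by (rule commutator_le[OF sm supp \<epsilon> u b vm v bv divb gm g dg K T]) (use x in blast)
    also have "\<dots> \<le> ?L * (ennreal C * ?S + ennreal C * ?B)"
      by (intro mult_left_mono add_mono 1 2) simp
    also have "\<dots> = ?L * (ennreal C * (?B + ?S))" by (simp add: distrib_left add.commute)
    also have "\<dots> = ?L * (ennreal C * (ennreal (Z * ?e) * measure_conv ?M (rescale \<epsilon> \<rho>) x))"
      by (simp only: measure_conv_averaging_kernel[OF M Z \<epsilon> \<rho>])
    also have "\<dots> = ?L * (ennreal (C * (Z * ?e)) * measure_conv ?M (rescale \<epsilon> \<rho>) x)"
      by (simp only: ennreal_mult'[OF C0] mult.assoc)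
    also have "C * (Z * ?e) = Z * (K * ?d\<^sup>2 + T * ?d)" using \<epsilon> by (simp add: C_def)
    finally show "ennreal \<bar>commutator u b divb \<theta> \<epsilon> x\<bar>
      \<le> ennreal (Z * (K * ?d\<^sup>2 + T * ?d)) * ?L * measure_conv ?M (rescale \<epsilon> \<rho>) x"
      by (simp only: ac_simps)
  qed
qed

theorem proposition8:
  fixes \<theta> :: "real^'n \<Rightarrow> real"
  assumes "test_function \<theta>" and "convolution_kernel \<theta>" and "even_fun \<theta>"
    and "supp \<theta> \<subseteq> cball 0 1"
  shows "\<exists>(\<rho> :: real^'n \<Rightarrow> real) (C\<^sub>\<theta> :: real).
    convolution_kernel \<rho> \<and> even_fun \<rho> \<and> supp \<rho> \<subseteq> cball 0 1 \<and> 0 \<le> C\<^sub>\<theta> \<and>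
    (\<forall>(u :: real^'n \<Rightarrow> real) (b :: real^'n \<Rightarrow> real^'n) (Db :: (real^'n) set \<Rightarrow> real^'n^'n)
       (divb :: real^'n \<Rightarrow> real).
      Linfty u \<longrightarrow> BV_loc b Db \<longrightarrow> locally_integrable divb \<longrightarrow> weak_divergence b divb \<longrightarrow>
      (\<forall>\<epsilon>>0. \<forall>\<phi> :: real^'n \<Rightarrow> real. \<phi> \<in> borel_measurable lebesgue \<longrightarrow>
        (\<integral>\<^sup>+x. ennreal \<bar>commutator u b divb \<theta> \<epsilon> x * \<phi> x\<bar> \<partial>lebesgue)
          \<le> ennreal C\<^sub>\<theta> * Linf_norm_on (closed_nbhd \<epsilon> (supp \<phi>)) u
            * (\<integral>\<^sup>+x. abs_conv \<phi> (rescale \<epsilon> \<rho>) x \<partial>total_variation Db)) \<and>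
      (\<forall>\<epsilon>>0. AE x in lebesgue.
        ennreal \<bar>commutator u b divb \<theta> \<epsilon> x\<bar>
          \<le> ennreal C\<^sub>\<theta> * Linf_norm_on (cball x \<epsilon>) u
            * measure_conv (total_variation Db) (rescale \<epsilon> \<rho>) x))"
proof -
  obtain B r where KT: "\<And>x. \<bar>\<theta> x\<bar> \<le> B" "\<And>x i. \<bar>grad \<theta> x $ i\<bar> \<le> B"
    using test_function_bounds[OF assms(1)] by metis
  have "(\<integral>\<^sup>+x. ennreal (\<theta> x) \<partial>lborel) = ennreal (\<integral>x. \<theta> x \<partial>lborel)"
    using assms(2) by (intro nn_integral_eq_integral) (auto simp: convolution_kernel_def)
  then have \<theta>: "mollifier \<theta>"
    using assms by (simp add: mollifier_def test_function_def convolution_kernel_def)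
  obtain \<rho> :: "real^'n \<Rightarrow> real" and Z where \<rho>: "convolution_kernel \<rho>" "even_fun \<rho>" "supp \<rho> \<subseteq> cball 0 1"
    "\<rho> \<in> borel_measurable borel" and Z: "Z > 0"
    and Z\<rho>: "\<And>x. ennreal (Z * \<rho> x) = indicator (cball 0 1) x + cone_average x"
    using averaging_kernel by metis
  define C where "C = Z * (B * (real CARD('n))\<^sup>2 + B * real CARD('n))"
  have "0 \<le> B" using KT(1)[of 0] by simp
  then have C: "0 \<le> C" using Z by (simp add: C_def)
  have AE: "AE x in lebesgue. ennreal \<bar>commutator u b divb \<theta> \<epsilon> x\<bar>
      \<le> ennreal C * Linf_norm_on (cball x \<epsilon>) u * measure_conv (total_variation Db) (rescale \<epsilon> \<rho>) x"
    if a: "Linfty u" "BV_loc b Db" "locally_integrable divb" "weak_divergence b divb" "\<epsilon> > 0" for u b Db divb \<epsilon>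
  proof -
    obtain P N where mu: "matrix_radon_measure Db P N"
      and deriv: "\<And>\<psi> i j. test_function \<psi> \<Longrightarrow>
        (\<integral>x. b x $ i * grad \<psi> x $ j \<partial>lebesgue) = - ((\<integral>x. \<psi> x \<partial>P i j) - (\<integral>x. \<psi> x \<partial>N i j))"
      using a(2) unfolding BV_loc_def derivative_measure_def by blast
    have "locally_integrable b" using a(2) by (simp add: BV_loc_def)
    then show ?thesis
      unfolding C_def by (intro commutator_AE_le[OF \<theta> KT(2,1) Z Z\<rho> a(1) _ mu deriv a(3,4,5)])
  qed
  have "(\<integral>\<^sup>+x. ennreal \<bar>commutator u b divb \<theta> \<epsilon> x * \<phi> x\<bar> \<partial>lebesgue)
      \<le> ennreal C * Linf_norm_on (closed_nbhd \<epsilon> (supp \<phi>)) u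
        * (\<integral>\<^sup>+x. abs_conv \<phi> (rescale \<epsilon> \<rho>) x \<partial>total_variation Db)"
    if "Linfty u" "BV_loc b Db" "locally_integrable divb" "weak_divergence b divb" "\<epsilon> > 0"
      "\<phi> \<in> borel_measurable lebesgue" for u b Db divb \<epsilon> \<phi>
  proof (rule nn_integral_commutator_le[OF _ that(6) _ _ _ AE[OF that(1-5)]])
    show "radon_measure (total_variation Db)"
      using that(2) radon_total_variation unfolding BV_loc_def derivative_measure_def by blast
    show "u \<in> borel_measurable lebesgue" using that(1) by (simp add: Linfty_def)
    show "rescale \<epsilon> \<rho> \<in> borel_measurable borel"
      using \<rho>(4) unfolding rescale_def by measurable
    show "even_fun (rescale \<epsilon> \<rho>)" using \<rho>(2) by (simp add: even_fun_def rescale_def)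
  qed
  with AE \<rho> C show ?thesis by (intro exI[of _ \<rho>] exI[of _ C]) blast
qed

end
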